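(* Let $n\ge 3$. The top degree homology groups of $T_n$ and of $\Pi_n$ are isomorphic as $\Sigma_n$-modules: $$\widetilde H_{n-3}(T_n)\;\cong_{\Sigma_n}\;\widetilde H_{n-3}(\Pi_n).$$
   Context: **Trees.** A tree is a cycle-free (connected) graph; vertices of degree $1$ are its leaves. A rooted tree has one vertex of degree $>1$ marked as root. Internal vertices are the vertices other than the leaves and the root; they are assumed to have degree at least $3$. Equivalently, all non-leaves have outdegree at least $2$, where the outdegree of a vertex is the number of adjacent edges not lying on the path between the vertex and the root. A rooted tree is binary if all non-leaves have outdegree exactly $2$. An internal edge is an edge not adjacent to a leaf; a rooted binary tree on $n$ leaves has exactly $n-2$ internal edges. The combinatorial type of a rooted tree with labelled leaves is its equivalence class under label- and root-preserving homeomorphisms of trees as $1$-dimensional cell complexes. **Complex of trees.** For $n\ge 3$, $T_n$ is the abstract simplicial complex whose maximal simplices are the combinatorial types of binary rooted trees with $n$ leaves labelled $1,\dots,n$, and whose lower dimensional simplices are obtained by contracting at most $n-3$ internal edges. Thus vertices are the types of rooted trees with leaves labelled $1,\dots,n$ having exactly one internal edge, and a tree with $m\ge1$ internal edges is the $(m-1)$-simplex whose vertices are the $m$ trees obtained from it by contracting all but one of its internal edges; faces correspond to contracting internal edges. (The tree without internal edges corresponds to the empty simplex.) The complex $T_n$ is pure of dimension $n-3$. **Partition lattice.** $\Pi_n$ is the lattice of set partitions of $[n]=\{1,\dots,n\}$, ordered by reversed refinement, so that $\hat 0$ is the partition into singletons and $\hat 1$ is the partition with one block. $\Delta(\Pi_n)$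 denotes the order complex of the proper part $\Pi_n\setminus\{\hat 0,\hat 1\}$, and $\widetilde H_*(\Pi_n)$ denotes the reduced simplicial homology $\widetilde H_*(\Delta(\Pi_n))$. **Actions.** The symmetric group $\Sigma_n$ acts on $T_n$ by permuting the leaf labels and on $\Pi_n$ (hence on $\Delta(\Pi_n)$) by permuting $[n]$; these induce the $\Sigma_n$-actions on reduced homology. Homology is taken with integer coefficients. *)

theory Defs
  imports
    "HOL-Algebra.Sym_Groups"
    "HOL-Library.Disjoint_Sets"
    "HOL-Combinatorics.Permutations"
begin

section \<open>Reduced simplicial homology with integer coefficients\<close>

text \<open>
  An abstract simplicial complex is a family \<open>K\<close> of finite sets closed under taking subsets,
  including the empty simplex. An oriented chain is a finitely supported integer function on the
  orderings of the simplices of \<open>K\<close> with \<open>k\<close> vertices (dimension \<open>k - 1\<close>) that changes by the sign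
  when the ordering is permuted; \<open>c xs\<close> is the coefficient of the oriented simplex \<open>[xs]\<close>, where
  reversing the orientation negates the simplex. The case \<open>k = 0\<close> is the augmentation term.
\<close>

definition oriented_chains :: "'a set set \<Rightarrow> nat \<Rightarrow> ('a list \<Rightarrow> int) set" where
  "oriented_chains K k =
    {c. finite {xs. c xs \<noteq> 0} \<and>
        (\<forall>xs. c xs \<noteq> 0 \<longrightarrow> distinct xs \<and> length xs = k \<and> set xs \<in> K) \<and>
        (\<forall>xs \<pi>. \<pi> permutes {..<length xs} \<longrightarrow> c (permute_list \<pi> xs) = sign \<pi> * c xs)}"

text \<open>
  The boundary of \<open>[v\<^sub>0,\<dots>,v\<^sub>p]\<close> is the sum over \<open>i\<close> of \<open>(-1)\<^sup>i\<close> times the oriented simplex with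
  \<open>v\<^sub>i\<close> omitted; here it is written in coefficients. Every simplex that has the ordered simplex \<open>xs\<close> as a facet has exactly one ordering of the form \<open>v # xs\<close>, and
  \<open>[xs]\<close> occurs in the boundary of \<open>[v # xs]\<close> with coefficient \<open>1\<close>.
\<close>

definition boundary :: "('a list \<Rightarrow> int) \<Rightarrow> 'a list \<Rightarrow> int" where
  "boundary c xs = (\<Sum>v | c (v # xs) \<noteq> 0. c (v # xs))"

definition cycles :: "'a set set \<Rightarrow> nat \<Rightarrow> ('a list \<Rightarrow> int) set" where
  "cycles K p = {c \<in> oriented_chains K (p + 1). boundary c = (\<lambda>_. 0)}"

definition boundaries :: "'a set set \<Rightarrow> nat \<Rightarrow> ('a list \<Rightarrow> int) set" where
  "boundaries K p = boundary ` oriented_chains K (p + 2)"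

definition cycle_group :: "'a set set \<Rightarrow> nat \<Rightarrow> ('a list \<Rightarrow> int) monoid" where
  "cycle_group K p = \<lparr>carrier = cycles K p, mult = (\<lambda>c d xs. c xs + d xs), one = (\<lambda>_. 0)\<rparr>"

definition reduced_simplicial_homology :: "'a set set \<Rightarrow> nat \<Rightarrow> ('a list \<Rightarrow> int) set monoid" where
  "reduced_simplicial_homology K p = cycle_group K p Mod boundaries K p"

text \<open>
  The chain map \<open>[v\<^sub>0,\<dots>,v\<^sub>p] \<mapsto> [f v\<^sub>0,\<dots>,f v\<^sub>p]\<close> of a simplicial map \<open>f\<close>. If \<open>f\<close> identifies two of
  the vertices, the contributions of the different orderings cancel, as they should.
\<close>

definition chain_map :: "('a \<Rightarrow> 'b) \<Rightarrow> ('a list \<Rightarrow> int) \<Rightarrow> 'b list \<Rightarrow> int" where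
  "chain_map f c ys = (\<Sum>xs | map f xs = ys \<and> c xs \<noteq> 0. c xs)"

text \<open>
  The induced map on homology into the complex \<open>L\<close>; homology classes are cosets, and the cosets of
  the images of all representatives of a class coincide.
\<close>

definition homology_map ::
  "'b set set \<Rightarrow> nat \<Rightarrow> ('a \<Rightarrow> 'b) \<Rightarrow> ('a list \<Rightarrow> int) set \<Rightarrow> ('b list \<Rightarrow> int) set" where
  "homology_map L p f X = (\<Union>c\<in>X. boundaries L p #>\<^bsub>cycle_group L p\<^esub> chain_map f c)"


section \<open>Modules over a group\<close>

definition group_module :: "('g, 'x) monoid_scheme \<Rightarrow> ('m, 'y) monoid_scheme \<Rightarrow> ('g \<Rightarrow> 'm \<Rightarrow> 'm) \<Rightarrow> bool" where
  "group_module G M act \<longleftrightarrow>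
    group G \<and> comm_group M \<and>
    (\<forall>g\<in>carrier G. act g \<in> hom M M) \<and>
    (\<forall>x\<in>carrier M. act \<one>\<^bsub>G\<^esub> x = x) \<and>
    (\<forall>g\<in>carrier G. \<forall>h\<in>carrier G. \<forall>x\<in>carrier M. act (g \<otimes>\<^bsub>G\<^esub> h) x = act g (act h x))"

definition isomorphic_group_modules ::
  "('g, 'x) monoid_scheme \<Rightarrow> ('m, 'y) monoid_scheme \<Rightarrow> ('g \<Rightarrow> 'm \<Rightarrow> 'm)
    \<Rightarrow> ('n, 'z) monoid_scheme \<Rightarrow> ('g \<Rightarrow> 'n \<Rightarrow> 'n) \<Rightarrow> bool" where
  "isomorphic_group_modules G M act N act' \<longleftrightarrow>
    group_module G M act \<and> group_module G N act' \<and>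
    (\<exists>\<phi>\<in>iso M N. \<forall>g\<in>carrier G. \<forall>x\<in>carrier M. \<phi> (act g x) = act' g (\<phi> x))"


section \<open>Trees\<close>

text \<open>\<open>leaf t i\<close> is the leaf with label \<open>i\<close>; its values outside the label set are irrelevant.\<close>

record 'v ltree =
  verts :: "'v set"
  edges :: "'v set set"
  root :: 'v
  leaf :: "nat \<Rightarrow> 'v"

definition is_path :: "'v set set \<Rightarrow> 'v list \<Rightarrow> bool" where
  "is_path E p \<longleftrightarrow> p \<noteq> [] \<and> distinct p \<and> successively (\<lambda>u v. {u, v} \<in> E) p"

definition path_edges :: "'v list \<Rightarrow> 'v set set" where
  "path_edges p = {{p ! i, p ! Suc i} | i. Suc i < length p}"

definition is_cycle :: "'v set set \<Rightarrow> 'v list \<Rightarrow> bool" where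
  "is_cycle E p \<longleftrightarrow> is_path E p \<and> length p \<ge> 3 \<and> {last p, hd p} \<in> E"

definition component_of :: "'v set set \<Rightarrow> 'v \<Rightarrow> 'v set" where
  "component_of E v = {w. (v, w) \<in> {(x, y). {x, y} \<in> E}\<^sup>*}"

definition degree :: "'v ltree \<Rightarrow> 'v \<Rightarrow> nat" where
  "degree t v = card {e \<in> edges t. v \<in> e}"

definition leaves :: "'v ltree \<Rightarrow> 'v set" where
  "leaves t = {v \<in> verts t. degree t v = 1}"

definition is_tree :: "'v ltree \<Rightarrow> bool" where
  "is_tree t \<longleftrightarrow>
    finite (verts t) \<and>
    (\<forall>e\<in>edges t. e \<subseteq> verts t \<and> card e = 2) \<and>
    (\<forall>u\<in>verts t. \<forall>v\<in>verts t. v \<in> component_of (edges t) u) \<and>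
    (\<nexists>p. is_cycle (edges t) p)"

definition rooted_tree :: "'v ltree \<Rightarrow> bool" where
  "rooted_tree t \<longleftrightarrow>
    is_tree t \<and> root t \<in> verts t \<and> degree t (root t) > 1 \<and>
    (\<forall>v \<in> verts t - leaves t - {root t}. degree t v \<ge> 3)"

definition labelled_tree :: "nat \<Rightarrow> 'v ltree \<Rightarrow> bool" where
  "labelled_tree n t \<longleftrightarrow> rooted_tree t \<and> bij_betw (leaf t) {1..n} (leaves t)"

definition outdegree :: "'v ltree \<Rightarrow> 'v \<Rightarrow> nat" where
  "outdegree t v = card {e \<in> edges t. v \<in> e \<and>
     \<not> (\<exists>p. is_path (edges t) p \<and> hd p = v \<and> last p = root t \<and> e \<in> path_edges p)}"

definition binary_tree :: "nat \<Rightarrow> 'v ltree \<Rightarrow> bool" where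
  "binary_tree n t \<longleftrightarrow> labelled_tree n t \<and> (\<forall>v \<in> verts t - leaves t. outdegree t v = 2)"

definition internal_edges :: "'v ltree \<Rightarrow> 'v set set" where
  "internal_edges t = {e \<in> edges t. e \<inter> leaves t = {}}"

text \<open>
  As the root is marked and all other non-leaves have degree at least three, label- and
  root-preserving homeomorphisms of cell complexes amount to graph isomorphisms preserving the
  root and the labels.
\<close>

definition isomorphic_trees :: "nat \<Rightarrow> 'v ltree \<Rightarrow> 'w ltree \<Rightarrow> bool" where
  "isomorphic_trees n t t' \<longleftrightarrow>
    (\<exists>f. bij_betw f (verts t) (verts t') \<and> edges t' = (\<lambda>e. f ` e) ` edges t \<and>
         root t' = f (root t) \<and> (\<forall>i\<in>{1..n}. leaf t' i = f (leaf t i)))"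

text \<open>
  Every finite tree has an isomorphic copy with vertices in \<^typ>\<open>nat\<close>, so the equivalence class
  among those trees determines the combinatorial type of a tree with vertices of any type.
\<close>

definition combinatorial_type :: "nat \<Rightarrow> 'v ltree \<Rightarrow> nat ltree set" where
  "combinatorial_type n t = {t'. isomorphic_trees n t t'}"

text \<open>
  Contraction of a set \<open>F\<close> of edges: the vertices are the connected components of the subgraph with
  edge set \<open>F\<close>.
\<close>

definition contract :: "'v ltree \<Rightarrow> 'v set set \<Rightarrow> 'v set ltree" where
  "contract t F =
    \<lparr>verts = component_of F ` verts t,
     edges = (\<lambda>e. component_of F ` e) ` (edges t - F),
     root = component_of F (root t),
     leaf = (\<lambda>i. component_of F (leaf t i))\<rparr>"


section \<open>The complex of trees\<close>

definition tree_simplex :: "nat \<Rightarrow> 'v ltree \<Rightarrow> nat ltree set set" where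
  "tree_simplex n t =
    {combinatorial_type n (contract t (internal_edges t - {e})) | e. e \<in> internal_edges t}"

text \<open>
  Contracting no edge yields the maximal simplices, contracting all internal edges the empty one.
\<close>

definition tree_complex :: "nat \<Rightarrow> nat ltree set set set" where
  "tree_complex n =
    {tree_simplex n (contract t F) | t F. binary_tree n (t :: nat ltree) \<and> F \<subseteq> internal_edges t}"

text \<open>The leaf labelled \<open>i\<close> is relabelled \<open>\<sigma> i\<close>.\<close>

definition relabel :: "(nat \<Rightarrow> nat) \<Rightarrow> 'v ltree \<Rightarrow> 'v ltree" where
  "relabel \<sigma> t = t\<lparr>leaf := leaf t \<circ> inv_into UNIV \<sigma>\<rparr>"

definition permute_type :: "(nat \<Rightarrow> nat) \<Rightarrow> nat ltree set \<Rightarrow> nat ltree set" where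
  "permute_type \<sigma> T = relabel \<sigma> ` T"


section \<open>The partition lattice\<close>

definition proper_partitions :: "nat \<Rightarrow> nat set set set" where
  "proper_partitions n = {P. partition_on {1..n} P} - {(\<lambda>i. {i}) ` {1..n}, {{1..n}}}"

definition order_complex :: "('a \<Rightarrow> 'a \<Rightarrow> bool) \<Rightarrow> 'a set \<Rightarrow> 'a set set" where
  "order_complex R A = {C. C \<subseteq> A \<and> finite C \<and> Complete_Partial_Order.chain R C}"

definition partition_complex :: "nat \<Rightarrow> nat set set set set" where
  "partition_complex n = order_complex (refines {1..n}) (proper_partitions n)"

definition permute_partition :: "(nat \<Rightarrow> nat) \<Rightarrow> nat set set \<Rightarrow> nat set set" where
  "permute_partition \<sigma> P = (\<lambda>B. \<sigma> ` B) ` P"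

end

theory Submission
  imports Defs
begin

text \<open>
  \<^bold>\<open>Nested clusters.\<close> Removing an internal edge from a rooted tree with labelled leaves cuts off a
  cluster, a set of at least two but not all labels. A tree with a single internal edge is determined by
  its cluster, and contracting other edges does not change the cluster of an edge
  (\<open>tree_simplex_contract\<close>). So \<open>T\<^sub>n\<close> is a
  complex whose simplices are laminar families of clusters: any two members are nested or
  disjoint. A laminar family has at most \<open>n - 2\<close> members, and those with exactly \<open>n - 2\<close> are
  the families of the binary trees (\<open>binary_tree_of_merge_order\<close>).

  \<^bold>\<open>Merge orders.\<close> List a maximal laminar family as \<open>B\<^sub>1, \<dots>, B\<^sub>n\<^sub>-\<^sub>2\<close>, smaller sets before the sets
  that contain them, and let \<open>P\<^sub>i\<close> be the partition formed by the maximal sets among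
  the singletons and \<open>B\<^sub>1, \<dots>, B\<^sub>i\<close>. A count of blocks shows that each \<open>B\<^sub>i\<close> is the union of exactly two
  blocks of \<open>P\<^sub>i\<^sub>-\<^sub>1\<close>, so \<open>P\<^sub>1 < \<dots> < P\<^sub>n\<^sub>-\<^sub>2\<close> is a maximal chain of proper partitions; every maximal chain
  arises from exactly one such merge order. Geometrically, \<open>\<Delta>(\<Pi>\<^sub>n)\<close> subdivides \<open>T\<^sub>n\<close>, and the
  simplices into which the simplex of a family is cut are the merge orders of this family.

  \<^bold>\<open>Comparing cycles.\<close> Neither complex has simplices of dimension \<open>n - 2\<close>, so homology classes
  in degree \<open>n - 3\<close> are just cycles. A chain of dimension \<open>n - 3\<close> on either complex has a value \<open>h\<close> at every merge
  order: its coefficient at the list of clusters, respectively at the list of partitions. The isomorphism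
  matches cycles with the same \<open>h\<close>, and the point is that both cycle
  conditions say the same about \<open>h\<close> (\<open>merge_order_cycle\<close>). Given a cycle of
  \<open>\<Pi>\<^sub>n\<close>, omit \<open>P\<^sub>i\<close> from a maximal chain.
    \<^item> If \<open>B\<^sub>i\<close> and \<open>B\<^sub>i\<^sub>+\<^sub>1\<close> are disjoint, just two partitions fill the gap, and they come from performing the two
      merges in either order. The two coefficients add up to zero: \<open>h\<close> changes sign when the two
      neighbours are swapped, as it does for an oriented simplex of \<open>T\<^sub>n\<close>.
    \<^item> If \<open>B\<^sub>i \<subseteq> B\<^sub>i\<^sub>+\<^sub>1\<close>, three blocks are being merged into one, and the gap can be filled in three
      ways. These are the three ways to complete the family without \<open>B\<^sub>i\<close>
      to a maximal one (\<open>merge_orders_exchange\<close>), that is, to expand the contracted edge of a tree again.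

  For \<open>\<Pi>\<^sub>n\<close> these conditions exhaust all facets of maximal chains
  (\<open>partition_cycle_iff\<close>). For \<open>T\<^sub>n\<close> the first holds for all oriented chains, and the second covers
  all facets, because every cluster can be listed immediately before the smallest member
  that properly contains it, or last if there is none (\<open>cycle_iff\<close>). Conversely, a function \<open>h\<close> satisfying the first condition is a chain
  of \<open>T\<^sub>n\<close>, since all merge orders of one family are connected by swaps of neighbours
  (\<open>merge_orders_sign\<close>). All constructions commute with permuting the labels.
\<close>

section \<open>Oriented chains\<close>

lemma permute_list_inj:
  assumes "distinct xs" "\<pi> permutes {..<length xs}" "\<rho> permutes {..<length xs}"
    and eq: "permute_list \<pi> xs = permute_list \<rho> xs"
  shows "\<pi> = \<rho>"
proof
  fix i
  show "\<pi> i = \<rho> i"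
  proof (cases "i < length xs")
    case True
    then have "xs ! \<pi> i = xs ! \<rho> i"
      using arg_cong[OF eq, of "\<lambda>l. l ! i"] permute_list_nth[OF assms(2)] permute_list_nth[OF assms(3)]
      by simp
    moreover have "\<pi> i < length xs" "\<rho> i < length xs"
      using True assms(2,3) by (metis lessThan_iff permutes_in_image)+
    ultimately show ?thesis using assms(1) nth_eq_iff_index_eq by blast
  next
    case False
    then show ?thesis using assms(2,3) by (simp add: permutes_def)
  qed
qed

lemma distinct_same_set_permute:
  assumes "distinct xs" "distinct ys" "set xs = set ys"
  obtains \<pi> where "\<pi> permutes {..<length xs}" "ys = permute_list \<pi> xs"
  using assms mset_eq_permutation[of ys xs] by (metis set_eq_iff_mset_eq_distinct)

lemma permute_list_inv:
  assumes "\<pi> permutes {..<length xs}"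
  shows "permute_list (inv' \<pi>) (permute_list \<pi> xs) = xs"
  using permute_list_compose[of "inv' \<pi>" xs \<pi>] assms permutes_inv[OF assms]
  by (simp add: permutes_inv_o(1))

lemma sign_compose_permutes:
  assumes "\<pi> permutes {..<k::nat}" "\<rho> permutes {..<k}"
  shows "sign (\<pi> \<circ> \<rho>) = sign \<pi> * sign \<rho>"
  using assms by (intro sign_compose) (auto simp: permutation_permutes)

lemma sign_inv_permutes:
  assumes "\<pi> permutes {..<k::nat}"
  shows "sign (inv' \<pi>) = sign \<pi>"
  using assms by (intro sign_inverse) (auto simp: permutation_permutes)

lemma oriented_chains_permute:
  assumes "c \<in> oriented_chains K k" "\<pi> permutes {..<length xs}"
  shows "c (permute_list \<pi> xs) = sign \<pi> * c xs"
  using assms by (auto simp: oriented_chains_def)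

lemma oriented_chains_support:
  assumes "c \<in> oriented_chains K k" "c xs \<noteq> 0"
  shows "distinct xs" "length xs = k" "set xs \<in> K"
  using assms by (auto simp: oriented_chains_def)

lemma oriented_chains_finite:
  assumes "c \<in> oriented_chains K k"
  shows "finite {xs. c xs \<noteq> 0}"
  using assms by (auto simp: oriented_chains_def)

lemma oriented_chains_zero: "(\<lambda>_. 0) \<in> oriented_chains K k"
  by (simp add: oriented_chains_def)

lemma oriented_chains_trivial:
  assumes "\<And>X. X \<in> K \<Longrightarrow> card X \<noteq> k"
  shows "oriented_chains K k = {\<lambda>_. 0}"
proof -
  have "c xs = 0" if "c \<in> oriented_chains K k" for c xs
    using oriented_chains_support[OF that, of xs] assms[of "set xs"] distinct_card[of xs] by auto
  then show ?thesis using oriented_chains_zero by fastforce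
qed

text \<open>
  An oriented chain is determined by its values on one ordering of each simplex.
\<close>

lemma oriented_chains_eqI:
  assumes c: "c \<in> oriented_chains K k" and d: "d \<in> oriented_chains K k"
    and w: "\<And>b. b \<in> M \<Longrightarrow> distinct (w b) \<and> length (w b) = k"
    and cover: "\<And>X. X \<in> K \<Longrightarrow> card X = k \<Longrightarrow> \<exists>b\<in>M. X = set (w b)"
    and agree: "\<And>b. b \<in> M \<Longrightarrow> c (w b) = d (w b)"
  shows "c = d"
proof
  fix xs
  show "c xs = d xs"
  proof (cases "c xs = 0 \<and> d xs = 0")
    case False
    then have xs: "distinct xs" "length xs = k" "set xs \<in> K"
      using oriented_chains_support[OF c] oriented_chains_support[OF d] by blast+
    then obtain b where b: "b \<in> M" "set xs = set (w b)"
      using cover[of "set xs"] distinct_card by metis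
    obtain \<pi> where \<pi>: "\<pi> permutes {..<length (w b)}" "xs = permute_list \<pi> (w b)"
      using distinct_same_set_permute[of "w b" xs] w b xs by metis
    then show ?thesis
      using oriented_chains_permute[OF c \<pi>(1)] oriented_chains_permute[OF d \<pi>(1)] agree b by simp
  qed simp
qed

text \<open>
  Values prescribed on some orderings \<open>w b\<close> extend to an oriented chain as soon as they obey the sign
  rule wherever two of the orderings list the same simplex.
\<close>

lemma oriented_chain_extension:
  assumes fin: "finite M"
    and w: "\<And>b. b \<in> M \<Longrightarrow> distinct (w b) \<and> length (w b) = k \<and> set (w b) \<in> K"
    and compat: "\<And>b b' \<pi>. b \<in> M \<Longrightarrow> b' \<in> M \<Longrightarrow> \<pi> permutes {..<k} \<Longrightarrow>
        w b' = permute_list \<pi> (w b) \<Longrightarrow> h b' = sign \<pi> * h b"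
  obtains c where "c \<in> oriented_chains K k" "\<And>b. b \<in> M \<Longrightarrow> c (w b) = h b"
proof -
  define good where
    "good xs p \<longleftrightarrow> fst p \<in> M \<and> snd p permutes {..<k} \<and> xs = permute_list (snd p) (w (fst p))"
    for xs p
  define c where
    "c xs = (if \<exists>p. good xs p then let p = SOME p. good xs p in sign (snd p) * h (fst p) else 0)"
    for xs
  have c_eq: "c xs = sign \<pi> * h b" if "good xs (b, \<pi>)" for xs b \<pi>
  proof -
    define p where "p = (SOME p. good xs p)"
    obtain b' \<pi>' where p: "p = (b', \<pi>')" by fastforce
    have "good xs p" unfolding p_def using that by (rule someI)
    then have g: "b' \<in> M" "\<pi>' permutes {..<k}" "xs = permute_list \<pi>' (w b')"
      unfolding p good_def by auto
    have g': "b \<in> M" "\<pi> permutes {..<k}" "xs = permute_list \<pi> (w b)"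
      using that unfolding good_def by auto
    have i: "inv' \<pi>' permutes {..<k}" using g(2) by (rule permutes_inv)
    have "w b' = permute_list (inv' \<pi>') (permute_list \<pi> (w b))"
      using permute_list_inv[of \<pi>' "w b'"] g g' w by simp
    also have "\<dots> = permute_list (\<pi> \<circ> inv' \<pi>') (w b)"
      using w g' i by (simp add: permute_list_compose)
    finally have "h b' = sign (\<pi> \<circ> inv' \<pi>') * h b"
      using compat[OF g'(1) g(1) permutes_compose[OF i g'(2)]] by simp
    then have "sign \<pi>' * h b' = sign \<pi> * h b"
      using g g' i by (simp add: sign_compose_permutes sign_inv_permutes)
    then show ?thesis
      using that unfolding c_def Let_def p_def[symmetric] p by auto
  qed
  have supp: "\<exists>b\<in>M. \<exists>\<pi>. \<pi> permutes {..<k} \<and> xs = permute_list \<pi> (w b)" if "c xs \<noteq> 0" for xs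
    using that by (auto simp: c_def good_def split: if_splits)
  have supp': "distinct xs \<and> length xs = k \<and> set xs \<in> K" if "c xs \<noteq> 0" for xs
  proof -
    obtain b \<pi> where "b \<in> M" "\<pi> permutes {..<k}" "xs = permute_list \<pi> (w b)"
      using supp \<open>c xs \<noteq> 0\<close> by blast
    then show ?thesis using w[of b] by simp
  qed
  have "{xs. c xs \<noteq> 0} \<subseteq> (\<lambda>(b, \<pi>). permute_list \<pi> (w b)) ` (M \<times> {\<pi>. \<pi> permutes {..<k}})"
    using supp by fast
  then have finc: "finite {xs. c xs \<noteq> 0}"
    by (rule finite_subset) (use fin finite_permutations in blast)
  have alt: "c (permute_list \<rho> xs) = sign \<rho> * c xs" if \<rho>: "\<rho> permutes {..<length xs}" for xs \<rho>
  proof (cases "\<exists>p. good xs p")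
    case True
    then obtain b \<pi> where g: "b \<in> M" "\<pi> permutes {..<k}" "xs = permute_list \<pi> (w b)" "good xs (b, \<pi>)"
      unfolding good_def by fastforce
    then have len: "length xs = k" using w by simp
    have "permute_list \<rho> xs = permute_list (\<pi> \<circ> \<rho>) (w b)"
      using g w \<rho> len by (simp add: permute_list_compose)
    then have "good (permute_list \<rho> xs) (b, \<pi> \<circ> \<rho>)"
      using g \<rho> len by (simp add: good_def permutes_compose)
    then show ?thesis
      using c_eq[of "permute_list \<rho> xs"] c_eq[OF g(4)] g \<rho> len by (simp add: sign_compose_permutes)
  next
    case False
    have "\<not> good (permute_list \<rho> xs) p" for p
    proof
      assume g: "good (permute_list \<rho> xs) p"
      then have len: "length xs = k"
        using w unfolding good_def by (metis length_permute_list)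
      have "inv' \<rho> permutes {..<k}" using \<rho> len by (simp add: permutes_inv)
      then have "good xs (fst p, snd p \<circ> inv' \<rho>)"
        using g w \<rho> permute_list_inv[OF \<rho>] len
        by (auto simp: good_def permute_list_compose permutes_compose)
      then show False using False by blast
    qed
    then show ?thesis using False by (simp add: c_def)
  qed
  have "c \<in> oriented_chains K k"
    using finc supp' alt by (auto simp: oriented_chains_def)
  moreover have "c (w b) = h b" if "b \<in> M" for b
    using c_eq[of "w b" b id] that by (simp add: good_def permutes_id)
  ultimately show ?thesis using that by blast
qed

text \<open>
  The boundary is defined through lists that start with the additional vertex. The later sums put this vertex at
  the place where it belongs in a given ordering, which only changes the sum by a sign. By
  antisymmetry it suffices to test one ordering for each pair of a simplex and one of its vertices.
\<close>

lemma boundary_zero_iff: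
  assumes c: "c \<in> oriented_chains K k"
    and cover: "\<And>X v. X \<in> K \<Longrightarrow> card X = k \<Longrightarrow> v \<in> X \<Longrightarrow>
        \<exists>(xs, ys)\<in>I. distinct (xs @ v # ys) \<and> X = set (xs @ v # ys)"
  shows "boundary c = (\<lambda>_. 0) \<longleftrightarrow>
    (\<forall>(xs, ys)\<in>I. (\<Sum>v | c (xs @ v # ys) \<noteq> 0. c (xs @ v # ys)) = 0)"
proof -
  \<comment> \<open>Moving the free vertex costs a sign that does not depend on this vertex.\<close>
  have move: "\<exists>s. s \<noteq> 0 \<and> (\<forall>v. c (v # zs) = s * c (xs @ v # ys))"
    if dz: "distinct (v0 # zs)" and dl: "distinct (xs @ v0 # ys)" and same: "set (v0 # zs) = set (xs @ v0 # ys)"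
    for v0 xs ys zs
  proof -
    let ?l = "xs @ v0 # ys" and ?i = "length xs"
    obtain \<pi> where \<pi>: "\<pi> permutes {..<length ?l}" "v0 # zs = permute_list \<pi> ?l"
      using distinct_same_set_permute[OF dl dz same[symmetric]] by blast
    have len: "length (v0 # zs) = length ?l" using \<pi>(2) by (metis length_permute_list)
    have nth: "(v0 # zs) ! j = ?l ! \<pi> j" if "j < length ?l" for j
      using permute_list_nth[OF \<pi>(1) that] \<pi>(2) by simp
    have bound: "\<pi> j < length ?l" if "j < length ?l" for j
      using \<pi>(1) that by (metis lessThan_iff permutes_in_image)
    have "\<pi> 0 = ?i"
    proof -
      have "?l ! \<pi> 0 = ?l ! ?i" using nth[of 0] by simp
      then show ?thesis using dl bound[of 0] nth_eq_iff_index_eq[of ?l "\<pi> 0" ?i] by simp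
    qed
    then have ne: "\<pi> j \<noteq> ?i" if "j \<noteq> 0" for j
      using permutes_inj[OF \<pi>(1)] that by (metis injD)
    have "v # zs = permute_list \<pi> (xs @ v # ys)" for v
    proof (rule nth_equalityI)
      show "length (v # zs) = length (permute_list \<pi> (xs @ v # ys))" using len by simp
      fix j assume "j < length (v # zs)"
      then have j: "j < length ?l" using len by simp
      have p: "permute_list \<pi> (xs @ v # ys) ! j = (xs @ v # ys) ! \<pi> j"
        by (rule permute_list_nth) (use \<pi>(1) j in auto)
      show "(v # zs) ! j = permute_list \<pi> (xs @ v # ys) ! j"
      proof (cases "j = 0")
        case True then show ?thesis using p \<open>\<pi> 0 = ?i\<close> by simp
      next
        case False
        then have "(v # zs) ! j = ?l ! \<pi> j" using nth[OF j] by (simp add: nth_Cons')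
        also have "\<dots> = (xs @ v # ys) ! \<pi> j"
          using ne[OF False] by (auto simp: nth_append nth_Cons')
        finally show ?thesis using p by simp
      qed
    qed
    then have "c (v # zs) = sign \<pi> * c (xs @ v # ys)" for v
      using oriented_chains_permute[OF c, of \<pi> "xs @ v # ys"] \<pi>(1) by simp
    then show ?thesis using sign_nz by metis
  qed
  have sums: "(\<Sum>v | c (v # zs) \<noteq> 0. c (v # zs)) = s * (\<Sum>v | c (xs @ v # ys) \<noteq> 0. c (xs @ v # ys))"
    if "s \<noteq> 0" "\<forall>v. c (v # zs) = s * c (xs @ v # ys)" for s zs xs ys
    using that by (simp add: sum_distrib_left)
  show ?thesis
  proof
    assume b: "boundary c = (\<lambda>_. 0)"
    show "\<forall>(xs, ys)\<in>I. (\<Sum>v | c (xs @ v # ys) \<noteq> 0. c (xs @ v # ys)) = 0"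
    proof clarify
      fix xs ys
      show "(\<Sum>v | c (xs @ v # ys) \<noteq> 0. c (xs @ v # ys)) = 0"
      proof (cases "\<exists>v. c (xs @ v # ys) \<noteq> 0")
        case True
        then obtain v where "c (xs @ v # ys) \<noteq> 0" by blast
        then have "distinct (xs @ v # ys)" using oriented_chains_support[OF c] by blast
        then obtain s where s: "s \<noteq> 0" "\<forall>v. c (v # xs @ ys) = s * c (xs @ v # ys)"
          using move[of v "xs @ ys" xs ys] by auto
        have "boundary c (xs @ ys) = 0" using b by simp
        then show ?thesis using sums[OF s] s(1) by (simp add: boundary_def)
      qed simp
    qed
  next
    assume I: "\<forall>(xs, ys)\<in>I. (\<Sum>v | c (xs @ v # ys) \<noteq> 0. c (xs @ v # ys)) = 0"
    show "boundary c = (\<lambda>_. 0)"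
    proof
      fix zs
      show "boundary c zs = 0"
      proof (cases "\<exists>v. c (v # zs) \<noteq> 0")
        case True
        then obtain v where "c (v # zs) \<noteq> 0" by blast
        then have v: "distinct (v # zs)" "length (v # zs) = k" "set (v # zs) \<in> K"
          using oriented_chains_support[OF c] by blast+
        have "card (set (v # zs)) = k" using distinct_card[OF v(1)] v(2) by metis
        then have "\<exists>(xs, ys)\<in>I. distinct (xs @ v # ys) \<and> set (v # zs) = set (xs @ v # ys)"
          by (rule cover[OF v(3)]) simp
        then obtain xs ys where xy: "(xs, ys) \<in> I" "distinct (xs @ v # ys)" "set (v # zs) = set (xs @ v # ys)"
          by blast
        then obtain s where s: "s \<noteq> 0" "\<forall>v. c (v # zs) = s * c (xs @ v # ys)"
          using move[OF v(1) xy(2,3)] by blast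
        show ?thesis using sums[OF s] I xy(1) by (auto simp: boundary_def)
      qed (simp add: boundary_def)
    qed
  qed
qed

section \<open>Homology in the top degree\<close>

lemma boundary_zero: "boundary (\<lambda>_. 0) = (\<lambda>_. 0)"
  by (simp add: boundary_def fun_eq_iff)

lemma boundary_add:
  assumes c: "c \<in> oriented_chains K k" and d: "d \<in> oriented_chains K k"
  shows "boundary (\<lambda>xs. c xs + d xs) xs = boundary c xs + boundary d xs"
proof -
  have fin: "finite {v. e (v # xs) \<noteq> 0}" if "e \<in> oriented_chains K k" for e
  proof -
    have "(\<lambda>v. v # xs) ` {v. e (v # xs) \<noteq> 0} \<subseteq> {ys. e ys \<noteq> 0}" by auto
    then show ?thesis
      using oriented_chains_finite[OF that] finite_imageD[of "\<lambda>v. v # xs"] finite_subset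
      by (metis (no_types, lifting) inj_onI list.inject)
  qed
  define S where "S = {v. c (v # xs) \<noteq> 0} \<union> {v. d (v # xs) \<noteq> 0}"
  have S: "finite S" unfolding S_def using fin[OF c] fin[OF d] by blast
  have "boundary e xs = (\<Sum>v\<in>S. e (v # xs))" if "{v. e (v # xs) \<noteq> 0} \<subseteq> S" for e :: "'a list \<Rightarrow> int"
    unfolding boundary_def by (rule sum.mono_neutral_left[OF S that]) auto
  moreover have "{v. c (v # xs) + d (v # xs) \<noteq> 0} \<subseteq> S" by (auto simp: S_def)
  ultimately show ?thesis by (simp add: S_def sum.distrib)
qed

lemma oriented_chains_add:
  assumes c: "c \<in> oriented_chains K k" and d: "d \<in> oriented_chains K k"
  shows "(\<lambda>xs. c xs + d xs) \<in> oriented_chains K k"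
proof -
  have "{xs. c xs + d xs \<noteq> 0} \<subseteq> {xs. c xs \<noteq> 0} \<union> {xs. d xs \<noteq> 0}" by auto
  then have "finite {xs. c xs + d xs \<noteq> 0}"
    using oriented_chains_finite[OF c] oriented_chains_finite[OF d] by (meson finite_UnI finite_subset)
  moreover have "distinct xs \<and> length xs = k \<and> set xs \<in> K" if "c xs + d xs \<noteq> 0" for xs
  proof -
    have "c xs \<noteq> 0 \<or> d xs \<noteq> 0" using that by auto
    then show ?thesis using oriented_chains_support[OF c] oriented_chains_support[OF d] by blast
  qed
  ultimately show ?thesis
    using oriented_chains_permute[OF c] oriented_chains_permute[OF d]
    by (simp add: oriented_chains_def distrib_left)
qed

lemma oriented_chains_uminus:
  assumes c: "c \<in> oriented_chains K k"
  shows "(\<lambda>xs. - c xs) \<in> oriented_chains K k"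
  using c by (simp add: oriented_chains_def)

lemma cycles_add:
  assumes "c \<in> cycles K p" "d \<in> cycles K p"
  shows "(\<lambda>xs. c xs + d xs) \<in> cycles K p"
  using assms boundary_add[of c K "p + 1" d]
  by (auto simp: cycles_def oriented_chains_add)

lemma cycles_uminus:
  assumes "c \<in> cycles K p"
  shows "(\<lambda>xs. - c xs) \<in> cycles K p"
proof -
  have "boundary (\<lambda>xs. - c xs) xs = - boundary c xs" for xs
    by (simp add: boundary_def sum_negf)
  then show ?thesis using assms by (auto simp: cycles_def oriented_chains_uminus)
qed

text \<open>
  In the top degree there is nothing to divide by, and homology classes are singletons.
\<close>

lemma boundaries_trivial:
  assumes "\<And>X. X \<in> K \<Longrightarrow> card X \<noteq> p + 2"
  shows "boundaries K p = {\<lambda>_. 0}"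
  using oriented_chains_trivial[OF assms] by (simp add: boundaries_def boundary_zero)

lemma top_homology:
  assumes "\<And>X. X \<in> K \<Longrightarrow> card X \<noteq> p + 2"
  shows "carrier (reduced_simplicial_homology K p) = (\<lambda>c. {c}) ` cycles K p"
    and "{c} \<otimes>\<^bsub>reduced_simplicial_homology K p\<^esub> {d} = {\<lambda>xs. c xs + d xs}"
    and "\<one>\<^bsub>reduced_simplicial_homology K p\<^esub> = {\<lambda>_. 0}"
    and "homology_map K p f {c} = {chain_map f c}"
  using boundaries_trivial[OF assms]
  by (auto simp: reduced_simplicial_homology_def FactGroup_def RCOSETS_def r_coset_def set_mult_def
      cycle_group_def homology_map_def)

lemma comm_group_top_homology:
  assumes "\<And>X. X \<in> K \<Longrightarrow> card X \<noteq> p + 2"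
  shows "comm_group (reduced_simplicial_homology K p)"
proof (rule comm_groupI)
  note top = top_homology[OF assms]
  show "\<exists>y\<in>carrier (reduced_simplicial_homology K p).
      y \<otimes>\<^bsub>reduced_simplicial_homology K p\<^esub> x = \<one>\<^bsub>reduced_simplicial_homology K p\<^esub>"
    if x: "x \<in> carrier (reduced_simplicial_homology K p)" for x
  proof -
    obtain c where "x = {c}" "c \<in> cycles K p" using x top by auto
    then show ?thesis using cycles_uminus[of c K p]
      by (intro bexI[of _ "{\<lambda>xs. - c xs}"]) (auto simp: top)
  qed
  have "(\<lambda>_. 0) \<in> cycles K p" by (simp add: cycles_def oriented_chains_zero boundary_zero)
  then show "\<one>\<^bsub>reduced_simplicial_homology K p\<^esub> \<in> carrier (reduced_simplicial_homology K p)"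
    by (simp add: top)
qed (auto simp: top_homology[OF assms] cycles_add algebra_simps)

text \<open>
  For a bijection the sum in the definition has at most one term.
\<close>

lemma chain_map_bij:
  assumes "bij f"
  shows "chain_map f c = (\<lambda>ys. c (map (inv' f) ys))"
proof
  fix ys
  have "map f xs = ys \<longleftrightarrow> xs = map (inv' f) ys" for xs
  proof
    show "xs = map (inv' f) ys" if "map f xs = ys"
      using that bij_is_inj[OF assms] by auto
    show "map f xs = ys" if "xs = map (inv' f) ys"
      using that surj_iff[of f] bij_is_surj[OF assms] by (simp add: o_def fun_eq_iff)
  qed
  then have "{xs. map f xs = ys \<and> c xs \<noteq> 0} = (if c (map (inv' f) ys) = 0 then {} else {map (inv' f) ys})"
    by auto
  then show "chain_map f c ys = c (map (inv' f) ys)" by (simp add: chain_map_def)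
qed

lemma chain_map_cycle:
  assumes f: "bij f" and K: "\<And>X. X \<in> K \<Longrightarrow> card X = p + 1 \<Longrightarrow> f ` X \<in> K"
    and c: "c \<in> cycles K p"
  shows "chain_map f c \<in> cycles K p"
proof -
  let ?g = "inv' f"
  have g: "bij ?g" using f by (rule bij_imp_bij_inv)
  have fg: "f (?g x) = x" for x using f by (simp add: bij_is_surj surj_f_inv_f)
  have gf: "?g (f x) = x" for x using f by (simp add: bij_is_inj)
  have oc: "c \<in> oriented_chains K (p + 1)" using c by (simp add: cycles_def)
  let ?d = "\<lambda>ys. c (map ?g ys)"
  have "{ys. ?d ys \<noteq> 0} \<subseteq> map f ` {xs. c xs \<noteq> 0}"
  proof
    fix ys assume "ys \<in> {ys. ?d ys \<noteq> 0}"
    then show "ys \<in> map f ` {xs. c xs \<noteq> 0}"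
      by (intro image_eqI[of _ _ "map ?g ys"]) (auto simp: o_def fg)
  qed
  then have fin: "finite {ys. ?d ys \<noteq> 0}"
    using oriented_chains_finite[OF oc] finite_subset by blast
  have supp: "distinct ys \<and> length ys = p + 1 \<and> set ys \<in> K" if "?d ys \<noteq> 0" for ys
  proof -
    note s = oriented_chains_support[OF oc that]
    have "f ` set (map ?g ys) \<in> K" using K[OF s(3)] s(1,2) distinct_card[OF s(1)] by simp
    moreover have "f ` set (map ?g ys) = set ys" by (force simp: fg)
    ultimately show ?thesis using s by (auto simp: distinct_map)
  qed
  have "?d (permute_list \<pi> ys) = sign \<pi> * ?d ys" if "\<pi> permutes {..<length ys}" for \<pi> ys
    using oriented_chains_permute[OF oc, of \<pi> "map ?g ys"] that by (simp add: permute_list_map)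
  then have "?d \<in> oriented_chains K (p + 1)" using fin supp by (simp add: oriented_chains_def)
  moreover have "boundary ?d ys = 0" for ys
  proof -
    have "boundary ?d ys = (\<Sum>v | c (?g v # map ?g ys) \<noteq> 0. c (?g v # map ?g ys))"
      by (simp add: boundary_def)
    also have "\<dots> = boundary c (map ?g ys)"
      unfolding boundary_def
      by (rule sum.reindex_bij_witness[of _ f ?g]) (auto simp: fg gf)
    finally show ?thesis using c by (simp add: cycles_def)
  qed
  ultimately show ?thesis by (simp add: chain_map_bij[OF f] cycles_def fun_eq_iff)
qed

lemma group_module_top_homology:
  assumes G: "group G" and top: "\<And>X. X \<in> K \<Longrightarrow> card X \<noteq> p + 2"
    and bij: "\<And>g. g \<in> carrier G \<Longrightarrow> bij (f g)"
    and one: "f \<one>\<^bsub>G\<^esub> = id"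
    and mult: "\<And>g h. g \<in> carrier G \<Longrightarrow> h \<in> carrier G \<Longrightarrow> f (g \<otimes>\<^bsub>G\<^esub> h) = f g \<circ> f h"
    and K: "\<And>g X. g \<in> carrier G \<Longrightarrow> X \<in> K \<Longrightarrow> card X = p + 1 \<Longrightarrow> f g ` X \<in> K"
  shows "group_module G (reduced_simplicial_homology K p) (\<lambda>g. homology_map K p (f g))"
proof -
  note t = top_homology[OF top]
  have "chain_map (f (g \<otimes>\<^bsub>G\<^esub> h)) c = chain_map (f g) (chain_map (f h) c)"
    if "g \<in> carrier G" "h \<in> carrier G" for g h c
    using that by (simp add: mult chain_map_bij bij bij_comp o_inv_distrib)
  moreover have "chain_map (f g) (\<lambda>xs. c xs + d xs) = (\<lambda>xs. chain_map (f g) c xs + chain_map (f g) d xs)"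
    if "g \<in> carrier G" for g c d
    using that by (simp add: chain_map_bij bij)
  moreover have "chain_map (f g) c \<in> cycles K p" if "g \<in> carrier G" "c \<in> cycles K p" for g c
    using chain_map_cycle[of "f g" K p c] bij K that by blast
  moreover have "chain_map id c = c" for c :: "'c list \<Rightarrow> int" by (simp add: chain_map_bij)
  ultimately show ?thesis
    using G comm_group_top_homology[OF top]
    by (auto simp: group_module_def t one hom_def)
qed

text \<open>
  As homology classes are single cycles here, an additive bijection between the cycles induces the isomorphism.
\<close>

lemma isomorphic_top_homology:
  assumes topK: "\<And>X. X \<in> K \<Longrightarrow> card X \<noteq> p + 2" and topL: "\<And>X. X \<in> L \<Longrightarrow> card X \<noteq> p + 2"
    and modK: "group_module G (reduced_simplicial_homology K p) (\<lambda>g. homology_map K p (f g))"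
    and modL: "group_module G (reduced_simplicial_homology L p) (\<lambda>g. homology_map L p (f' g))"
    and bij: "bij_betw \<phi> (cycles K p) (cycles L p)"
    and add: "\<And>c d. c \<in> cycles K p \<Longrightarrow> d \<in> cycles K p \<Longrightarrow> \<phi> (\<lambda>xs. c xs + d xs) = (\<lambda>xs. \<phi> c xs + \<phi> d xs)"
    and equiv: "\<And>g c. g \<in> carrier G \<Longrightarrow> c \<in> cycles K p \<Longrightarrow> \<phi> (chain_map (f g) c) = chain_map (f' g) (\<phi> c)"
  shows "isomorphic_group_modules G
    (reduced_simplicial_homology K p) (\<lambda>g. homology_map K p (f g))
    (reduced_simplicial_homology L p) (\<lambda>g. homology_map L p (f' g))"
proof -
  note tK = top_homology[OF topK] and tL = top_homology[OF topL]
  have "bij_betw ((`) \<phi>) (carrier (reduced_simplicial_homology K p)) (carrier (reduced_simplicial_homology L p))"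
    using bij by (auto simp: tK tL bij_betw_def inj_on_def image_image)
  moreover have "\<phi> c \<in> cycles L p" if "c \<in> cycles K p" for c using bij that by (auto simp: bij_betw_def)
  ultimately have "(`) \<phi> \<in> iso (reduced_simplicial_homology K p) (reduced_simplicial_homology L p)"
    by (auto simp: iso_def hom_def tK tL add)
  then show ?thesis
    unfolding isomorphic_group_modules_def
    using modK modL equiv by (intro conjI bexI[of _ "(`) \<phi>"]) (auto simp: tK tL)
qed

section \<open>Merging blocks of a partition\<close>

text \<open>
  When \<open>B\<close> is a union of blocks of \<open>P\<close>, this is the partition in which these blocks are replaced by \<open>B\<close>.
\<close>

definition merge :: "'a set set \<Rightarrow> 'a set \<Rightarrow> 'a set set" where
  "merge P B = insert B {X \<in> P. \<not> X \<subseteq> B}"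

definition mergeable :: "'a set set \<Rightarrow> 'a set \<Rightarrow> bool" where
  "mergeable P B \<longleftrightarrow> (\<exists>X\<in>P. \<exists>Y\<in>P. X \<noteq> Y \<and> B = X \<union> Y)"

fun merge_seq :: "'a set set \<Rightarrow> 'a set list \<Rightarrow> bool" where
  "merge_seq P [] \<longleftrightarrow> True"
| "merge_seq P (B # Bs) \<longleftrightarrow> mergeable P B \<and> merge_seq (merge P B) Bs"

fun merges :: "'a set set \<Rightarrow> 'a set list \<Rightarrow> 'a set set list" where
  "merges P [] = []"
| "merges P (B # Bs) = merge P B # merges (merge P B) Bs"

lemma merge_seq_append: "merge_seq P (xs @ ys) \<longleftrightarrow> merge_seq P xs \<and> merge_seq (foldl merge P xs) ys"
  by (induction xs arbitrary: P) auto

lemma merges_append: "merges P (xs @ ys) = merges P xs @ merges (foldl merge P xs) ys"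
  by (induction xs arbitrary: P) auto

lemma length_merges [simp]: "length (merges P xs) = length xs"
  by (induction xs arbitrary: P) auto

lemma partition_on_blocks:
  assumes "partition_on U P" "X \<in> P" "Y \<in> P"
  shows "X \<noteq> {}" "X \<subseteq> U" "X \<noteq> Y \<Longrightarrow> X \<inter> Y = {}"
  using assms by (auto simp: partition_on_def disjoint_def)

lemma block_subset_Union:
  assumes "partition_on U P" "S \<subseteq> P" "X \<in> P"
  shows "X \<subseteq> \<Union>S \<longleftrightarrow> X \<in> S"
proof
  assume X: "X \<subseteq> \<Union>S"
  obtain x where "x \<in> X" using partition_on_blocks[OF assms(1,3,3)] by blast
  then obtain Y where "Y \<in> S" "x \<in> Y" using X by blast
  then have "X = Y" using partition_on_blocks(3)[OF assms(1,3), of Y] \<open>x \<in> X\<close> assms(2) by blast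
  then show "X \<in> S" using \<open>Y \<in> S\<close> by simp
qed blast

lemma merge_Union:
  assumes P: "partition_on U P" and fin: "finite U" and S: "S \<subseteq> P" "S \<noteq> {}"
  shows "merge P (\<Union>S) = insert (\<Union>S) (P - S)" "partition_on U (merge P (\<Union>S))"
    "card (merge P (\<Union>S)) + card S = card P + 1"
proof -
  have finP: "finite P" using fin P by (rule finite_elements)
  show eq: "merge P (\<Union>S) = insert (\<Union>S) (P - S)"
    using block_subset_Union[OF P S(1)] by (auto simp: merge_def)
  have disj: "X \<inter> \<Union>S = {}" if "X \<in> P - S" for X
    using that S(1) partition_on_blocks(3)[OF P] by blast
  have ne: "\<Union>S \<noteq> {}" using S partition_on_blocks(1)[OF P] by blast
  show "partition_on U (merge P (\<Union>S))"
    unfolding eq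
  proof (rule partition_onI)
    show "\<Union> (insert (\<Union> S) (P - S)) = U" using partition_onD1[OF P] S(1) by auto
    show "{} \<notin> insert (\<Union> S) (P - S)" using ne partition_on_blocks(1)[OF P] by blast
    show "disjnt p q" if "p \<in> insert (\<Union> S) (P - S)" "q \<in> insert (\<Union> S) (P - S)" "p \<noteq> q" for p q
      using that disj[of p] disj[of q] partition_on_blocks(3)[OF P, of p q] by (auto simp: disjnt_def)
  qed
  have "\<Union>S \<notin> P - S" using disj[of "\<Union>S"] ne by blast
  moreover have "card (P - S) = card P - card S" "card S \<le> card P"
    using S(1) finP by (auto simp: card_Diff_subset finite_subset card_mono)
  ultimately show "card (merge P (\<Union>S)) + card S = card P + 1"
    unfolding eq using finP by simp
qed

lemma mergeable_blocks:
  assumes "mergeable P B"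
  obtains X Y where "X \<in> P" "Y \<in> P" "X \<noteq> Y" "B = \<Union>{X, Y}"
  using assms by (auto simp: mergeable_def)

lemma merge_mergeable:
  assumes P: "partition_on U P" and fin: "finite U" and B: "mergeable P B"
  shows "partition_on U (merge P B)" "card (merge P B) + 1 = card P" "B \<notin> P" "B \<noteq> {}" "B \<subseteq> U"
    "refines U P (merge P B)"
proof -
  obtain X Y where XY: "X \<in> P" "Y \<in> P" "X \<noteq> Y" "B = \<Union>{X, Y}" using B by (rule mergeable_blocks)
  note m = merge_Union[OF P fin, of "{X, Y}"]
  show part: "partition_on U (merge P B)" using m(2) XY by simp
  show "card (merge P B) + 1 = card P" using m(3) XY by simp
  show "B \<notin> P"
    using XY partition_on_blocks[OF P] by (metis Sup_insert Un_upper1 Un_upper2 Int_absorb2 ccpo_Sup_singleton)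
  show "B \<noteq> {}" "B \<subseteq> U" using XY partition_on_blocks[OF P] by auto
  show "refines U P (merge P B)" using P part by (auto simp: refines_def merge_def)
qed

text \<open>
  Each step of a merge sequence costs one block, so lengths of sequences can be read off block counts.
\<close>

lemma merge_seq_partition:
  assumes "partition_on U P" "finite U" "merge_seq P xs"
  shows "partition_on U (foldl merge P xs) \<and> card (foldl merge P xs) + length xs = card P"
  using assms(1,3)
proof (induction xs arbitrary: P)
  case (Cons B xs)
  then show ?case using merge_mergeable(1,2)[OF Cons.prems(1) assms(2), of B] by fastforce
qed simp

lemma merge_seq_merges:
  assumes "partition_on U P" "finite U" "merge_seq P xs" "i < length xs"
  shows "refines U P (merges P xs ! i) \<and> card (merges P xs ! i) + Suc i = card P"
  using assms(1,3,4)
proof (induction xs arbitrary: P i)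
  case (Cons B xs)
  note m = merge_mergeable[OF Cons.prems(1) assms(2), of B]
  show ?case
  proof (cases i)
    case 0
    then show ?thesis using m(2,6) Cons.prems by simp
  next
    case (Suc j)
    have "refines U (merge P B) (merges (merge P B) xs ! j) \<and>
        card (merges (merge P B) xs ! j) + Suc j = card (merge P B)"
      using Cons.IH[OF m(1), of j] Cons.prems Suc by simp
    then show ?thesis using m(2,6) Cons.prems Suc by (auto intro: refines_trans)
  qed
qed simp

lemma merge_seq_merges_sorted:
  assumes "partition_on U P" "finite U" "merge_seq P xs"
  shows "sorted_wrt (refines U) (merges P xs)"
  using assms(1,3)
proof (induction xs arbitrary: P)
  case (Cons B xs)
  note m = merge_mergeable[OF Cons.prems(1) assms(2), of B]
  have "refines U (merge P B) Q" if "Q \<in> set (merges (merge P B) xs)" for Q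
    using merge_seq_merges[OF m(1) assms(2), of xs] Cons.prems that by (auto simp: in_set_conv_nth)
  then show ?case using Cons m(1) by simp
qed simp

lemma merge_inj:
  assumes P: "partition_on U P" "finite U" and "mergeable P B" "mergeable P B'" "merge P B = merge P B'"
  shows "B = B'"
  using assms merge_mergeable(3)[OF P] by (auto simp: merge_def)

lemma merges_inj:
  assumes "partition_on U P" "finite U" "merge_seq P xs" "merge_seq P ys" "merges P xs = merges P ys"
  shows "xs = ys"
  using assms(1,3-)
proof (induction xs arbitrary: P ys)
  case Nil
  then show ?case by (cases ys) auto
next
  case (Cons B xs)
  then obtain B' ys' where ys: "ys = B' # ys'" by (cases ys) auto
  with Cons.prems have "B = B'" using merge_inj[OF Cons.prems(1) assms(2), of B B'] by simp
  with Cons ys show ?case using merge_mergeable(1)[OF Cons.prems(1) assms(2), of B] by simp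
qed

lemma merges_sorted_key:
  assumes "partition_on U P" "finite U" "merge_seq P xs"
  shows "map card (merges P xs) = map (\<lambda>i. card P - Suc i) [0..<length xs]"
proof (rule nth_equalityI)
  fix i assume "i < length (map card (merges P xs))"
  then show "map card (merges P xs) ! i = map (\<lambda>i. card P - Suc i) [0..<length xs] ! i"
    using merge_seq_merges[OF assms, of i] by (simp, linarith)
qed simp

subsection \<open>Maximal chains of partitions\<close>

text \<open>
  A block of \<open>Q\<close> that is not a block of \<open>P\<close> consists of at least two blocks of \<open>P\<close>. Merging
  them gives a partition with fewer blocks that still refines \<open>Q\<close>, so induction on
  the number of blocks applies; if only one block is lost, it was a merge of two.
\<close>

lemma refines_merge:
  assumes PQ: "refines U P Q" "P \<noteq> Q" and fin: "finite U"
  shows "card Q < card P \<and> (card Q + 1 = card P \<longrightarrow> (\<exists>B. mergeable P B \<and> Q = merge P B))"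
  using PQ
proof (induction "card P" arbitrary: P rule: less_induct)
  case less
  have P: "partition_on U P" and Q: "partition_on U Q" using less.prems by (auto simp: refines_def)
  have "\<not> Q \<subseteq> P"
  proof
    assume "Q \<subseteq> P"
    then have "refines U Q P" using P Q by (auto simp: refines_def)
    then show False using less.prems refines_asym by blast
  qed
  then obtain B where B: "B \<in> Q" "B \<notin> P" by blast
  define S where "S = {X \<in> P. X \<subseteq> B}"
  have S: "S \<subseteq> P" "\<Union>S = B"
    using refines_obtains_subset[OF less.prems(1) B(1)] by (auto simp: S_def partition_on_def)
  have finS: "finite S" using S(1) finite_elements[OF fin P] finite_subset by blast
  have "S \<noteq> {}" using S(2) partition_on_blocks(1)[OF Q B(1) B(1)] by auto
  moreover have "S \<noteq> {X}" for X
  proof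
    assume "S = {X}"
    then have "B = X" "X \<in> P" using S by blast+
    then show False using B(2) by blast
  qed
  ultimately have S2: "card S \<ge> 2"
  proof -
    have "card S \<noteq> 0" using finS \<open>S \<noteq> {}\<close> by simp
    moreover have "card S \<noteq> 1" using \<open>\<And>X. S \<noteq> {X}\<close> by (auto simp: card_1_singleton_iff)
    ultimately show ?thesis by linarith
  qed
  note m = merge_Union[OF P fin S(1) \<open>S \<noteq> {}\<close>, unfolded S(2)]
  have lt: "card (merge P B) < card P" using m(3) S2 by linarith
  have ref: "refines U (merge P B) Q"
    using m(2) Q less.prems(1) B(1) by (auto simp: refines_def merge_def)
  show ?case
  proof (cases "merge P B = Q")
    case True
    have "\<exists>B. mergeable P B \<and> Q = merge P B" if "card Q + 1 = card P"
    proof -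
      have "card S = 2" using m(3) True that by simp
      then obtain X Y where "S = {X, Y}" "X \<noteq> Y" by (meson card_2_iff)
      then have "mergeable P B" using S by (auto simp: mergeable_def)
      then show ?thesis using True by blast
    qed
    then show ?thesis using True lt by simp
  next
    case False
    then have "card Q < card (merge P B)" using less.hyps[OF lt ref] by simp
    then show ?thesis using lt by simp
  qed
qed

text \<open>
  Every step of a chain loses a block, so a chain that is as long as the
  block count permits loses exactly one block in each step.
\<close>

lemma sorted_chain_of_merges:
  assumes "partition_on U P" "finite U" "sorted_wrt (\<lambda>A B. refines U A B \<and> A \<noteq> B) (P # Ps)"
    "\<And>Q. Q \<in> set Ps \<Longrightarrow> 2 \<le> card Q" "2 \<le> card P"
  shows "length Ps + 2 \<le> card P \<and> (length Ps + 2 = card P \<longrightarrow> (\<exists>Bs. merge_seq P Bs \<and> merges P Bs = Ps))"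
  using assms(1,3-)
proof (induction Ps arbitrary: P)
  case Nil
  then show ?case by (metis add_0 list.size(3) merge_seq.simps(1) merges.simps(1))
next
  case (Cons Q Ps)
  have PQ: "refines U P Q" "P \<noteq> Q" using Cons.prems by auto
  then have Q: "partition_on U Q" by (simp add: refines_def)
  note r = refines_merge[OF PQ assms(2)]
  have IH: "length Ps + 2 \<le> card Q \<and> (length Ps + 2 = card Q \<longrightarrow> (\<exists>Bs. merge_seq Q Bs \<and> merges Q Bs = Ps))"
    using Cons.IH[OF Q] Cons.prems by simp
  have "\<exists>Bs. merge_seq P Bs \<and> merges P Bs = Q # Ps" if "length (Q # Ps) + 2 = card P"
  proof -
    have "card Q + 1 = card P" "length Ps + 2 = card Q" using that r IH by auto
    then obtain B Bs where "mergeable P B" "Q = merge P B" "merge_seq Q Bs" "merges Q Bs = Ps"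
      using r IH by blast
    then show ?thesis by (intro exI[of _ "B # Bs"]) simp
  qed
  then show ?case using r IH by auto
qed

subsection \<open>Two consecutive merges\<close>

lemma merge_merge_new_blocks:
  assumes P: "partition_on U P" "finite U" and a: "mergeable P a" and b: "mergeable (merge P a) b"
  shows "merge (merge P a) b - P = (if a \<subseteq> b then {b} else {a, b})" "a \<noteq> b" "\<not> b \<subseteq> a"
proof -
  note ma = merge_mergeable[OF P a]
  obtain X Y where X: "X \<in> merge P a" "Y \<in> merge P a" "X \<noteq> Y" "b = \<Union>{X, Y}"
    using b by (rule mergeable_blocks)
  note mb = merge_mergeable[OF ma(1) P(2) b]
  have a_in: "a \<in> merge P a" by (simp add: merge_def)
  show "a \<noteq> b" using a_in mb(3) by blast
  show nba: "\<not> b \<subseteq> a"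
  proof
    assume "b \<subseteq> a"
    then have "X \<subseteq> a" "Y \<subseteq> a" using X by auto
    then have "X = a" "Y = a"
      using X partition_on_blocks[OF ma(1) X(1) a_in] partition_on_blocks[OF ma(1) X(2) a_in] by auto
    then show False using X by simp
  qed
  have "b \<notin> P"
  proof
    assume "b \<in> P"
    then have "b \<in> merge P a" using nba by (simp add: merge_def)
    then show False using mb(3) by blast
  qed
  then show "merge (merge P a) b - P = (if a \<subseteq> b then {b} else {a, b})"
    using ma(3) by (auto simp: merge_def)
qed

text \<open>
  The intervals of length two in the partition lattice. The new blocks of \<open>merge (merge P a) b\<close> are
  \<open>a\<close> and \<open>b\<close> when these are disjoint, which determines the two merges up to order; otherwise \<open>b\<close> is the only
  new block, and just the second merge is determined.
\<close>

lemma two_merges: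
  assumes P: "partition_on U P" "finite U" and a: "mergeable P a" "mergeable (merge P a) b"
    and a': "mergeable P a'" "mergeable (merge P a') b'"
    and eq: "merge (merge P a) b = merge (merge P a') b'"
  shows "if a \<subseteq> b then b' = b else a' = a \<and> b' = b \<or> a' = b \<and> b' = a"
proof -
  note n = merge_merge_new_blocks[OF P a] and n' = merge_merge_new_blocks[OF P a']
  have "(if a \<subseteq> b then {b} else {a, b}) = (if a' \<subseteq> b' then {b'} else {a', b'})"
    using n(1) n'(1) eq by simp
  then show ?thesis using n(2) n'(2) by (auto split: if_splits simp: doubleton_eq_iff)
qed

lemma merge_merge_subset:
  assumes "a \<subseteq> b"
  shows "merge (merge P a) b = merge P b"
  using assms by (auto simp: merge_def)

lemma merge_commute:
  assumes "\<not> a \<subseteq> b" "\<not> b \<subseteq> a"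
  shows "merge (merge P a) b = merge (merge P b) a"
  using assms by (auto simp: merge_def)

text \<open>
  This number tells from \<open>P\<close> and \<open>b\<close> alone whether the first merge is nested in the second.
\<close>

lemma card_blocks_below:
  assumes P: "partition_on U P" "finite U" and a: "mergeable P a" and b: "mergeable (merge P a) b"
  shows "card {X \<in> P. X \<subseteq> b} = (if a \<subseteq> b then 3 else 2)"
proof -
  note ma = merge_mergeable[OF P a]
  note mb = merge_mergeable[OF ma(1) P(2) b]
  have fin: "finite P" using P finite_elements by blast
  show ?thesis
  proof (cases "a \<subseteq> b")
    case True
    have "merge P b = insert b (P - {X \<in> P. X \<subseteq> b})" by (auto simp: merge_def)
    moreover have "b \<notin> P - {X \<in> P. X \<subseteq> b}" by blast
    ultimately have "card (merge P b) = Suc (card (P - {X \<in> P. X \<subseteq> b}))" using fin by simp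
    moreover have "card (P - {X \<in> P. X \<subseteq> b}) = card P - card {X \<in> P. X \<subseteq> b}"
      by (rule card_Diff_subset) (use fin in auto)
    moreover have "card {X \<in> P. X \<subseteq> b} \<le> card P" by (rule card_mono) (use fin in auto)
    ultimately show ?thesis using True ma(2) mb(2) merge_merge_subset[OF True, of P] by simp
  next
    case False
    obtain X Y where X: "X \<in> merge P a" "Y \<in> merge P a" "X \<noteq> Y" "b = \<Union>{X, Y}"
      using b by (rule mergeable_blocks)
    then have "X \<in> P" "Y \<in> P" using False by (auto simp: merge_def)
    then have "Z \<subseteq> b \<longleftrightarrow> Z \<in> {X, Y}" if "Z \<in> P" for Z
      using block_subset_Union[OF P(1), of "{X, Y}" Z] that X(4) by simp
    then have "{Z \<in> P. Z \<subseteq> b} = {X, Y}" using \<open>X \<in> P\<close> \<open>Y \<in> P\<close> by blast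
    then show ?thesis using False X(3) by simp
  qed
qed

section \<open>Laminar families and their merge orders\<close>

definition laminar :: "'a set set \<Rightarrow> bool" where
  "laminar F \<longleftrightarrow> (\<forall>A\<in>F. \<forall>B\<in>F. A \<subseteq> B \<or> B \<subseteq> A \<or> A \<inter> B = {})"

lemma block_vs_union:
  assumes P: "partition_on U P" and "S \<subseteq> P" "X \<in> P"
  shows "X \<subseteq> \<Union>S \<or> X \<inter> \<Union>S = {}"
proof (cases "X \<in> S")
  case False
  then have "X \<inter> Y = {}" if "Y \<in> S" for Y
    using partition_on_blocks(3)[OF P assms(3), of Y] that assms(2) by blast
  then show ?thesis by blast
qed blast

text \<open>
  Merging along a laminar family, smaller sets first, always joins at least two blocks, since
  the set to be created is a union of current blocks and not itself one. The number
  of blocks therefore bounds the length, and if the bound is attained each step joins exactly two blocks.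
\<close>

lemma merge_seq_of_laminar:
  assumes "partition_on U P" "finite U" "U \<noteq> {}"
    and "\<And>B. B \<in> set Bs \<Longrightarrow> B \<noteq> {} \<and> B \<notin> P \<and> (\<exists>S\<subseteq>P. B = \<Union>S)"
    and "laminar (set Bs)" "sorted_wrt (\<lambda>A B. \<not> B \<subseteq> A) Bs"
  shows "length Bs < card P \<and> (length Bs + 1 = card P \<longrightarrow> merge_seq P Bs)"
  using assms(1,4-)
proof (induction Bs arbitrary: P)
  case Nil
  then have "P \<noteq> {}" using assms(3) by (auto simp: partition_on_def)
  then show ?case using finite_elements[OF assms(2) Nil(1)] by (simp add: card_gt_0_iff)
next
  case (Cons B Bs)
  note P = Cons.prems(1)
  have lam: "B' \<subseteq> B \<or> B \<subseteq> B' \<or> B' \<inter> B = {}" if "B' \<in> set Bs" for B'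
    using Cons.prems(3) that unfolding laminar_def by (metis list.set_intros)
  obtain S where S: "S \<subseteq> P" "B = \<Union>S" and B: "B \<noteq> {}" "B \<notin> P" using Cons.prems(2)[of B] by auto
  then have "S \<noteq> {}" by auto
  have finS: "finite S" using S(1) finite_elements[OF assms(2) P] finite_subset by blast
  have "card S \<noteq> 0" using finS \<open>S \<noteq> {}\<close> by simp
  moreover have "card S \<noteq> 1"
  proof
    assume "card S = 1"
    then obtain X where "S = {X}" by (auto simp: card_1_singleton_iff)
    then show False using S B(2) by simp
  qed
  ultimately have S2: "card S \<ge> 2" by linarith
  note m = merge_Union[OF P assms(2) S(1) \<open>S \<noteq> {}\<close>, folded S(2)]
  have "B' \<noteq> {} \<and> B' \<notin> merge P B \<and> (\<exists>S'\<subseteq>merge P B. B' = \<Union>S')" if B': "B' \<in> set Bs" for B'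
  proof -
    obtain T where T: "T \<subseteq> P" "B' = \<Union>T" and ne: "B' \<noteq> {}" "B' \<notin> P" using Cons.prems(2)[of B'] B' by auto
    have nsub: "\<not> B' \<subseteq> B" using Cons.prems(4) B' by simp
    then consider "B \<subseteq> B'" | "B' \<inter> B = {}" using lam[OF B'] by blast
    then have "\<exists>S'\<subseteq>merge P B. B' = \<Union>S'"
    proof cases
      case 1
      have "B' = \<Union>(insert B {X \<in> T. \<not> X \<subseteq> B})" using 1 T(2) by auto
      moreover have "insert B {X \<in> T. \<not> X \<subseteq> B} \<subseteq> merge P B" using T(1) by (auto simp: merge_def)
      ultimately show ?thesis by blast
    next
      case 2
      have "\<not> X \<subseteq> B" if "X \<in> T" for X
        using that 2 T partition_on_blocks(1)[OF P, of X X] by blast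
      then have "T \<subseteq> merge P B" using T(1) by (auto simp: merge_def)
      then show ?thesis using T(2) by blast
    qed
    then show ?thesis using ne nsub by (auto simp: merge_def)
  qed
  moreover have "laminar (set Bs)" using Cons.prems(3) by (simp add: laminar_def)
  moreover have "sorted_wrt (\<lambda>A B. \<not> B \<subseteq> A) Bs" using Cons.prems(4) by simp
  ultimately have IH: "length Bs < card (merge P B) \<and> (length Bs + 1 = card (merge P B) \<longrightarrow> merge_seq (merge P B) Bs)"
    using Cons.IH[OF m(2)] by blast
  have "merge_seq P (B # Bs)" if "length (B # Bs) + 1 = card P"
  proof -
    have c: "card S = 2" "length Bs + 1 = card (merge P B)" using that IH m(3) S2 by auto
    then obtain X Y where "S = {X, Y}" "X \<noteq> Y" by (meson card_2_iff)
    then have "mergeable P B" using S by (auto simp: mergeable_def)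
    then show ?thesis using IH c by simp
  qed
  then show ?case using IH m(3) S2 by auto
qed

lemma Union_of_merged_blocks:
  assumes "S' \<subseteq> merge P B" "mergeable P B"
  shows "\<exists>S\<subseteq>P. \<Union>S' = \<Union>S"
proof -
  obtain X Y where XY: "X \<in> P" "Y \<in> P" "B = \<Union>{X, Y}" using assms(2) by (rule mergeable_blocks)
  let ?S = "(if B \<in> S' then {X, Y} else {}) \<union> (S' \<inter> P)"
  have "S' \<subseteq> insert B P" using assms(1) by (auto simp: merge_def)
  then have "\<Union>S' = \<Union>?S" using XY by auto
  moreover have "?S \<subseteq> P" using XY by auto
  ultimately show ?thesis by blast
qed

text \<open>
  Conversely every set created by merging is a union of earlier blocks, so it contains each
  earlier set or is disjoint from it, and it splits into the two blocks that were joined.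
\<close>

lemma merge_seq_laminar:
  assumes "partition_on U P" "finite U" "merge_seq P Bs"
  shows "(\<forall>B\<in>set Bs. B \<noteq> {} \<and> B \<notin> P \<and> (\<exists>S\<subseteq>P. B = \<Union>S)) \<and> laminar (P \<union> set Bs) \<and>
    sorted_wrt (\<lambda>A B. \<not> B \<subseteq> A) Bs \<and>
    (\<forall>B\<in>set Bs. \<exists>X\<in>P \<union> set Bs. \<exists>Y\<in>P \<union> set Bs. X \<inter> Y = {} \<and> B = X \<union> Y)"
  using assms(1,3)
proof (induction Bs arbitrary: P)
  case Nil
  have "A \<subseteq> B \<or> B \<subseteq> A \<or> A \<inter> B = {}" if "A \<in> P" "B \<in> P" for A B
    using partition_on_blocks(3)[OF Nil(1) that] by blast
  then show ?case by (simp add: laminar_def)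
next
  case (Cons B Bs)
  note P = Cons.prems(1)
  have B: "mergeable P B" using Cons.prems by simp
  note m = merge_mergeable[OF P assms(2) B]
  obtain X Y where XY: "X \<in> P" "Y \<in> P" "X \<noteq> Y" "B = \<Union>{X, Y}" using B by (rule mergeable_blocks)
  have Bin: "B \<in> merge P B" by (simp add: merge_def)
  have "merge_seq (merge P B) Bs" using Cons.prems(2) by simp
  note IH_all = Cons.IH[OF m(1) this]
  note IH = IH_all[THEN conjunct1] IH_all[THEN conjunct2, THEN conjunct1]
    IH_all[THEN conjunct2, THEN conjunct2, THEN conjunct1] IH_all[THEN conjunct2, THEN conjunct2, THEN conjunct2]
  have nsub: "\<not> B' \<subseteq> B" if B': "B' \<in> set Bs" for B'
  proof
    assume sub: "B' \<subseteq> B"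
    obtain S where S: "S \<subseteq> merge P B" "B' = \<Union>S" and "B' \<noteq> {}" "B' \<notin> merge P B"
      using bspec[OF IH(1) B'] by (elim conjE exE)
    then obtain Z where Z: "Z \<in> S" by blast
    then have "Z \<subseteq> B" "Z \<in> merge P B" using S sub by auto
    then have "Z = B" by (auto simp: merge_def)
    then have "B' = B" using Z S sub by blast
    then show False using Bin \<open>B' \<notin> merge P B\<close> by simp
  qed
  have notP: "B' \<notin> P" if "B' \<in> set Bs" for B'
    using nsub[OF that] bspec[OF IH(1) that] by (simp add: merge_def)
  have un: "\<exists>S\<subseteq>P. B' = \<Union>S" if "B' \<in> set Bs" for B'
    using bspec[OF IH(1) that] Union_of_merged_blocks[OF _ B] by metis
  have blocks: "B' \<noteq> {} \<and> B' \<notin> P \<and> (\<exists>S\<subseteq>P. B' = \<Union>S)" if "B' \<in> set (B # Bs)" for B'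
  proof (cases "B' = B")
    case True
    then show ?thesis using m(3,4) XY(1,2,4) by (auto intro!: exI[of _ "{X, Y}"])
  next
    case False
    then have "B' \<in> set Bs" using that by simp
    then show ?thesis using notP un bspec[OF IH(1)] by simp
  qed
  have cmp: "Z \<subseteq> W \<or> Z \<inter> W = {}" if Z: "Z \<in> P" and W: "W \<in> P \<union> set (B # Bs)" for Z W
  proof -
    obtain S where "S \<subseteq> P" "W = \<Union>S" using blocks[of W] W
      by (metis Un_iff cSup_singleton empty_subsetI insert_subset)
    then show ?thesis using block_vs_union[OF P _ Z] by blast
  qed
  have "laminar (P \<union> set (B # Bs))"
    unfolding laminar_def
  proof (intro ballI)
    fix Z W assume ZW: "Z \<in> P \<union> set (B # Bs)" "W \<in> P \<union> set (B # Bs)"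
    show "Z \<subseteq> W \<or> W \<subseteq> Z \<or> Z \<inter> W = {}"
    proof (cases "Z \<in> P \<or> W \<in> P")
      case True
      then show ?thesis using cmp[of Z W] cmp[of W Z] ZW by blast
    next
      case False
      then have "Z \<in> merge P B \<union> set Bs" "W \<in> merge P B \<union> set Bs" using ZW Bin by auto
      then show ?thesis using IH(2) by (simp add: laminar_def)
    qed
  qed
  moreover have "sorted_wrt (\<lambda>A B. \<not> B \<subseteq> A) (B # Bs)" using IH(3) nsub by simp
  moreover have "\<exists>X\<in>P \<union> set (B # Bs). \<exists>Y\<in>P \<union> set (B # Bs). X \<inter> Y = {} \<and> B' = X \<union> Y"
    if "B' \<in> set (B # Bs)" for B'
  proof (cases "B' = B")
    case True
    then show ?thesis using XY partition_on_blocks(3)[OF P XY(1,2)] by auto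
  next
    case False
    then have "B' \<in> set Bs" using that by simp
    moreover have "merge P B \<union> set Bs \<subseteq> P \<union> set (B # Bs)" by (auto simp: merge_def)
    ultimately show ?thesis using IH(4) by (meson subsetD)
  qed
  ultimately show ?case using blocks by blast
qed

definition singletons :: "nat \<Rightarrow> nat set set" where
  "singletons n = (\<lambda>i. {i}) ` {1..n}"

text \<open>
  The label set \<open>{1..n}\<close> is appended as the last merge. It is not a cluster, but plays the role of the
  next larger set for the last cluster, so that no case distinction at the end of the list arises.
\<close>

definition merge_orders :: "nat \<Rightarrow> nat set list set" where
  "merge_orders n = {Bs. length Bs + 2 = n \<and> merge_seq (singletons n) (Bs @ [{1..n}])}"

text \<open>
  The label sets below a single internal edge of a tree, see \<open>tree_vertex\<close> below.
\<close>

definition clusters :: "nat \<Rightarrow> nat set set" where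
  "clusters n = {B. B \<subset> {1..n} \<and> 2 \<le> card B}"

lemma singletons_partition: "partition_on {1..n} (singletons n)"
  unfolding singletons_def by (rule partition_on_singletons)

lemma card_singletons: "card (singletons n) = n"
  unfolding singletons_def by (simp add: card_image)

lemma Union_of_singletons:
  assumes "B \<subseteq> {1..n}"
  shows "\<exists>S\<subseteq>singletons n. B = \<Union>S"
  using assms by (intro exI[of _ "(\<lambda>i. {i}) ` B"]) (auto simp: singletons_def)

lemma finite_clusters: "finite (clusters n)"
  by (rule finite_subset[of _ "Pow {1..n}"]) (auto simp: clusters_def)

lemma cluster_finite: "B \<in> clusters n \<Longrightarrow> finite B"
  by (auto simp: clusters_def intro: finite_subset)

lemma laminar_merge_seq:
  assumes n: "2 \<le> n" and lam: "laminar (set Bs)" and cl: "set Bs \<subseteq> clusters n"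
    and srt: "sorted_wrt (\<lambda>A B. \<not> B \<subseteq> A) Bs"
  shows "length Bs + 2 \<le> n \<and> (length Bs + 2 = n \<longrightarrow> Bs \<in> merge_orders n)"
proof -
  let ?U = "{1..n}" and ?Bs = "Bs @ [{1..n}]"
  have "B \<noteq> {} \<and> B \<notin> singletons n \<and> (\<exists>S\<subseteq>singletons n. B = \<Union>S)" if "B \<in> set ?Bs" for B
  proof -
    have "2 \<le> card B \<and> B \<subseteq> ?U" using that cl n by (auto simp: clusters_def)
    then show ?thesis using Union_of_singletons[of B n] by (auto simp: singletons_def)
  qed
  moreover have "laminar (set ?Bs)" using lam cl by (fastforce simp: laminar_def clusters_def)
  moreover have "sorted_wrt (\<lambda>A B. \<not> B \<subseteq> A) ?Bs" using srt cl by (auto simp: sorted_wrt_append clusters_def)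
  ultimately have "length ?Bs < card (singletons n) \<and> (length ?Bs + 1 = card (singletons n) \<longrightarrow> merge_seq (singletons n) ?Bs)"
    using n by (intro merge_seq_of_laminar[OF singletons_partition]) auto
  then show ?thesis by (auto simp: card_singletons merge_orders_def)
qed

lemma merge_order_laminar:
  assumes "Bs \<in> merge_orders n"
  shows "laminar (singletons n \<union> set Bs \<union> {{1..n}})" "laminar (set Bs)" "set Bs \<subseteq> clusters n"
    "sorted_wrt (\<lambda>A B. \<not> B \<subseteq> A) Bs" "distinct Bs" "length Bs + 2 = n"
    "B \<in> set Bs \<union> {{1..n}} \<Longrightarrow> \<exists>X\<in>singletons n \<union> set Bs. \<exists>Y\<in>singletons n \<union> set Bs. X \<inter> Y = {} \<and> B = X \<union> Y"
proof -
  let ?F = "singletons n \<union> set (Bs @ [{1..n}])"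
  have seq: "merge_seq (singletons n) (Bs @ [{1..n}])" and len: "length Bs + 2 = n"
    using assms by (auto simp: merge_orders_def)
  then show "length Bs + 2 = n" by simp
  have F: "?F = singletons n \<union> set Bs \<union> {{1..n}}" by auto
  note lam = merge_seq_laminar[OF singletons_partition finite_atLeastAtMost seq]
  from lam show l: "laminar (singletons n \<union> set Bs \<union> {{1..n}})" by (simp only: F)
  then show "laminar (set Bs)" by (simp add: laminar_def)
  show s: "sorted_wrt (\<lambda>A B. \<not> B \<subseteq> A) Bs" using lam by (simp add: sorted_wrt_append)
  then show "distinct Bs" by (induction Bs) auto
  show "set Bs \<subseteq> clusters n"
  proof
    fix B assume B: "B \<in> set Bs"
    then have "B \<in> set (Bs @ [{1..n}])" by simp
    then have p: "B \<noteq> {}" "B \<notin> singletons n" "\<exists>S\<subseteq>singletons n. B = \<Union>S" using lam by blast+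
    then have sub: "B \<subseteq> {1..n}" by (auto simp: singletons_def)
    moreover have "B \<noteq> {1..n}" using lam B by (auto simp: sorted_wrt_append)
    moreover have "card B \<noteq> 0" using p(1) sub finite_subset by fastforce
    moreover have "card B \<noteq> 1"
    proof
      assume "card B = 1"
      then obtain i where "B = {i}" by (auto simp: card_1_singleton_iff)
      then show False using p(2) sub by (auto simp: singletons_def)
    qed
    ultimately show "B \<in> clusters n" by (auto simp: clusters_def)
  qed
  show "\<exists>X\<in>singletons n \<union> set Bs. \<exists>Y\<in>singletons n \<union> set Bs. X \<inter> Y = {} \<and> B = X \<union> Y"
    if B: "B \<in> set Bs \<union> {{1..n}}"
  proof -
    have "B \<in> set (Bs @ [{1..n}])" using B by auto
    then have "\<exists>X\<in>?F. \<exists>Y\<in>?F. X \<inter> Y = {} \<and> B = X \<union> Y"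
      by (rule lam[THEN conjunct2, THEN conjunct2, THEN conjunct2, THEN bspec])
    then obtain X Y where XY: "X \<in> ?F" "Y \<in> ?F" "X \<inter> Y = {}" "B = X \<union> Y" by blast
    have ne: "Z \<noteq> {}" if "Z \<in> ?F" for Z
    proof (cases "Z \<in> singletons n")
      case True
      then show ?thesis by (auto simp: singletons_def)
    next
      case False
      then have "Z \<in> set (Bs @ [{1..n}])" using that by blast
      then show ?thesis using lam by blast
    qed
    have "B \<subseteq> {1..n}" using B \<open>set Bs \<subseteq> clusters n\<close> by (auto simp: clusters_def)
    moreover have "X \<noteq> {}" "Y \<noteq> {}" using ne XY(1,2) by blast+
    ultimately have "X \<noteq> {1..n}" "Y \<noteq> {1..n}" using XY(3,4) by blast+
    then have "X \<in> singletons n \<union> set Bs" "Y \<in> singletons n \<union> set Bs" using XY(1,2) by simp_all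
    then show ?thesis using XY(3,4) by blast
  qed
qed

text \<open>
  Merge orders are the linear extensions of inclusion on maximal laminar families of
  clusters. In this form it is plain which rearrangements of a merge order are again merge orders.
\<close>

lemma merge_orders_iff:
  assumes "2 \<le> n"
  shows "Bs \<in> merge_orders n \<longleftrightarrow> length Bs + 2 = n \<and> laminar (set Bs) \<and> set Bs \<subseteq> clusters n \<and>
    sorted_wrt (\<lambda>A B. \<not> B \<subseteq> A) Bs"
  using laminar_merge_seq[OF assms] merge_order_laminar by blast

lemma finite_merge_orders: "finite (merge_orders n)"
proof (rule finite_subset)
  show "merge_orders n \<subseteq> {Bs. set Bs \<subseteq> clusters n \<and> length Bs = n - 2}"
    using merge_order_laminar(3,6) by fastforce
qed (rule finite_lists_length_eq[OF finite_clusters])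

lemma sort_by_key:
  fixes f :: "'a \<Rightarrow> 'b::linorder"
  assumes "finite A"
  obtains xs where "set xs = A" "distinct xs" "sorted_wrt (\<lambda>x y. f x \<le> f y \<and> x \<noteq> y) xs"
proof -
  obtain ys where ys: "set ys = A" "distinct ys" using finite_distinct_list[OF assms] by blast
  have "sorted_wrt (\<lambda>x y. f x \<le> f y) (sort_key f ys)"
    using sorted_sort_key[of f ys] by (simp add: sorted_map)
  moreover have "sorted_wrt (\<noteq>) zs" if "distinct zs" for zs :: "'a list"
    using that by (induction zs) auto
  then have "sorted_wrt (\<noteq>) (sort_key f ys)" using ys(2) by simp
  ultimately have "sorted_wrt (\<lambda>x y. f x \<le> f y \<and> x \<noteq> y) (sort_key f ys)"
    by (simp add: sorted_wrt_iff_nth_less)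
  then show ?thesis using that[of "sort_key f ys"] ys by simp
qed

text \<open>
  Sorting by cardinality puts smaller sets first.
\<close>

lemma laminar_family_merge_order:
  assumes n: "2 \<le> n" and L: "L \<subseteq> clusters n" "laminar L"
  shows "card L + 2 \<le> n \<and> (card L + 2 = n \<longrightarrow> (\<exists>Bs\<in>merge_orders n. set Bs = L))"
proof -
  have "finite L" using L(1) finite_clusters finite_subset by blast
  then obtain Bs where Bs: "set Bs = L" "distinct Bs" "sorted_wrt (\<lambda>A B. card A \<le> card B \<and> A \<noteq> B) Bs"
    by (rule sort_by_key[of L card])
  have srt: "sorted_wrt (\<lambda>A B. \<not> B \<subseteq> A) Bs"
  proof (rule sorted_wrt_mono_rel[OF _ Bs(3)])
    fix A B assume "A \<in> set Bs" "B \<in> set Bs" and le: "card A \<le> card B \<and> A \<noteq> B"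
    then have "finite A" using Bs(1) L(1) cluster_finite by blast
    then show "\<not> B \<subseteq> A" using le card_seteq by metis
  qed
  show ?thesis
    using laminar_merge_seq[OF n, of Bs] Bs(1,3) distinct_card[OF Bs(2)] L srt by auto
qed

subsection \<open>Maximal simplices of the partition complex\<close>

lemma merge_order_partitions:
  assumes Bs: "Bs \<in> merge_orders n" and n: "2 \<le> n"
  shows "set (merges (singletons n) Bs) \<in> partition_complex n" "distinct (merges (singletons n) Bs)"
proof -
  let ?U = "{1..n}" and ?Ps = "merges (singletons n) Bs"
  have seq: "merge_seq (singletons n) Bs" and len: "length Bs + 2 = n"
    using Bs by (auto simp: merge_orders_def merge_seq_append)
  note m = merge_seq_merges[OF singletons_partition finite_atLeastAtMost seq]
  have "Q \<in> proper_partitions n" if Q: "Q \<in> set ?Ps" for Q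
  proof -
    obtain i where i: "i < length Bs" "Q = ?Ps ! i" using Q unfolding in_set_conv_nth length_merges by blast
    then have "refines ?U (singletons n) Q" "card Q + Suc i = n" using m[OF i(1)] i(2) card_singletons by simp_all
    moreover from this have "card Q \<noteq> 1" "card Q \<noteq> n" using i(1) len by linarith+
    then have "Q \<noteq> singletons n" "Q \<noteq> {?U}" using card_singletons[of n] by auto
    ultimately show ?thesis by (simp add: proper_partitions_def refines_def singletons_def)
  qed
  moreover have srt: "sorted_wrt (refines ?U) ?Ps"
    by (rule merge_seq_merges_sorted[OF singletons_partition finite_atLeastAtMost seq])
  have "Complete_Partial_Order.chain (refines ?U) (set ?Ps)"
  proof (rule chainI)
    fix P Q assume "P \<in> set ?Ps" "Q \<in> set ?Ps"
    then obtain i j where ij: "i < length ?Ps" "j < length ?Ps" "P = ?Ps ! i" "Q = ?Ps ! j"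
      by (metis in_set_conv_nth)
    consider "i < j" | "j < i" | "i = j" by linarith
    then show "refines ?U P Q \<or> refines ?U Q P"
    proof cases
      case 3
      have "refines ?U (singletons n) P" using m[of i] ij by simp
      then show ?thesis using 3 ij refines_refl by (metis refines_def)
    qed (use srt ij in \<open>auto simp: sorted_wrt_iff_nth_less\<close>)
  qed
  ultimately show "set ?Ps \<in> partition_complex n"
    by (auto simp: partition_complex_def order_complex_def)
  have "inj_on (\<lambda>i. n - Suc i) {0..<length Bs}" using len by (auto simp: inj_on_def)
  then have "distinct (map card ?Ps)"
    using merges_sorted_key[OF singletons_partition finite_atLeastAtMost seq]
    by (simp add: card_singletons distinct_map)
  then show "distinct ?Ps" by (simp add: distinct_map)
qed

text \<open>
  Every chain of proper partitions extends upwards from the partition into singletons; a chain with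
  \<open>n - 2\<close> members has block counts \<open>n - 1, \<dots>, 2\<close>, hence merges two blocks in each step.
\<close>

lemma partition_complex_card:
  assumes C: "C \<in> partition_complex n" and n: "2 \<le> n"
  shows "card C + 2 \<le> n \<and> (card C + 2 = n \<longrightarrow> (\<exists>Bs\<in>merge_orders n. C = set (merges (singletons n) Bs)))"
proof -
  let ?U = "{1..n}"
  have fin: "finite C" and chain: "Complete_Partial_Order.chain (refines ?U) C"
    and proper: "\<And>P. P \<in> C \<Longrightarrow> partition_on ?U P \<and> P \<noteq> singletons n \<and> P \<noteq> {?U}"
    using C by (auto simp: partition_complex_def order_complex_def proper_partitions_def singletons_def)
  obtain Ps where Ps: "set Ps = C" "distinct Ps" "sorted_wrt (\<lambda>P Q. - int (card P) \<le> - int (card Q) \<and> P \<noteq> Q) Ps"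
    using sort_by_key[OF fin, of "\<lambda>P. - int (card P)"] by blast
  have "sorted_wrt (\<lambda>P Q. refines ?U P Q \<and> P \<noteq> Q) Ps"
  proof (rule sorted_wrt_mono_rel[OF _ Ps(3)])
    fix P Q assume PQ: "P \<in> set Ps" "Q \<in> set Ps" "- int (card P) \<le> - int (card Q) \<and> P \<noteq> Q"
    then have "\<not> refines ?U Q P" using refines_merge[of ?U Q P] by auto
    then show "refines ?U P Q \<and> P \<noteq> Q"
      using chainD[OF chain, of P Q] PQ Ps(1) by blast
  qed
  moreover have "refines ?U (singletons n) P" if "P \<in> C" for P
  proof -
    have P: "partition_on ?U P" using proper[OF that] by simp
    have "\<exists>Y\<in>P. X \<subseteq> Y" if "X \<in> singletons n" for X
    proof -
      from \<open>X \<in> singletons n\<close> obtain x where "X = {x}" "x \<in> ?U" unfolding singletons_def by blast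
      then show ?thesis using partition_onD1[OF P] by blast
    qed
    then show ?thesis using P singletons_partition[of n] by (simp add: refines_def)
  qed
  ultimately have srt: "sorted_wrt (\<lambda>P Q. refines ?U P Q \<and> P \<noteq> Q) (singletons n # Ps)"
    using Ps(1) proper by auto
  have card2: "2 \<le> card P" if "P \<in> C" for P
  proof -
    have "finite P" using proper[OF that] finite_elements by blast
    moreover have "P \<noteq> {}" using proper[OF that] n by (auto simp: partition_on_def)
    ultimately have "card P \<noteq> 0" by simp
    moreover have "card P \<noteq> 1"
    proof
      assume "card P = 1"
      then obtain X where "P = {X}" by (auto simp: card_1_singleton_iff)
      then show False using proper[OF that] by (auto simp: partition_on_def)
    qed
    ultimately show ?thesis by linarith
  qed
  note s = sorted_chain_of_merges[OF singletons_partition finite_atLeastAtMost srt, unfolded card_singletons Ps(1), OF card2 n]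
  have "\<exists>Bs\<in>merge_orders n. C = set (merges (singletons n) Bs)" if len: "length Ps + 2 = n"
  proof -
    obtain Bs where Bs: "merge_seq (singletons n) Bs" "merges (singletons n) Bs = Ps" using s len by blast
    define R where "R = foldl merge (singletons n) Bs"
    have "length Bs = length Ps" using Bs(2) by (metis length_merges)
    then have R: "partition_on ?U R" "card R = 2"
      using merge_seq_partition[OF singletons_partition finite_atLeastAtMost Bs(1)] len
      by (auto simp: R_def card_singletons)
    then obtain X Y where XY: "R = {X, Y}" "X \<noteq> Y" by (meson card_2_iff)
    then have "?U = X \<union> Y" using partition_onD1[OF R(1)] by simp
    then have "mergeable R ?U" using XY by (auto simp: mergeable_def)
    then have "Bs \<in> merge_orders n"
      using Bs(1) len \<open>length Bs = length Ps\<close> by (simp add: merge_orders_def merge_seq_append R_def)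
    then show ?thesis using Bs(2) Ps(1) by auto
  qed
  then show ?thesis using s Ps(1,2) distinct_card by metis
qed

section \<open>Rearranging merge orders\<close>

definition adjacent_swaps :: "('a \<Rightarrow> 'a \<Rightarrow> bool) \<Rightarrow> ('a list \<times> 'a list) set" where
  "adjacent_swaps R = {(xs @ a # b # ys, xs @ b # a # ys) | xs a b ys.
     sorted_wrt R (xs @ a # b # ys) \<and> sorted_wrt R (xs @ b # a # ys)}"

lemma adjacent_swaps_to_front:
  assumes "sorted_wrt R (ps @ xs @ y # zs)" "\<forall>x\<in>set xs. R y x"
  shows "(ps @ xs @ y # zs, ps @ y # xs @ zs) \<in> (adjacent_swaps R)\<^sup>* \<and> sorted_wrt R (ps @ y # xs @ zs)"
  using assms
proof (induction xs arbitrary: zs rule: rev_induct)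
  case (snoc x xs)
  have s: "sorted_wrt R ((ps @ xs) @ y # x # zs)"
    using snoc.prems by (auto simp: sorted_wrt_append)
  then have "((ps @ xs) @ x # y # zs, (ps @ xs) @ y # x # zs) \<in> adjacent_swaps R"
    using snoc.prems(1) unfolding adjacent_swaps_def by fastforce
  moreover have "(ps @ xs @ y # x # zs, ps @ y # xs @ x # zs) \<in> (adjacent_swaps R)\<^sup>* \<and>
      sorted_wrt R (ps @ y # xs @ x # zs)"
    using snoc.IH[of "x # zs"] snoc.prems(2) s by simp
  ultimately show ?case by (simp add: converse_rtrancl_into_rtrancl)
qed simp

text \<open>
  Linear extensions of the same relation are connected by swaps of neighbours: the first element of the target
  list can be moved to the front, since everything before it is incomparable to it,
  and induction takes care of the rest.
\<close>

lemma adjacent_swaps_connected: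
  assumes "sorted_wrt R (ps @ xs)" "sorted_wrt R (ps @ ys)" "mset xs = mset ys"
  shows "(ps @ xs, ps @ ys) \<in> (adjacent_swaps R)\<^sup>*"
  using assms
proof (induction ys arbitrary: ps xs)
  case (Cons y ys)
  have "y \<in> set xs" using Cons.prems(3) by (metis list.set_intros(1) mset_eq_setD)
  then obtain x1 x2 where xs: "xs = x1 @ y # x2" by (meson split_list)
  have rest: "mset (x1 @ x2) = mset ys" using Cons.prems(3) xs by simp
  then have "set x1 \<subseteq> set ys" by (metis Un_upper1 mset_eq_setD set_append)
  then have "\<forall>x\<in>set x1. R y x" using Cons.prems(2) by (auto simp: sorted_wrt_append)
  then have m: "(ps @ xs, (ps @ [y]) @ x1 @ x2) \<in> (adjacent_swaps R)\<^sup>*" "sorted_wrt R ((ps @ [y]) @ x1 @ x2)"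
    using adjacent_swaps_to_front[of R ps x1 y x2] Cons.prems(1) xs by simp_all
  have "((ps @ [y]) @ x1 @ x2, (ps @ [y]) @ ys) \<in> (adjacent_swaps R)\<^sup>*"
    using Cons.IH[OF m(2) _ rest] Cons.prems(2) by simp
  with m(1) show ?case by simp
qed simp

lemma permute_list_adjacent:
  "permute_list (transpose (length xs) (Suc (length xs))) (xs @ a # b # ys) = xs @ b # a # ys"
  (is "permute_list ?t ?l = _")
proof (rule nth_equalityI)
  fix i assume "i < length (permute_list ?t ?l)"
  then have i: "i < length ?l" by simp
  have t: "?t permutes {..<length ?l}" by (rule permutes_swap_id) auto
  show "permute_list ?t ?l ! i = (xs @ b # a # ys) ! i"
    unfolding permute_list_nth[OF t i]
    by (auto simp: transpose_def nth_append nth_Cons' split: if_splits)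
qed simp

text \<open>
  A function that changes sign under swaps of neighbours changes by the sign of the
  permutation between any two merge orders of the same family. This makes it the restriction of an oriented
  chain on laminar families.
\<close>

lemma merge_orders_sign:
  fixes h :: "nat set list \<Rightarrow> int"
  assumes n: "2 \<le> n"
    and swap: "\<And>xs a b ys. xs @ a # b # ys \<in> merge_orders n \<Longrightarrow> xs @ b # a # ys \<in> merge_orders n \<Longrightarrow>
        h (xs @ b # a # ys) = - h (xs @ a # b # ys)"
    and Bs: "Bs \<in> merge_orders n" and Bs': "Bs' \<in> merge_orders n" and eq: "set Bs = set Bs'"
  obtains \<pi> where "\<pi> permutes {..<length Bs}" "Bs' = permute_list \<pi> Bs" "h Bs' = sign \<pi> * h Bs"
proof -
  let ?R = "\<lambda>A B :: nat set. \<not> B \<subseteq> A"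
  note M = merge_orders_iff[OF n]
  have "mset Bs = mset Bs'"
    using eq merge_order_laminar(5)[OF Bs] merge_order_laminar(5)[OF Bs'] set_eq_iff_mset_eq_distinct by blast
  then have "(Bs, Bs') \<in> (adjacent_swaps ?R)\<^sup>*"
    using adjacent_swaps_connected[of ?R "[]" Bs Bs'] merge_order_laminar(4)[OF Bs] merge_order_laminar(4)[OF Bs']
    by simp
  then have "Bs' \<in> merge_orders n \<and>
      (\<exists>\<pi>. \<pi> permutes {..<length Bs} \<and> Bs' = permute_list \<pi> Bs \<and> h Bs' = sign \<pi> * h Bs)"
  proof (induction rule: rtrancl_induct)
    case base
    show ?case using Bs by (auto intro!: exI[of _ id] simp: permutes_id)
  next
    case (step Cs Ds)
    obtain \<pi> where \<pi>: "\<pi> permutes {..<length Bs}" "Cs = permute_list \<pi> Bs" "h Cs = sign \<pi> * h Bs"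
      and Cs: "Cs \<in> merge_orders n" using step.IH by blast
    obtain xs a b ys where l: "Cs = xs @ a # b # ys" "Ds = xs @ b # a # ys" "sorted_wrt ?R Ds"
      using step.hyps(2) unfolding adjacent_swaps_def by blast
    have "set Ds = set Cs" "length Ds = length Cs" using l by auto
    then have Ds: "Ds \<in> merge_orders n" using Cs l(3) unfolding M by simp
    let ?t = "transpose (length xs) (Suc (length xs))"
    have len: "length Cs = length Bs" using \<pi>(2) by simp
    have t: "?t permutes {..<length Bs}"
      unfolding len[symmetric] l(1) by (rule permutes_swap_id) auto
    have "Ds = permute_list ?t Cs" using permute_list_adjacent l by metis
    then have "Ds = permute_list (\<pi> \<circ> ?t) Bs" using \<pi>(2) t by (simp add: permute_list_compose)
    moreover have "h Ds = sign (\<pi> \<circ> ?t) * h Bs"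
      using swap[of xs a b ys] Cs Ds l(1,2) \<pi>(3) sign_compose_permutes[OF \<pi>(1) t] by (simp add: sign_swap_id)
    ultimately show ?case using Ds permutes_compose[OF t \<pi>(1)] by blast
  qed
  then show ?thesis using that by blast
qed

text \<open>
  The set created right after the preceding clusters, which is the whole label set after the last one.
\<close>

definition next_cluster :: "nat \<Rightarrow> nat set list \<Rightarrow> nat set" where
  "next_cluster n ys = hd (ys @ [{1..n}])"

lemma next_cluster_Cons [simp]: "next_cluster n (C # zs) = C"
  by (simp add: next_cluster_def)

lemma block_containing:
  assumes "X \<in> P \<union> set xs"
  shows "\<exists>B\<in>foldl merge P xs. X \<subseteq> B"
  using assms
proof (induction xs arbitrary: P X)
  case (Cons A xs)
  then show ?case
  proof (cases "X \<in> set xs")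
    case True
    then show ?thesis using Cons.IH[of X "merge P A"] by simp
  next
    case False
    then have "\<exists>Y\<in>merge P A. X \<subseteq> Y" using Cons.prems by (auto simp: merge_def)
    then obtain Y where "Y \<in> merge P A" "X \<subseteq> Y" by blast
    then show ?thesis using Cons.IH[of Y "merge P A"] by (auto intro: order.trans)
  qed
qed auto

lemma merge_orders_split:
  assumes "xs @ a # ys \<in> merge_orders n"
  defines "P \<equiv> foldl merge (singletons n) xs"
  obtains zs where "ys @ [{1..n}] = next_cluster n ys # zs"
    "merge_seq (singletons n) xs" "partition_on {1..n} P" "mergeable P a"
    "mergeable (merge P a) (next_cluster n ys)" "merge_seq (merge (merge P a) (next_cluster n ys)) zs"
proof -
  obtain zs where zs: "ys @ [{1..n}] = next_cluster n ys # zs"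
    by (cases ys) (auto simp: next_cluster_def)
  have seq: "merge_seq (singletons n) (xs @ a # next_cluster n ys # zs)"
    using assms(1) zs by (simp add: merge_orders_def)
  then have "partition_on {1..n} P"
    unfolding P_def merge_seq_append
    using merge_seq_partition[OF singletons_partition finite_atLeastAtMost] by blast
  then show ?thesis using that[OF zs] seq by (simp add: merge_seq_append P_def)
qed

lemma merge_orders_replace:
  assumes "xs @ a # ys \<in> merge_orders n" and C: "a \<subseteq> next_cluster n ys" "a' \<subseteq> next_cluster n ys"
    and a': "mergeable (foldl merge (singletons n) xs) a'"
    and b': "mergeable (merge (foldl merge (singletons n) xs) a') (next_cluster n ys)"
  shows "xs @ a' # ys \<in> merge_orders n"
proof -
  define P where "P = foldl merge (singletons n) xs"
  obtain zs where zs: "ys @ [{1..n}] = next_cluster n ys # zs"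
    "merge_seq (singletons n) xs" "merge_seq (merge (merge P a) (next_cluster n ys)) zs"
    using merge_orders_split[OF assms(1)] unfolding P_def by metis
  have "merge_seq P (a' # next_cluster n ys # zs)"
    using zs(3) a' b' merge_merge_subset[OF C(1), of P] merge_merge_subset[OF C(2), of P] by (simp add: P_def)
  then have "merge_seq (singletons n) (xs @ a' # next_cluster n ys # zs)"
    using zs(2) by (simp only: merge_seq_append P_def)
  moreover have "(xs @ a' # ys) @ [{1..n}] = xs @ a' # next_cluster n ys # zs" using zs(1) by simp
  ultimately have "merge_seq (singletons n) ((xs @ a' # ys) @ [{1..n}])" by (simp only:)
  moreover have "length (xs @ a' # ys) + 2 = n" using assms(1) by (simp add: merge_orders_def)
  ultimately show ?thesis unfolding merge_orders_def by blast
qed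

text \<open>
  If a maximal laminar family loses \<open>a\<close> and the next set \<open>C\<close> in the merge order contains \<open>a\<close>, then \<open>C\<close> is the
  union of three blocks of the partition \<open>P\<close> reached before \<open>a\<close>. Any other completion \<open>a'\<close> takes the place of \<open>a\<close>:
  \<open>C\<close> must split into two members of the new family. Old sets properly inside \<open>C\<close> lie within one of the three
  blocks, so two of them cannot make up \<open>C\<close> and one half is \<open>a'\<close>. The other half and the two halves of \<open>a'\<close> are
  old sets covering \<open>C\<close>, so they are the three blocks.
\<close>

lemma merge_orders_exchange:
  assumes xs: "xs @ a # ys \<in> merge_orders n" and aC: "a \<subseteq> next_cluster n ys"
    and Bs': "Bs' \<in> merge_orders n" "set Bs' = insert a' (set xs \<union> set ys)" "a' \<notin> set xs \<union> set ys"
  shows "xs @ a' # ys \<in> merge_orders n"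
proof -
  let ?C = "next_cluster n ys"
  define P where "P = foldl merge (singletons n) xs"
  obtain zs where zs: "ys @ [{1..n}] = ?C # zs" and P: "partition_on {1..n} P"
    and a: "mergeable P a" and C: "mergeable (merge P a) ?C"
    using merge_orders_split[OF xs] unfolding P_def by metis
  \<comment> \<open>the family without \<open>a\<close>, and the three blocks that make up \<open>C\<close>\<close>
  define F where "F = singletons n \<union> set xs \<union> set ys"
  define T where "T = {X \<in> P. X \<subseteq> ?C}"
  have card_T: "card T = 3"
    using card_blocks_below[OF P finite_atLeastAtMost a C] aC by (simp add: T_def)
  have Cin: "?C \<in> set (ys @ [{1..n}])" using zs by simp
  have srt: "sorted_wrt (\<lambda>A B. \<not> B \<subseteq> A) (xs @ a # ?C # zs)"
  proof -
    have "sorted_wrt (\<lambda>A B. \<not> B \<subseteq> A) ((xs @ a # ys) @ [{1..n}])"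
      using merge_order_laminar(3,4)[OF xs] by (auto simp: sorted_wrt_append clusters_def)
    then show ?thesis using zs by simp
  qed
  have UC: "\<Union>T = ?C"
  proof -
    have "refines {1..n} P (merge (merge P a) ?C)"
      using merge_mergeable[OF P finite_atLeastAtMost a] merge_mergeable[OF _ finite_atLeastAtMost C]
      by (meson refines_trans)
    then have "partition_on ?C T"
      using refines_obtains_subset[of _ P _ ?C] by (simp add: T_def merge_def)
    then show ?thesis by (simp add: partition_on_def)
  qed
  have block: "\<exists>B\<in>P. W \<subseteq> B" if "W \<in> F" "W \<subset> ?C" for W
  proof -
    have "W \<notin> set (?C # zs)" using that(2) srt by (auto simp: sorted_wrt_append)
    then have "W \<notin> set ys" using zs by (metis UnCI set_append)
    then have "W \<in> singletons n \<union> set xs" using that(1) by (auto simp: F_def)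
    then show ?thesis using block_containing unfolding P_def by blast
  qed
  have nonempty: "W \<noteq> {}" if "W \<in> insert a' F" for W
  proof (cases "W \<in> singletons n")
    case False
    then have "W \<in> set Bs'" using that Bs'(2) by (auto simp: F_def)
    then show ?thesis using merge_order_laminar(3)[OF Bs'(1)] by (auto simp: clusters_def)
  qed (auto simp: singletons_def)
  have F': "singletons n \<union> set Bs' = insert a' F" using Bs'(2) by (auto simp: F_def)
  have split: "\<exists>X\<in>insert a' F. \<exists>Y\<in>insert a' F. X \<inter> Y = {} \<and> B = X \<union> Y"
    if "B \<in> set Bs' \<union> {{1..n}}" for B
    using merge_order_laminar(7)[OF Bs'(1) that] unfolding F' .
  have covered: "T \<subseteq> S" if "S \<subseteq> P" "?C \<subseteq> \<Union>S" for S
    using that block_subset_Union[OF P that(1)] unfolding T_def by blast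
  have not_few: "\<not> ?C \<subseteq> B1 \<union> B2" if "B1 \<in> P" "B2 \<in> P" for B1 B2
  proof
    assume "?C \<subseteq> B1 \<union> B2"
    then have "T \<subseteq> {B1, B2}" using that by (intro covered) auto
    then have "card T \<le> card {B1, B2}" by (intro card_mono) auto
    then show False using card_T card_insert_le_m1[of 2 "{B2}" B1] by (auto split: if_splits)
  qed
  have "\<exists>W\<in>F. a' \<inter> W = {} \<and> ?C = a' \<union> W"
  proof -
    have "?C \<in> set Bs' \<union> {{1..n}}" using Cin Bs'(2) by auto
    from split[OF this] obtain X Y where
      XY: "X \<in> insert a' F" "Y \<in> insert a' F" "X \<inter> Y = {}" "?C = X \<union> Y" by blast
    have "X \<noteq> {}" "Y \<noteq> {}" using nonempty[OF XY(1)] nonempty[OF XY(2)] .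
    then have sub: "X \<subset> ?C" "Y \<subset> ?C" using XY(3,4) by blast+
    have "X = a' \<or> Y = a'"
    proof (rule ccontr)
      assume "\<not> (X = a' \<or> Y = a')"
      then obtain B1 B2 where "B1 \<in> P" "X \<subseteq> B1" "B2 \<in> P" "Y \<subseteq> B2"
        using XY(1,2) sub block by (metis insertE)
      then show False using not_few[of B1 B2] XY(4) by blast
    qed
    moreover have "\<not> (X = a' \<and> Y = a')" using XY(3) nonempty[of a'] by auto
    ultimately show ?thesis using XY by (metis Int_commute Un_commute insertE)
  qed
  then obtain W where W: "W \<in> F" "a' \<inter> W = {}" "?C = a' \<union> W" by blast
  have "W \<noteq> {}" "a' \<noteq> {}" using nonempty[of W] nonempty[of a'] W(1) by simp_all
  then have W_sub: "W \<subset> ?C" and a'_sub: "a' \<subset> ?C" using W(2,3) by blast+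
  have "a' \<in> set Bs' \<union> {{1..n}}" using Bs'(2) by simp
  from split[OF this] obtain V1 V2 where
    V: "V1 \<in> insert a' F" "V2 \<in> insert a' F" "V1 \<inter> V2 = {}" "a' = V1 \<union> V2" by blast
  have V_ne: "V1 \<noteq> {}" "V2 \<noteq> {}" "W \<noteq> {}"
    using nonempty[OF V(1)] nonempty[OF V(2)] \<open>W \<noteq> {}\<close> .
  have "V1 \<noteq> a'" "V2 \<noteq> a'" using V(3,4) V_ne(1,2) by blast+
  then have "V1 \<in> F" "V2 \<in> F" using V(1,2) by simp_all
  moreover have "V1 \<subset> ?C" "V2 \<subset> ?C" using V(4) a'_sub by blast+
  ultimately obtain B1 B2 B3 where
    B: "B1 \<in> P" "V1 \<subseteq> B1" "B2 \<in> P" "V2 \<subseteq> B2" "B3 \<in> P" "W \<subseteq> B3"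
    using block[of V1] block[of V2] block[OF W(1) W_sub] by meson
  have T: "T \<subseteq> {B1, B2, B3}" using B W(3) V(4) by (intro covered) auto
  moreover have "card {B1, B2, B3} \<le> card T"
    using card_T card_length[of "[B1, B2, B3]"] by simp
  ultimately have T_eq: "T = {B1, B2, B3}" by (intro card_seteq) auto
  then have ne: "B1 \<noteq> B2" "B1 \<noteq> B3" "B2 \<noteq> B3"
    using card_T by (auto simp: card_insert_if split: if_splits)
  have disj: "B1 \<inter> B2 = {}" "B1 \<inter> B3 = {}" "B2 \<inter> B3 = {}"
    using partition_on_blocks(3)[OF P] B ne by blast+
  have C_eq: "?C = B1 \<union> B2 \<union> B3" using UC T_eq by auto
  have "V1 = B1" "V2 = B2" "W = B3"
    using C_eq W(3) V(4) B disj by blast+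
  then have a'_eq: "a' = B1 \<union> B2" and C_eq': "?C = a' \<union> B3" using V(4) W(3) by auto
  have "mergeable P a'" using a'_eq B(1,3) ne(1) unfolding mergeable_def by blast
  moreover have "mergeable (merge P a') ?C"
  proof -
    have "\<not> B3 \<subseteq> a'" using W(2) V_ne(3) \<open>W = B3\<close> by auto
    then have "B3 \<in> merge P a'" "a' \<in> merge P a'" "B3 \<noteq> a'" using B(5) by (auto simp: merge_def)
    then show ?thesis using C_eq' unfolding mergeable_def by blast
  qed
  ultimately show ?thesis
    using merge_orders_replace[OF xs aC] a'_sub by (auto simp: P_def)
qed

section \<open>Cycles of the partition complex\<close>

text \<open>
  Used for chains of partitions with \<open>f\<close> the number of blocks: the sorted order of a chain is determined by
  these numbers, also when one member is replaced by an unknown one.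
\<close>

lemma sorted_lists_agree:
  assumes l: "distinct (pre @ q # post)" and key: "map f (pre @ q0 # post) = map f l'"
    and inj: "distinct (map f l')" and set: "set (pre @ q # post) = set l'"
  shows "pre @ q # post = l'"
proof -
  let ?l = "pre @ q # post" and ?m = "pre @ q0 # post" and ?i = "length pre"
  have len: "length ?l = length l'" using arg_cong[OF key, of length] by simp
  have l0: "?m ! j = ?l ! j" if "j \<noteq> ?i" for j
    using that by (auto simp: nth_append nth_Cons')
  have off: "l' ! j = ?l ! j" if j: "j < length ?l" "j \<noteq> ?i" for j
  proof -
    have "?l ! j \<in> set l'" using set j(1) nth_mem by metis
    then obtain k where k: "k < length l'" "l' ! k = ?l ! j" by (metis in_set_conv_nth)
    have "f (?l ! j) = map f ?m ! j" using l0[OF j(2)] j(1) nth_map[of j ?m f]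
      by (simp del: map_append list.map)
    then have "map f l' ! k = map f l' ! j" using k key by (simp del: map_append list.map)
    then have "k = j" using inj k(1) j(1) len nth_eq_iff_index_eq[of "map f l'" k j] by simp
    then show ?thesis using k by simp
  qed
  have "q \<in> set l'" using set by auto
  then obtain k where k: "k < length l'" "l' ! k = q" by (metis in_set_conv_nth)
  have "k = ?i"
  proof (rule ccontr)
    assume "k \<noteq> ?i"
    then have "?l ! k = ?l ! ?i" using off[of k] k len by simp
    then show False using l k(1) len \<open>k \<noteq> ?i\<close> nth_eq_iff_index_eq[of ?l k ?i] by simp
  qed
  show ?thesis
  proof (rule nth_equalityI[OF len])
    fix j assume "j < length ?l"
    then show "?l ! j = l' ! j" using off[of j] k \<open>k = ?i\<close> by (cases "j = ?i") simp_all
  qed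
qed

lemma merges_complete:
  assumes "partition_on U P" "finite U" "merge_seq P (Bs @ [U])"
  shows "merges P (Bs @ [U]) = merges P Bs @ [{U}]"
proof -
  have "merge_seq P Bs" using assms(3) by (simp add: merge_seq_append)
  then have R: "partition_on U (foldl merge P Bs)" using merge_seq_partition[OF assms(1,2)] by blast
  have "X \<subseteq> U" if "X \<in> foldl merge P Bs" for X using partition_on_blocks(2)[OF R that that] .
  then have "merge (foldl merge P Bs) U = {U}" by (auto simp: merge_def)
  then show ?thesis by (simp add: merges_append)
qed

lemma merges_replace:
  assumes "merge (merge P a) (next_cluster n ys) = merge (merge P a') (next_cluster n ys)"
  shows "merges (merge P a) ys = merges (merge P a') ys"
  using assms by (cases ys) auto

text \<open>
  A maximal chain that contains all but one member of a given chain fills the gap at the same place.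
  It comes from a merge order which agrees with the given one except for the merges before and after the gap.
\<close>

lemma partition_simplex_through:
  assumes n: "2 \<le> n" and xs: "xs @ a # ys \<in> merge_orders n"
  defines "P \<equiv> foldl merge (singletons n) xs"
  assumes C: "set (merges (singletons n) xs @ Q # merges (merge P a) ys) \<in> partition_complex n"
    "distinct (merges (singletons n) xs @ Q # merges (merge P a) ys)"
  obtains a' ys' where "Q = merge P a'" "xs @ a' # ys' \<in> merge_orders n"
    "merges (merge P a') ys' = merges (merge P a) ys"
    "ys' = ys \<and> (a \<subseteq> next_cluster n ys \<or> a' = a) \<or>
     \<not> a \<subseteq> next_cluster n ys \<and> (\<exists>zs. ys = a' # zs \<and> ys' = a # zs)"
proof -
  let ?U = "{1..n}" and ?pre = "merges (singletons n) xs" and ?post = "merges (merge P a) ys"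
  note P0 = singletons_partition[of n] finite_atLeastAtMost
  have seq: "merge_seq (singletons n) Bs"
    and len: "length Bs + 2 = n" if "Bs \<in> merge_orders n" for Bs
    using that by (simp_all add: merge_orders_def merge_seq_append)
  have orig: "merges (singletons n) (xs @ a # ys) = ?pre @ merge P a # ?post"
    by (simp add: merges_append P_def)
  have "card (set (?pre @ Q # ?post)) = length (xs @ a # ys)"
    using distinct_card[OF C(2)] by simp
  then have "card (set (?pre @ Q # ?post)) + 2 = n" using len[OF xs] by simp
  then obtain Bs where Bs: "Bs \<in> merge_orders n"
    and set_eq: "set (?pre @ Q # ?post) = set (merges (singletons n) Bs)"
    using partition_complex_card[OF C(1) n] by blast
  have key: "map card (merges (singletons n) Cs) = map (\<lambda>i. n - Suc i) [0..<n - 2]"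
    if "Cs \<in> merge_orders n" for Cs
  proof -
    have "length Cs = n - 2" using len[OF \<open>Cs \<in> _\<close>] by simp
    then show ?thesis using merges_sorted_key[OF P0 seq[OF \<open>Cs \<in> _\<close>]] by (simp add: card_singletons)
  qed
  have "inj_on (\<lambda>i. n - Suc i) {0..<n - 2}" by (auto simp: inj_on_def)
  then have "distinct (map (\<lambda>i. n - Suc i) [0..<n - 2])" by (simp add: distinct_map)
  then have l: "?pre @ Q # ?post = merges (singletons n) Bs"
    using key[OF xs] key[OF Bs] C(2) set_eq unfolding orig by (intro sorted_lists_agree[of _ _ _ card "merge P a"]) simp_all
  define xs' where "xs' = take (length xs) Bs"
  have "length Bs = length (xs @ a # ys)" using len[OF Bs] len[OF xs] by simp
  then have "length xs < length Bs" by simp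
  then have "Bs = xs' @ Bs ! length xs # drop (Suc (length xs)) Bs" and lx: "length xs' = length xs"
    unfolding xs'_def by (simp_all add: id_take_nth_drop[symmetric])
  then obtain a' ys' where Bs_eq: "Bs = xs' @ a' # ys'" by blast
  have l': "?pre @ Q # ?post = merges (singletons n) xs' @
      merges (foldl merge (singletons n) xs') (a' # ys')"
    using l unfolding Bs_eq merges_append .
  then have pre: "?pre = merges (singletons n) xs'" using lx by (simp add: append_eq_append_conv)
  have xs': "xs' = xs"
  proof (rule merges_inj[OF P0])
    show "merge_seq (singletons n) xs'" "merge_seq (singletons n) xs"
      using seq[OF Bs] seq[OF xs] Bs_eq by (simp_all add: merge_seq_append)
  qed (use pre in simp)
  have "?pre @ Q # ?post = ?pre @ merges P (a' # ys')"
    using l' unfolding xs' P_def[symmetric] .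
  then have Q: "Q = merge P a'" and post: "merges (merge P a') ys' = ?post" by simp_all
  have Bs_in: "xs @ a' # ys' \<in> merge_orders n" using Bs Bs_eq xs' by simp
  obtain zs where zs: "ys @ [?U] = next_cluster n ys # zs" and P: "partition_on ?U P" and
    a: "mergeable P a" "mergeable (merge P a) (next_cluster n ys)"
    "merge_seq (merge (merge P a) (next_cluster n ys)) zs"
    using merge_orders_split[OF xs] unfolding P_def by metis
  obtain zs' where zs': "ys' @ [?U] = next_cluster n ys' # zs'" and
    a': "mergeable P a'" "mergeable (merge P a') (next_cluster n ys')"
    "merge_seq (merge (merge P a') (next_cluster n ys')) zs'"
    using merge_orders_split[OF Bs_in] unfolding P_def by metis
  let ?C = "next_cluster n ys" and ?C' = "next_cluster n ys'"
  note ma = merge_mergeable(1)[OF P finite_atLeastAtMost a(1)]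
  note ma' = merge_mergeable(1)[OF P finite_atLeastAtMost a'(1)]
  \<comment> \<open>With the final merge appended both lists have a first merge after the gap, even if \<open>ys\<close> is empty.\<close>
  have "merges (merge P a) (ys @ [?U]) = merges (merge P a') (ys' @ [?U])"
    using merges_complete[OF ma finite_atLeastAtMost, of ys] merges_complete[OF ma' finite_atLeastAtMost, of ys']
      post a a' unfolding zs zs' by simp
  then have R: "merge (merge P a) ?C = merge (merge P a') ?C'"
    and tail: "merges (merge (merge P a) ?C) zs = merges (merge (merge P a') ?C') zs'"
    unfolding zs zs' merges.simps list.inject by blast+
  have "zs = zs'"
    using merges_inj[OF merge_mergeable(1)[OF ma finite_atLeastAtMost a(2)] finite_atLeastAtMost a(3)] a'(3) tail
    unfolding R by blast
  note two = two_merges[OF P finite_atLeastAtMost a(1,2) a'(1,2) R]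
  have "ys' = ys \<and> (a \<subseteq> ?C \<or> a' = a) \<or> \<not> a \<subseteq> ?C \<and> (\<exists>zs. ys = a' # zs \<and> ys' = a # zs)"
  proof (cases "?C' = ?C")
    case True
    then have "ys' = ys" using zs zs' \<open>zs = zs'\<close> by (metis append_same_eq)
    moreover have "a \<subseteq> ?C \<or> a' = a"
      using two True merge_merge_new_blocks(2)[OF P finite_atLeastAtMost a(1,2)] by (auto split: if_splits)
    ultimately show ?thesis by blast
  next
    case False
    then have nsub: "\<not> a \<subseteq> ?C" and eq: "a' = ?C" "?C' = a" using two by (auto split: if_splits)
    have "a \<subseteq> ?U" using merge_mergeable(5)[OF P finite_atLeastAtMost a(1)] .
    then have "?C \<noteq> ?U" using nsub by auto
    then obtain ws where ws: "ys = ?C # ws" by (cases ys) (auto simp: next_cluster_def)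
    then have "zs = ws @ [?U]" using zs by (metis append_Cons list.inject)
    then have "ys' = a # ws" using zs' \<open>zs = zs'\<close> eq(2) by (metis append_Cons append_same_eq)
    then show ?thesis using nsub ws eq(1) by auto
  qed
  then show ?thesis using that[OF Q Bs_in post] by blast
qed

lemma finite_replacements: "finite {a'. xs @ a' # ys \<in> merge_orders n}"
proof (rule finite_subset)
  show "{a'. xs @ a' # ys \<in> merge_orders n} \<subseteq> clusters n"
    using merge_order_laminar(3) by fastforce
qed (rule finite_clusters)

lemma partition_boundary_nested:
  assumes n: "2 \<le> n" and xs: "xs @ a # ys \<in> merge_orders n" and aC: "a \<subseteq> next_cluster n ys"
    and d: "d \<in> oriented_chains (partition_complex n) k"
  defines "pre \<equiv> merges (singletons n) xs" and "post \<equiv> merges (merge (foldl merge (singletons n) xs) a) ys"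
  shows "(\<Sum>Q | d (pre @ Q # post) \<noteq> 0. d (pre @ Q # post)) =
    (\<Sum>a' | xs @ a' # ys \<in> merge_orders n. d (merges (singletons n) (xs @ a' # ys)))"
proof -
  define P where "P = foldl merge (singletons n) xs"
  let ?C = "next_cluster n ys" and ?A = "{a'. xs @ a' # ys \<in> merge_orders n}"
  have P: "partition_on {1..n} P" and a: "mergeable P a" "mergeable (merge P a) ?C"
    using merge_orders_split[OF xs] unfolding P_def by metis+
  have repl: "merges (singletons n) (xs @ a' # ys) = pre @ merge P a' # post" and a': "mergeable P a'"
    if in_M: "xs @ a' # ys \<in> merge_orders n" for a'
  proof -
    have a': "mergeable P a'" "mergeable (merge P a') ?C"
      using merge_orders_split[OF in_M] unfolding P_def by metis+
    have "a' \<subseteq> ?C"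
      using card_blocks_below[OF P finite_atLeastAtMost a] card_blocks_below[OF P finite_atLeastAtMost a'] aC
      by (auto split: if_splits)
    then have "merges (merge P a) ys = merges (merge P a') ys"
      using merge_merge_subset[OF aC, of P] merge_merge_subset[of a' ?C P] by (intro merges_replace[of _ _ n]) simp
    then show "merges (singletons n) (xs @ a' # ys) = pre @ merge P a' # post"
      by (simp add: merges_append pre_def post_def P_def)
    show "mergeable P a'" by fact
  qed
  have inj: "inj_on (merge P) ?A"
    using merge_inj[OF P finite_atLeastAtMost] a' by (auto simp: inj_on_def)
  have "{Q. d (pre @ Q # post) \<noteq> 0} \<subseteq> merge P ` ?A"
  proof
    fix Q assume "Q \<in> {Q. d (pre @ Q # post) \<noteq> 0}"
    then have "set (pre @ Q # post) \<in> partition_complex n" "distinct (pre @ Q # post)"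
      using oriented_chains_support[OF d] by blast+
    then show "Q \<in> merge P ` ?A"
      using aC unfolding pre_def post_def by (elim partition_simplex_through[OF n xs]) (auto simp: P_def)
  qed
  then have "(\<Sum>Q | d (pre @ Q # post) \<noteq> 0. d (pre @ Q # post)) = (\<Sum>Q\<in>merge P ` ?A. d (pre @ Q # post))"
    by (intro sum.mono_neutral_left) (use finite_replacements in auto)
  also have "\<dots> = (\<Sum>a'\<in>?A. d (merges (singletons n) (xs @ a' # ys)))"
    by (simp add: sum.reindex[OF inj] repl)
  finally show ?thesis .
qed

lemma partition_boundary_disjoint:
  assumes n: "2 \<le> n" and xs: "xs @ a # b # zs \<in> merge_orders n" and nab: "\<not> a \<subseteq> b"
    and d: "d \<in> oriented_chains (partition_complex n) k"
  defines "pre \<equiv> merges (singletons n) xs"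
    and "post \<equiv> merges (merge (foldl merge (singletons n) xs) a) (b # zs)"
  shows "(\<Sum>Q | d (pre @ Q # post) \<noteq> 0. d (pre @ Q # post)) =
    d (merges (singletons n) (xs @ a # b # zs)) + d (merges (singletons n) (xs @ b # a # zs))"
    and "xs @ b # a # zs \<in> merge_orders n"
proof -
  let ?R = "\<lambda>A B :: nat set. \<not> B \<subseteq> A"
  define P where "P = foldl merge (singletons n) xs"
  note M = merge_orders_iff[OF n]
  have "sorted_wrt ?R (xs @ b # a # zs)"
    using merge_order_laminar(4)[OF xs] nab by (auto simp: sorted_wrt_append)
  moreover have "set (xs @ b # a # zs) = set (xs @ a # b # zs)" by auto
  ultimately show ba: "xs @ b # a # zs \<in> merge_orders n" using xs unfolding M by simp
  have P: "partition_on {1..n} P" and a: "mergeable P a" "mergeable (merge P a) b"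
    using merge_orders_split[OF xs] unfolding P_def by (metis next_cluster_Cons)+
  have b: "mergeable P b"
    using merge_orders_split[OF ba] unfolding P_def by metis
  have nba: "\<not> b \<subseteq> a" "a \<noteq> b" using merge_merge_new_blocks(2,3)[OF P finite_atLeastAtMost a] by auto
  have eqs: "merges (singletons n) (xs @ a # b # zs) = pre @ merge P a # post"
    "merges (singletons n) (xs @ b # a # zs) = pre @ merge P b # post"
    using merge_commute[OF nab nba(1), of P] by (simp_all add: merges_append pre_def post_def P_def)
  have ne: "merge P a \<noteq> merge P b" using merge_inj[OF P finite_atLeastAtMost a(1) b] nba(2) by blast
  have "{Q. d (pre @ Q # post) \<noteq> 0} \<subseteq> {merge P a, merge P b}"
  proof
    fix Q assume "Q \<in> {Q. d (pre @ Q # post) \<noteq> 0}"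
    then have "set (pre @ Q # post) \<in> partition_complex n" "distinct (pre @ Q # post)"
      using oriented_chains_support[OF d] by blast+
    then show "Q \<in> {merge P a, merge P b}"
      using nab unfolding pre_def post_def by (elim partition_simplex_through[OF n xs]) (auto simp: P_def)
  qed
  then have "(\<Sum>Q | d (pre @ Q # post) \<noteq> 0. d (pre @ Q # post)) = (\<Sum>Q\<in>{merge P a, merge P b}. d (pre @ Q # post))"
    by (intro sum.mono_neutral_left) auto
  then show "(\<Sum>Q | d (pre @ Q # post) \<noteq> 0. d (pre @ Q # post)) =
    d (merges (singletons n) (xs @ a # b # zs)) + d (merges (singletons n) (xs @ b # a # zs))"
    using ne by (simp add: eqs)
qed

text \<open>
  The two conditions on the values at merge orders that express a vanishing
  boundary in either complex. In the second sum three terms occur.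
\<close>

definition merge_order_cycle :: "nat \<Rightarrow> (nat set list \<Rightarrow> int) \<Rightarrow> bool" where
  "merge_order_cycle n h \<longleftrightarrow>
    (\<forall>xs a b ys. xs @ a # b # ys \<in> merge_orders n \<longrightarrow> \<not> a \<subseteq> b \<longrightarrow>
       h (xs @ b # a # ys) = - h (xs @ a # b # ys)) \<and>
    (\<forall>xs a ys. xs @ a # ys \<in> merge_orders n \<longrightarrow> a \<subseteq> next_cluster n ys \<longrightarrow>
       (\<Sum>a' | xs @ a' # ys \<in> merge_orders n. h (xs @ a' # ys)) = 0)"

text \<open>
  Facets of maximal chains are obtained by omitting one partition. Depending on whether its merge is nested in the
  next one, the boundary coefficient is the sum in the second condition or the sum of two coefficients in the
  first.
\<close>

lemma partition_cycle_iff: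
  assumes n: "2 \<le> n" and d: "d \<in> oriented_chains (partition_complex n) (n - 2)"
  shows "boundary d = (\<lambda>_. 0) \<longleftrightarrow> merge_order_cycle n (\<lambda>Bs. d (merges (singletons n) Bs))"
proof -
  let ?v = "merges (singletons n)"
  let ?I = "{(?v xs, merges (merge (foldl merge (singletons n) xs) a) ys) | xs a ys. xs @ a # ys \<in> merge_orders n}"
  let ?S = "\<lambda>xs a ys. \<Sum>Q | d (?v xs @ Q # merges (merge (foldl merge (singletons n) xs) a) ys) \<noteq> 0.
      d (?v xs @ Q # merges (merge (foldl merge (singletons n) xs) a) ys)"
  have "boundary d = (\<lambda>_. 0) \<longleftrightarrow> (\<forall>(xs, ys)\<in>?I. (\<Sum>Q | d (xs @ Q # ys) \<noteq> 0. d (xs @ Q # ys)) = 0)"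
  proof (rule boundary_zero_iff[OF d])
    fix X Q assume X: "X \<in> partition_complex n" "card X = n - 2" "Q \<in> X"
    then obtain Bs where Bs: "Bs \<in> merge_orders n" "X = set (?v Bs)"
      using partition_complex_card[OF X(1) n] n by auto
    then obtain i where i: "i < length Bs" "Q = ?v Bs ! i" using X(3) by (metis in_set_conv_nth length_merges)
    let ?xs = "take i Bs" and ?a = "Bs ! i" and ?ys = "drop (Suc i) Bs"
    have split: "Bs = ?xs @ ?a # ?ys" using i(1) by (rule id_take_nth_drop)
    then have v: "?v Bs = ?v ?xs @ merge (foldl merge (singletons n) ?xs) ?a #
        merges (merge (foldl merge (singletons n) ?xs) ?a) ?ys"
      by (metis merges_append merges.simps(2))
    moreover have "Q = merge (foldl merge (singletons n) ?xs) ?a"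
      using i by (subst i(2), subst v) (simp add: nth_append)
    ultimately have "?v Bs = ?v ?xs @ Q # merges (merge (foldl merge (singletons n) ?xs) ?a) ?ys" by simp
    moreover have "(?v ?xs, merges (merge (foldl merge (singletons n) ?xs) ?a) ?ys) \<in> ?I"
    proof -
      have "?xs @ ?a # ?ys \<in> merge_orders n" by (subst split[symmetric]) (rule Bs(1))
      then show ?thesis by blast
    qed
    ultimately show "\<exists>(xs, ys)\<in>?I. distinct (xs @ Q # ys) \<and> X = set (xs @ Q # ys)"
      using merge_order_partitions(2)[OF Bs(1) n] Bs(2) by (intro bexI[of _ "(_, _)"]) auto
  qed
  also have "\<dots> \<longleftrightarrow> (\<forall>xs a ys. xs @ a # ys \<in> merge_orders n \<longrightarrow> ?S xs a ys = 0)"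
    by blast
  also have "\<dots> \<longleftrightarrow> merge_order_cycle n (\<lambda>Bs. d (?v Bs))"
  proof
    assume S: "\<forall>xs a ys. xs @ a # ys \<in> merge_orders n \<longrightarrow> ?S xs a ys = 0"
    show "merge_order_cycle n (\<lambda>Bs. d (?v Bs))"
      unfolding merge_order_cycle_def
    proof (intro conjI allI impI)
      fix xs a b ys assume *: "xs @ a # b # ys \<in> merge_orders n" "\<not> a \<subseteq> b"
      show "d (?v (xs @ b # a # ys)) = - d (?v (xs @ a # b # ys))"
        using partition_boundary_disjoint(1)[OF n * d] S[rule_format, OF *(1)] by linarith
    next
      fix xs a ys assume *: "xs @ a # ys \<in> merge_orders n" "a \<subseteq> next_cluster n ys"
      show "(\<Sum>a' | xs @ a' # ys \<in> merge_orders n. d (?v (xs @ a' # ys))) = 0"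
        using partition_boundary_nested[OF n * d] S[rule_format, OF *(1)] by simp
    qed
  next
    assume h: "merge_order_cycle n (\<lambda>Bs. d (?v Bs))"
    show "\<forall>xs a ys. xs @ a # ys \<in> merge_orders n \<longrightarrow> ?S xs a ys = 0"
    proof (intro allI impI)
      fix xs a ys assume M: "xs @ a # ys \<in> merge_orders n"
      show "?S xs a ys = 0"
      proof (cases "a \<subseteq> next_cluster n ys")
        case True
        then show ?thesis using partition_boundary_nested[OF n M True d] h M
          unfolding merge_order_cycle_def by simp
      next
        case False
        have "a \<subseteq> {1..n}" using merge_order_laminar(3)[OF M] by (auto simp: clusters_def)
        then obtain b zs where ys: "ys = b # zs" using False by (cases ys) (auto simp: next_cluster_def)
        then have nab: "\<not> a \<subseteq> b" using False by simp
        have "d (?v (xs @ b # a # zs)) = - d (?v (xs @ a # b # zs))"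
          using h M nab unfolding merge_order_cycle_def ys by blast
        then show ?thesis
          using partition_boundary_disjoint(1)[OF n M[unfolded ys] nab d] unfolding ys by linarith
      qed
    qed
  qed
  finally show ?thesis .
qed

section \<open>Comparison of the cycles of the two complexes\<close>

text \<open>
  A cluster can be moved right before the smallest larger set: the sets that it has to pass do not contain it.
\<close>

lemma merge_order_before_parent:
  assumes n: "2 \<le> n" and Bs: "Bs \<in> merge_orders n" and a: "a \<in> set Bs"
  obtains xs ys where "xs @ a # ys \<in> merge_orders n" "set (xs @ a # ys) = set Bs" "a \<subseteq> next_cluster n ys"
proof -
  let ?R = "\<lambda>A B :: nat set. \<not> B \<subseteq> A"
  note M = merge_orders_iff[OF n]
  have aU: "a \<subseteq> {1..n}" using merge_order_laminar(3)[OF Bs] a by (auto simp: clusters_def)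
  obtain xs zs where Bs_eq: "Bs = xs @ a # zs" using a by (meson split_list)
  have "\<exists>us vs. zs = us @ vs \<and> (\<forall>u\<in>set us. \<not> a \<subseteq> u) \<and> a \<subseteq> next_cluster n vs"
  proof (cases "\<exists>z\<in>set zs. a \<subseteq> z")
    case True
    then obtain us C vs where "zs = us @ C # vs" "a \<subseteq> C" "\<forall>u\<in>set us. \<not> a \<subseteq> u"
      using split_list_first_prop[of zs "\<lambda>z. a \<subseteq> z"] by blast
    then show ?thesis by (intro exI[of _ us] exI[of _ "C # vs"]) simp
  next
    case False
    then show ?thesis using aU by (intro exI[of _ zs] exI[of _ "[]"]) (simp add: next_cluster_def)
  qed
  then obtain us vs where uv: "zs = us @ vs" "\<forall>u\<in>set us. \<not> a \<subseteq> u" "a \<subseteq> next_cluster n vs" by blast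
  have "sorted_wrt ?R ((xs @ us) @ a # vs)"
    using merge_order_laminar(4)[OF Bs] uv(2) unfolding Bs_eq uv(1) by (auto simp: sorted_wrt_append)
  moreover have set: "set ((xs @ us) @ a # vs) = set Bs" using Bs_eq uv(1) by auto
  moreover have "length ((xs @ us) @ a # vs) = length Bs" using Bs_eq uv(1) by simp
  ultimately have "(xs @ us) @ a # vs \<in> merge_orders n" using Bs unfolding M by metis
  then show ?thesis using that[OF _ set uv(3)] by blast
qed

text \<open>
  A simplicial complex that looks in the top dimension like the complex of laminar families of clusters; \<open>s\<close> names
  the vertex that belongs to a cluster.
\<close>

locale cluster_complex =
  fixes n :: nat and K :: "'a set set" and s :: "nat set \<Rightarrow> 'a"
  assumes n: "3 \<le> n"
    and inj_s: "inj_on s (clusters n)"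
    and simplex: "Bs \<in> merge_orders n \<Longrightarrow> s ` set Bs \<in> K"
    and card_simplex: "X \<in> K \<Longrightarrow> card X + 2 \<le> n"
    and simplexE: "X \<in> K \<Longrightarrow> card X + 2 = n \<Longrightarrow> \<exists>Bs\<in>merge_orders n. X = s ` set Bs"
begin

lemma n2: "2 \<le> n" using n by simp

lemma map_s:
  assumes "Bs \<in> merge_orders n"
  shows "distinct (map s Bs)" "length (map s Bs) = n - 2" "set (map s Bs) \<in> K"
proof -
  note Bs = merge_order_laminar(3,5,6)[OF assms]
  show "distinct (map s Bs)" using Bs inj_on_subset[OF inj_s] by (simp add: distinct_map)
  show "length (map s Bs) = n - 2" using Bs(3) by simp
  show "set (map s Bs) \<in> K" using simplex[OF assms] by simp
qed

lemma chain_swap: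
  assumes c: "c \<in> oriented_chains K k"
  shows "c (map s (xs @ b # a # ys)) = - c (map s (xs @ a # b # ys))"
proof -
  let ?l = "map s xs @ s a # s b # map s ys" and ?t = "transpose (length (map s xs)) (Suc (length (map s xs)))"
  have "?t permutes {..<length ?l}" by (rule permutes_swap_id) auto
  from oriented_chains_permute[OF c this] show ?thesis
    by (simp add: permute_list_adjacent[of "map s xs", simplified] sign_swap_id)
qed

text \<open>
  The vertices that complete a facet to a maximal simplex belong to the clusters that can be
  exchanged for \<open>a\<close>.
\<close>

lemma chain_boundary_nested:
  assumes xs: "xs @ a # ys \<in> merge_orders n" and aC: "a \<subseteq> next_cluster n ys"
    and c: "c \<in> oriented_chains K (n - 2)"
  shows "(\<Sum>v | c (map s xs @ v # map s ys) \<noteq> 0. c (map s xs @ v # map s ys)) =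
    (\<Sum>a' | xs @ a' # ys \<in> merge_orders n. c (map s (xs @ a' # ys)))"
proof -
  let ?A = "{a'. xs @ a' # ys \<in> merge_orders n}"
  have cl: "a' \<in> clusters n" "set xs \<union> set ys \<subseteq> clusters n" if "xs @ a' # ys \<in> merge_orders n" for a'
    using merge_order_laminar(3)[OF that] by auto
  have inj: "inj_on s ?A" using cl(1) by (intro inj_on_subset[OF inj_s]) auto
  have "{v. c (map s xs @ v # map s ys) \<noteq> 0} \<subseteq> s ` ?A"
  proof
    fix v assume "v \<in> {v. c (map s xs @ v # map s ys) \<noteq> 0}"
    then have v: "distinct (map s xs @ v # map s ys)" "length (map s xs @ v # map s ys) = n - 2"
      "set (map s xs @ v # map s ys) \<in> K"
      using oriented_chains_support[OF c] by blast+
    then have "card (set (map s xs @ v # map s ys)) + 2 = n"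
      using distinct_card[OF v(1)] n by simp
    then obtain Bs where Bs: "Bs \<in> merge_orders n" "set (map s xs @ v # map s ys) = s ` set Bs"
      using simplexE[OF v(3)] by blast
    have Bs_cl: "set Bs \<subseteq> clusters n" by (rule merge_order_laminar(3)[OF Bs(1)])
    have "v \<in> s ` set Bs" using Bs(2) by auto
    then obtain a' where a': "a' \<in> set Bs" "v = s a'" by blast
    have "s ` set Bs = s ` insert a' (set xs \<union> set ys)" using Bs(2) a'(2) by auto
    then have "set Bs = insert a' (set xs \<union> set ys)"
    proof (subst inj_on_image_eq_iff[symmetric, OF inj_s Bs_cl])
      show "insert a' (set xs \<union> set ys) \<subseteq> clusters n" using cl(2)[OF xs] a'(1) Bs_cl by simp blast
    qed
    moreover have "a' \<notin> set xs \<union> set ys" using v(1) a'(2) by auto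
    ultimately show "v \<in> s ` ?A"
      using merge_orders_exchange[OF xs aC Bs(1)] a'(2) by blast
  qed
  then have "(\<Sum>v | c (map s xs @ v # map s ys) \<noteq> 0. c (map s xs @ v # map s ys)) =
      (\<Sum>v\<in>s ` ?A. c (map s xs @ v # map s ys))"
    by (intro sum.mono_neutral_left) (use finite_replacements in auto)
  then show ?thesis by (simp add: sum.reindex[OF inj])
qed

text \<open>
  A facet of a maximal simplex omits one cluster. Testing it on a merge order in which this
  cluster directly precedes a larger set gives the second condition; the first is the orientation rule.
\<close>

lemma cycle_iff:
  assumes c: "c \<in> oriented_chains K (n - 2)"
  shows "boundary c = (\<lambda>_. 0) \<longleftrightarrow> merge_order_cycle n (\<lambda>Bs. c (map s Bs))"
proof -
  let ?I = "{(map s xs, map s ys) | xs a ys. xs @ a # ys \<in> merge_orders n \<and> a \<subseteq> next_cluster n ys}"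
  let ?S = "\<lambda>xs ys. \<Sum>v | c (map s xs @ v # map s ys) \<noteq> 0. c (map s xs @ v # map s ys)"
  have "boundary c = (\<lambda>_. 0) \<longleftrightarrow> (\<forall>(xs, ys)\<in>?I. (\<Sum>v | c (xs @ v # ys) \<noteq> 0. c (xs @ v # ys)) = 0)"
  proof (rule boundary_zero_iff[OF c])
    fix X v assume X: "X \<in> K" "card X = n - 2" "v \<in> X"
    have "card X + 2 = n" using X(2) n by simp
    then obtain Bs where Bs: "Bs \<in> merge_orders n" "X = s ` set Bs"
      using simplexE[OF X(1)] by blast
    then obtain a where a: "a \<in> set Bs" "v = s a" using X(3) by blast
    obtain xs ys where xy: "xs @ a # ys \<in> merge_orders n" "set (xs @ a # ys) = set Bs" "a \<subseteq> next_cluster n ys"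
      using merge_order_before_parent[OF n2 Bs(1) a(1)] .
    have "(map s xs, map s ys) \<in> ?I" using xy by blast
    moreover have "distinct (map s xs @ v # map s ys)" using map_s(1)[OF xy(1)] a(2) by simp
    moreover have "X = set (map s xs @ v # map s ys)"
      unfolding Bs(2) xy(2)[symmetric] a(2) by auto
    ultimately show "\<exists>(xs, ys)\<in>?I. distinct (xs @ v # ys) \<and> X = set (xs @ v # ys)"
      by (intro bexI[of _ "(map s xs, map s ys)"]) simp_all
  qed
  also have "\<dots> \<longleftrightarrow> (\<forall>xs a ys. xs @ a # ys \<in> merge_orders n \<longrightarrow> a \<subseteq> next_cluster n ys \<longrightarrow> ?S xs ys = 0)"
    by blast
  also have "\<dots> \<longleftrightarrow> merge_order_cycle n (\<lambda>Bs. c (map s Bs))"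
  proof -
    have "\<forall>xs a b ys. xs @ a # b # ys \<in> merge_orders n \<longrightarrow> \<not> a \<subseteq> b \<longrightarrow>
        c (map s (xs @ b # a # ys)) = - c (map s (xs @ a # b # ys))"
      by (intro allI impI) (rule chain_swap[OF c])
    moreover have "(\<forall>xs a ys. xs @ a # ys \<in> merge_orders n \<longrightarrow> a \<subseteq> next_cluster n ys \<longrightarrow> ?S xs ys = 0) \<longleftrightarrow>
        (\<forall>xs a ys. xs @ a # ys \<in> merge_orders n \<longrightarrow> a \<subseteq> next_cluster n ys \<longrightarrow>
          (\<Sum>a' | xs @ a' # ys \<in> merge_orders n. c (map s (xs @ a' # ys))) = 0)"
      by (simp only: chain_boundary_nested[OF _ _ c] cong: imp_cong)
    ultimately show ?thesis unfolding merge_order_cycle_def by simp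
  qed
  finally show ?thesis .
qed

text \<open>
  The chain map of the subdivision of the complex by \<open>\<Delta>(\<Pi>\<^sub>n)\<close>: the coefficient of a maximal chain of
  partitions is the coefficient of the family of its newly created blocks, in the order of their creation.
\<close>

definition subdivision :: "('a list \<Rightarrow> int) \<Rightarrow> nat set set list \<Rightarrow> int" where
  "subdivision c = (THE d. d \<in> oriented_chains (partition_complex n) (n - 2) \<and>
     (\<forall>Bs\<in>merge_orders n. d (merges (singletons n) Bs) = c (map s Bs)))"

lemma merges_simplex:
  assumes "Bs \<in> merge_orders n"
  shows "distinct (merges (singletons n) Bs) \<and> length (merges (singletons n) Bs) = n - 2"
  using merge_order_partitions(2)[OF assms n2] merge_order_laminar(6)[OF assms] by simp

lemma partition_chains_eqI:
  assumes "d \<in> oriented_chains (partition_complex n) (n - 2)" "d' \<in> oriented_chains (partition_complex n) (n - 2)"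
    "\<And>Bs. Bs \<in> merge_orders n \<Longrightarrow> d (merges (singletons n) Bs) = d' (merges (singletons n) Bs)"
  shows "d = d'"
proof (rule oriented_chains_eqI[OF assms(1,2) merges_simplex])
  show "\<exists>Bs\<in>merge_orders n. X = set (merges (singletons n) Bs)" if "X \<in> partition_complex n" "card X = n - 2" for X
  proof -
    have "card X + 2 = n" using that(2) n by simp
    then show ?thesis using partition_complex_card[OF that(1) n2] by blast
  qed
qed (simp_all add: assms(3))

lemma chains_eqI:
  assumes "c \<in> oriented_chains K (n - 2)" "c' \<in> oriented_chains K (n - 2)"
    "\<And>Bs. Bs \<in> merge_orders n \<Longrightarrow> c (map s Bs) = c' (map s Bs)"
  shows "c = c'"
proof (rule oriented_chains_eqI[OF assms(1,2)])
  show "distinct (map s Bs) \<and> length (map s Bs) = n - 2" if "Bs \<in> merge_orders n" for Bs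
    using map_s[OF that] by simp
  show "\<exists>Bs\<in>merge_orders n. X = set (map s Bs)" if "X \<in> K" "card X = n - 2" for X
  proof -
    have "card X + 2 = n" using that(2) n by simp
    then show ?thesis using simplexE[OF that(1)] by simp
  qed
qed (simp_all add: assms(3))

text \<open>
  The block counts of a chain determine its order, so no two merge orders describe the same chain of
  partitions and there is no sign rule to check when a chain is built from its values on merge orders.
\<close>

lemma merges_determine_order:
  assumes Bs: "Bs \<in> merge_orders n" "Bs' \<in> merge_orders n"
    and perm: "\<pi> permutes {..<n - 2}" "merges (singletons n) Bs' = permute_list \<pi> (merges (singletons n) Bs)"
  shows "\<pi> = id" "Bs' = Bs"
proof -
  let ?v = "merges (singletons n)"
  note P0 = singletons_partition[of n] finite_atLeastAtMost
  have seq: "merge_seq (singletons n) Cs" and len: "length Cs = n - 2" if "Cs \<in> merge_orders n" for Cs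
    using that by (auto simp: merge_orders_def merge_seq_append)
  have nth: "card (?v Cs ! i) + Suc i = n" if "Cs \<in> merge_orders n" "i < n - 2" for Cs i
    using merge_seq_merges[OF P0 seq[OF that(1)], of i] that(2) len[OF that(1)] by (simp add: card_singletons)
  show "\<pi> = id"
  proof
    fix i
    show "\<pi> i = id i"
    proof (cases "i < n - 2")
      case True
      have "?v Bs' ! i = ?v Bs ! \<pi> i"
        using permute_list_nth[of \<pi> "?v Bs" i] perm True len[OF Bs(1)] by simp
      moreover have "\<pi> i < n - 2" using permutes_in_image[OF perm(1), of i] True by simp
      ultimately show ?thesis using nth[OF Bs(2) True] nth[OF Bs(1), of "\<pi> i"] by simp
    next
      case False
      then show ?thesis using perm(1) by (simp add: permutes_def)
    qed
  qed
  then have "?v Bs' = ?v Bs" using perm(2) by simp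
  then show "Bs' = Bs" using merges_inj[OF P0 seq[OF Bs(2)] seq[OF Bs(1)]] by simp
qed

lemma subdivision_spec:
  shows subdivision_chain: "subdivision c \<in> oriented_chains (partition_complex n) (n - 2)"
    and subdivision_merges: "Bs \<in> merge_orders n \<Longrightarrow> subdivision c (merges (singletons n) Bs) = c (map s Bs)"
proof -
  let ?P = "\<lambda>d. d \<in> oriented_chains (partition_complex n) (n - 2) \<and>
     (\<forall>Bs\<in>merge_orders n. d (merges (singletons n) Bs) = c (map s Bs))"
  obtain d where "d \<in> oriented_chains (partition_complex n) (n - 2)"
    "\<And>Bs. Bs \<in> merge_orders n \<Longrightarrow> d (merges (singletons n) Bs) = c (map s Bs)"
  proof (rule oriented_chain_extension[OF finite_merge_orders])
    fix Bs assume "Bs \<in> merge_orders n"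
    then show "distinct (merges (singletons n) Bs) \<and> length (merges (singletons n) Bs) = n - 2 \<and>
        set (merges (singletons n) Bs) \<in> partition_complex n"
      using merges_simplex merge_order_partitions(1)[OF _ n2] by blast
  next
    fix Bs Bs' \<pi>
    assume "Bs \<in> merge_orders n" "Bs' \<in> merge_orders n" "\<pi> permutes {..<n - 2}"
      "merges (singletons n) Bs' = permute_list \<pi> (merges (singletons n) Bs)"
    from merges_determine_order[OF this] show "c (map s Bs') = sign \<pi> * c (map s Bs)" by simp
  qed blast
  then have "?P d" by blast
  moreover have "d' = d" if "?P d'" for d'
    using that \<open>?P d\<close> by (intro partition_chains_eqI) simp_all
  ultimately have "?P (subdivision c)" unfolding subdivision_def by (rule theI)
  then show "subdivision c \<in> oriented_chains (partition_complex n) (n - 2)"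
    and "Bs \<in> merge_orders n \<Longrightarrow> subdivision c (merges (singletons n) Bs) = c (map s Bs)" by blast+
qed

lemma subdivision_eqI:
  assumes "d \<in> oriented_chains (partition_complex n) (n - 2)"
    "\<And>Bs. Bs \<in> merge_orders n \<Longrightarrow> d (merges (singletons n) Bs) = c (map s Bs)"
  shows "subdivision c = d"
  by (rule partition_chains_eqI) (simp_all add: subdivision_chain subdivision_merges assms)

lemma cycles_eq:
  "cycles K (n - 3) = {c \<in> oriented_chains K (n - 2). merge_order_cycle n (\<lambda>Bs. c (map s Bs))}"
  "cycles (partition_complex n) (n - 3) = {d \<in> oriented_chains (partition_complex n) (n - 2).
     merge_order_cycle n (\<lambda>Bs. d (merges (singletons n) Bs))}"
proof -
  have "n - 3 + 1 = n - 2" using n by simp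
  then show "cycles K (n - 3) = {c \<in> oriented_chains K (n - 2). merge_order_cycle n (\<lambda>Bs. c (map s Bs))}"
    "cycles (partition_complex n) (n - 3) = {d \<in> oriented_chains (partition_complex n) (n - 2).
     merge_order_cycle n (\<lambda>Bs. d (merges (singletons n) Bs))}"
    unfolding cycles_def using cycle_iff partition_cycle_iff[OF n2] by auto
qed

lemma merge_order_cycle_cong:
  assumes "\<And>Bs. Bs \<in> merge_orders n \<Longrightarrow> h Bs = h' Bs" "merge_order_cycle n h"
  shows "merge_order_cycle n h'"
  unfolding merge_order_cycle_def
proof (intro conjI allI impI)
  fix xs a b ys assume *: "xs @ a # b # ys \<in> merge_orders n" "\<not> a \<subseteq> b"
  have "set (xs @ b # a # ys) = set (xs @ a # b # ys)" by auto
  moreover have "sorted_wrt (\<lambda>A B. \<not> B \<subseteq> A) (xs @ b # a # ys)"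
    using merge_order_laminar(4)[OF *(1)] *(2) by (auto simp: sorted_wrt_append)
  ultimately have "xs @ b # a # ys \<in> merge_orders n"
    using *(1) unfolding merge_orders_iff[OF n2] by simp
  then show "h' (xs @ b # a # ys) = - h' (xs @ a # b # ys)"
    using assms * unfolding merge_order_cycle_def by (metis (no_types, lifting))
next
  fix xs a ys assume *: "xs @ a # ys \<in> merge_orders n" "a \<subseteq> next_cluster n ys"
  have "(\<Sum>a' | xs @ a' # ys \<in> merge_orders n. h' (xs @ a' # ys)) =
      (\<Sum>a' | xs @ a' # ys \<in> merge_orders n. h (xs @ a' # ys))"
    by (rule sum.cong) (simp_all add: assms(1))
  then show "(\<Sum>a' | xs @ a' # ys \<in> merge_orders n. h' (xs @ a' # ys)) = 0"
    using assms(2) * unfolding merge_order_cycle_def by simp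
qed

text \<open>
  The values at merge orders determine both kinds of chains, and the cycle conditions
  agree. Surjectivity needs that an arbitrary cycle of partitions obeys the sign rule for
  different merge orders of one family, which follows from the first condition.
\<close>

lemma bij_betw_subdivision: "bij_betw subdivision (cycles K (n - 3)) (cycles (partition_complex n) (n - 3))"
  unfolding bij_betw_def
proof
  show "inj_on subdivision (cycles K (n - 3))"
  proof (rule inj_onI)
    fix c c' assume c: "c \<in> cycles K (n - 3)" "c' \<in> cycles K (n - 3)" and eq: "subdivision c = subdivision c'"
    show "c = c'"
    proof (rule chains_eqI)
      show "c (map s Bs) = c' (map s Bs)" if "Bs \<in> merge_orders n" for Bs
        using subdivision_merges[OF that, of c] subdivision_merges[OF that, of c'] eq by simp
    qed (use c in \<open>simp_all add: cycles_eq\<close>)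
  qed
  show "subdivision ` cycles K (n - 3) = cycles (partition_complex n) (n - 3)"
  proof (intro equalityI subsetI)
    fix d assume "d \<in> subdivision ` cycles K (n - 3)"
    then obtain c where c: "d = subdivision c" "merge_order_cycle n (\<lambda>Bs. c (map s Bs))"
      by (auto simp: cycles_eq)
    then show "d \<in> cycles (partition_complex n) (n - 3)"
      using subdivision_chain merge_order_cycle_cong[OF _ c(2)] subdivision_merges by (simp add: cycles_eq)
  next
    fix d assume d: "d \<in> cycles (partition_complex n) (n - 3)"
    define h where "h = (\<lambda>Bs. d (merges (singletons n) Bs))"
    have dc: "d \<in> oriented_chains (partition_complex n) (n - 2)" and h: "merge_order_cycle n h"
      using d by (simp_all add: cycles_eq h_def)
    have swap: "h (xs @ b # a # ys) = - h (xs @ a # b # ys)"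
      if "xs @ a # b # ys \<in> merge_orders n" "xs @ b # a # ys \<in> merge_orders n" for xs a b ys
    proof -
      have "\<not> a \<subseteq> b" using merge_order_laminar(4)[OF that(2)] by (simp add: sorted_wrt_append)
      then show ?thesis using h that(1) unfolding merge_order_cycle_def by blast
    qed
    obtain c where c: "c \<in> oriented_chains K (n - 2)" "\<And>Bs. Bs \<in> merge_orders n \<Longrightarrow> c (map s Bs) = h Bs"
    proof (rule oriented_chain_extension[OF finite_merge_orders])
      fix Bs assume "Bs \<in> merge_orders n"
      then show "distinct (map s Bs) \<and> length (map s Bs) = n - 2 \<and> set (map s Bs) \<in> K" using map_s by blast
    next
      fix Bs Bs' \<pi>
      assume *: "Bs \<in> merge_orders n" "Bs' \<in> merge_orders n" "\<pi> permutes {..<n - 2}"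
        "map s Bs' = permute_list \<pi> (map s Bs)"
      have len: "length Bs = n - 2" using map_s(2)[OF *(1)] by simp
      then have "map s Bs' = map s (permute_list \<pi> Bs)" using *(3,4) by (simp add: permute_list_map)
      moreover have "set Bs' \<union> set (permute_list \<pi> Bs) \<subseteq> clusters n"
        using merge_order_laminar(3)[OF *(1)] merge_order_laminar(3)[OF *(2)] *(3) len by simp
      ultimately have Bs': "Bs' = permute_list \<pi> Bs" using map_inj_on inj_on_subset[OF inj_s] by metis
      then have "set Bs = set Bs'" using *(3) len by simp
      then obtain \<rho> where \<rho>: "\<rho> permutes {..<length Bs}" "Bs' = permute_list \<rho> Bs" "h Bs' = sign \<rho> * h Bs"
        using merge_orders_sign[of n h, OF n2 swap *(1,2)] by blast
      have "\<rho> = \<pi>"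
        using permute_list_inj[OF merge_order_laminar(5)[OF *(1)] \<rho>(1), of \<pi>] *(3) len \<rho>(2) Bs' by simp
      then show "h Bs' = sign \<pi> * h Bs" using \<rho>(3) by simp
    qed blast
    have "merge_order_cycle n (\<lambda>Bs. c (map s Bs))"
      by (rule merge_order_cycle_cong[OF _ h]) (simp add: c(2))
    then have "c \<in> cycles K (n - 3)" using c(1) by (simp add: cycles_eq)
    moreover have "subdivision c = d" by (rule subdivision_eqI[OF dc]) (simp add: c(2) h_def)
    ultimately show "d \<in> subdivision ` cycles K (n - 3)" by blast
  qed
qed

lemma subdivision_add: "subdivision (\<lambda>xs. c xs + c' xs) = (\<lambda>xs. subdivision c xs + subdivision c' xs)"
  by (rule subdivision_eqI[OF oriented_chains_add[OF subdivision_chain subdivision_chain]]) (simp add: subdivision_merges)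

end

section \<open>Equivariance\<close>

text \<open>
  Relabelling commutes with merging, hence with the passage from merge orders to chains of partitions.
\<close>

lemma permute_partition_merge:
  assumes "inj \<sigma>"
  shows "permute_partition \<sigma> (merge P B) = merge (permute_partition \<sigma> P) (\<sigma> ` B)"
proof -
  have "{Y \<in> (`) \<sigma> ` P. \<not> Y \<subseteq> \<sigma> ` B} = (`) \<sigma> ` {X \<in> P. \<not> \<sigma> ` X \<subseteq> \<sigma> ` B}" by blast
  then show ?thesis
    by (simp add: permute_partition_def merge_def inj_image_subset_iff[OF assms])
qed

lemma permute_partition_merges:
  assumes "inj \<sigma>"
  shows "map (permute_partition \<sigma>) (merges P Bs) = merges (permute_partition \<sigma> P) (map ((`) \<sigma>) Bs)"
  by (induction Bs arbitrary: P) (simp_all add: permute_partition_merge[OF assms])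

lemma permute_partition_singletons:
  assumes "\<sigma> permutes {1..n}"
  shows "permute_partition \<sigma> (singletons n) = singletons n"
proof -
  have "permute_partition \<sigma> (singletons n) = (\<lambda>i. {i}) ` (\<sigma> ` {1..n})"
    by (simp add: permute_partition_def singletons_def image_image)
  then show ?thesis using permutes_image[OF assms] by (simp add: singletons_def)
qed

lemma permute_clusters:
  assumes "\<sigma> permutes {1..n}" "B \<in> clusters n"
  shows "\<sigma> ` B \<in> clusters n"
proof -
  have "\<sigma> ` B \<subset> \<sigma> ` {1..n}"
    using assms(2) permutes_inj[OF assms(1)]
    by (simp add: clusters_def psubset_eq inj_image_subset_iff inj_image_eq_iff)
  moreover have "card (\<sigma> ` B) = card B"
    using card_image[OF inj_on_subset[OF permutes_inj[OF assms(1)]]] by blast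
  ultimately show ?thesis using assms permutes_image[OF assms(1)] by (simp add: clusters_def)
qed

lemma permute_merge_orders:
  assumes n: "2 \<le> n" and \<sigma>: "\<sigma> permutes {1..n}" and Bs: "Bs \<in> merge_orders n"
  shows "map ((`) \<sigma>) Bs \<in> merge_orders n"
proof -
  note inj = permutes_inj[OF \<sigma>]
  note L = merge_order_laminar[OF Bs]
  have "laminar ((`) \<sigma> ` set Bs)"
    using L(2) unfolding laminar_def ball_simps image_Int[OF inj, symmetric] inj_image_subset_iff[OF inj]
    by simp
  moreover have "(`) \<sigma> ` set Bs \<subseteq> clusters n" using L(3) permute_clusters[OF \<sigma>] by blast
  moreover have "sorted_wrt (\<lambda>A B. \<not> B \<subseteq> A) (map ((`) \<sigma>) Bs)"
    using L(4) by (simp add: sorted_wrt_map inj_image_subset_iff[OF inj])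
  ultimately show ?thesis using L(6) unfolding merge_orders_iff[OF n] by simp
qed

lemma permute_partition_comp: "permute_partition (\<sigma> \<circ> \<tau>) = permute_partition \<sigma> \<circ> permute_partition \<tau>"
  by (simp add: permute_partition_def fun_eq_iff image_image image_comp)

lemma permute_partition_id: "permute_partition id = id"
  by (simp add: permute_partition_def fun_eq_iff)

lemma bij_permute_partition:
  assumes "bij \<sigma>"
  shows "bij (permute_partition \<sigma>)" "inv' (permute_partition \<sigma>) = permute_partition (inv' \<sigma>)"
proof -
  have 1: "permute_partition \<sigma> \<circ> permute_partition (inv' \<sigma>) = id"
    using assms by (simp add: permute_partition_id bij_is_surj surj_iff[THEN iffD1] flip: permute_partition_comp)
  have 2: "permute_partition (inv' \<sigma>) \<circ> permute_partition \<sigma> = id"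
    using assms by (simp add: permute_partition_id bij_is_inj flip: permute_partition_comp)
  show "bij (permute_partition \<sigma>)" using o_bij[OF 2 1] .
  show "inv' (permute_partition \<sigma>) = permute_partition (inv' \<sigma>)" by (rule inv_unique_comp[OF 1 2])
qed

locale equivariant_cluster_complex = cluster_complex n K s
  for n :: nat and K :: "'a set set" and s :: "nat set \<Rightarrow> 'a" +
  fixes act :: "(nat \<Rightarrow> nat) \<Rightarrow> 'a \<Rightarrow> 'a"
  assumes bij_act: "\<sigma> permutes {1..n} \<Longrightarrow> bij (act \<sigma>)"
    and act_id: "act id = id"
    and act_comp: "\<sigma> permutes {1..n} \<Longrightarrow> \<tau> permutes {1..n} \<Longrightarrow> act (\<sigma> \<circ> \<tau>) = act \<sigma> \<circ> act \<tau>"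
    and act_s: "\<sigma> permutes {1..n} \<Longrightarrow> B \<in> clusters n \<Longrightarrow> act \<sigma> (s B) = s (\<sigma> ` B)"
begin

lemma chain_map_partition:
  assumes \<sigma>: "\<sigma> permutes {1..n}" and Bs: "Bs \<in> merge_orders n"
  shows "chain_map (permute_partition \<sigma>) d (merges (singletons n) Bs) =
    d (merges (singletons n) (map ((`) (inv' \<sigma>)) Bs))"
proof -
  note b = permutes_bij[OF \<sigma>] and i = permutes_inv[OF \<sigma>]
  have "map (permute_partition (inv' \<sigma>)) (merges (singletons n) Bs) =
      merges (singletons n) (map ((`) (inv' \<sigma>)) Bs)"
    using permute_partition_merges[OF permutes_inj[OF i]] permute_partition_singletons[OF i] by metis
  then show ?thesis
    by (simp add: chain_map_bij bij_permute_partition[OF b])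
qed

lemma chain_map_act:
  assumes \<sigma>: "\<sigma> permutes {1..n}" and Bs: "Bs \<in> merge_orders n"
  shows "chain_map (act \<sigma>) c (map s Bs) = c (map s (map ((`) (inv' \<sigma>)) Bs))"
proof -
  note i = permutes_inv[OF \<sigma>]
  have "inv' (act \<sigma>) (s B) = s (inv' \<sigma> ` B)" if B: "B \<in> clusters n" for B
  proof -
    have "act \<sigma> (s (inv' \<sigma> ` B)) = s (\<sigma> ` inv' \<sigma> ` B)" by (rule act_s[OF \<sigma> permute_clusters[OF i B]])
    also have "\<sigma> ` inv' \<sigma> ` B = B" using image_f_inv_f[OF bij_is_surj[OF permutes_bij[OF \<sigma>]]] .
    finally show ?thesis using inv_f_eq[OF bij_is_inj[OF bij_act[OF \<sigma>]]] by blast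
  qed
  then have "map (inv' (act \<sigma>)) (map s Bs) = map s (map ((`) (inv' \<sigma>)) Bs)"
    using merge_order_laminar(3)[OF Bs] by auto
  then show ?thesis by (simp only: chain_map_bij[OF bij_act[OF \<sigma>]])
qed

lemma no_larger_simplex: "X \<in> K \<Longrightarrow> card X \<noteq> n - 3 + 2"
  using card_simplex[of X] n by auto

lemma no_larger_partition_simplex: "X \<in> partition_complex n \<Longrightarrow> card X \<noteq> n - 3 + 2"
  using partition_complex_card[of X n] n by auto

lemma act_simplex:
  assumes \<sigma>: "\<sigma> permutes {1..n}" and X: "X \<in> K" "card X = n - 3 + 1"
  shows "act \<sigma> ` X \<in> K"
proof -
  have "card X + 2 = n" using X(2) n by simp
  then obtain Bs where Bs: "Bs \<in> merge_orders n" "X = s ` set Bs" using simplexE[OF X(1)] by blast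
  have "act \<sigma> ` X = s ` set (map ((`) \<sigma>) Bs)"
    using act_s[OF \<sigma>] merge_order_laminar(3)[OF Bs(1)] unfolding Bs(2) by (auto simp: image_image subset_iff)
  then show ?thesis using simplex[OF permute_merge_orders[OF n2 \<sigma> Bs(1)]] by simp
qed

lemma permute_partition_simplex:
  assumes \<sigma>: "\<sigma> permutes {1..n}" and X: "X \<in> partition_complex n" "card X = n - 3 + 1"
  shows "permute_partition \<sigma> ` X \<in> partition_complex n"
proof -
  have "card X + 2 = n" using X(2) n by simp
  then obtain Bs where Bs: "Bs \<in> merge_orders n" "X = set (merges (singletons n) Bs)"
    using partition_complex_card[OF X(1) n2] by blast
  have "permute_partition \<sigma> ` X = set (map (permute_partition \<sigma>) (merges (singletons n) Bs))"
    using Bs(2) by simp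
  also have "\<dots> = set (merges (singletons n) (map ((`) \<sigma>) Bs))"
    using permute_partition_merges[OF permutes_inj[OF \<sigma>]] permute_partition_singletons[OF \<sigma>] by metis
  finally show ?thesis using merge_order_partitions(1)[OF permute_merge_orders[OF n2 \<sigma> Bs(1)] n2] by simp
qed

lemma subdivision_equivariant:
  assumes \<sigma>: "\<sigma> permutes {1..n}" and c: "c \<in> cycles K (n - 3)"
  shows "subdivision (chain_map (act \<sigma>) c) = chain_map (permute_partition \<sigma>) (subdivision c)"
proof (rule subdivision_eqI)
  have "subdivision c \<in> cycles (partition_complex n) (n - 3)"
    using bij_betw_subdivision c by (auto simp: bij_betw_def)
  then have "chain_map (permute_partition \<sigma>) (subdivision c) \<in> cycles (partition_complex n) (n - 3)"
    using chain_map_cycle[OF bij_permute_partition(1)[OF permutes_bij[OF \<sigma>]] permute_partition_simplex[OF \<sigma>]]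
    by blast
  then show "chain_map (permute_partition \<sigma>) (subdivision c) \<in> oriented_chains (partition_complex n) (n - 2)"
    by (simp add: cycles_eq)
  fix Bs assume Bs: "Bs \<in> merge_orders n"
  show "chain_map (permute_partition \<sigma>) (subdivision c) (merges (singletons n) Bs) = chain_map (act \<sigma>) c (map s Bs)"
    by (simp add: chain_map_partition[OF \<sigma> Bs] chain_map_act[OF \<sigma> Bs] del: map_map
        subdivision_merges[OF permute_merge_orders[OF n2 permutes_inv[OF \<sigma>] Bs]])
      (simp add: subdivision_merges[OF permute_merge_orders[OF n2 permutes_inv[OF \<sigma>] Bs]])
qed

theorem top_homology_isomorphic:
  "isomorphic_group_modules (sym_group n)
    (reduced_simplicial_homology K (n - 3)) (\<lambda>\<sigma>. homology_map K (n - 3) (act \<sigma>))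
    (reduced_simplicial_homology (partition_complex n) (n - 3))
    (\<lambda>\<sigma>. homology_map (partition_complex n) (n - 3) (permute_partition \<sigma>))"
proof (rule isomorphic_top_homology)
  show "group_module (sym_group n) (reduced_simplicial_homology K (n - 3)) (\<lambda>\<sigma>. homology_map K (n - 3) (act \<sigma>))"
    by (rule group_module_top_homology)
      (simp_all add: sym_group_is_group sym_group_carrier sym_group_mult sym_group_one no_larger_simplex bij_act act_id act_comp act_simplex
        del: add_2_eq_Suc')
  show "group_module (sym_group n) (reduced_simplicial_homology (partition_complex n) (n - 3))
      (\<lambda>\<sigma>. homology_map (partition_complex n) (n - 3) (permute_partition \<sigma>))"
    by (rule group_module_top_homology)
      (simp_all add: sym_group_is_group sym_group_carrier sym_group_mult sym_group_one no_larger_partition_simplex bij_permute_partition permutes_bij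
        permute_partition_id permute_partition_comp permute_partition_simplex del: add_2_eq_Suc')
  show "bij_betw subdivision (cycles K (n - 3)) (cycles (partition_complex n) (n - 3))"
    by (rule bij_betw_subdivision)
qed (simp_all add: no_larger_simplex no_larger_partition_simplex subdivision_add subdivision_equivariant sym_group_carrier
    del: add_2_eq_Suc')

end

section \<open>Trees and their bridges\<close>

abbreviation linked :: "'v set set \<Rightarrow> 'v \<Rightarrow> 'v \<Rightarrow> bool" where
  "linked E x y \<equiv> y \<in> component_of E x"

lemma linked_refl: "linked E x x"
  by (simp add: component_of_def)

lemma linked_edge: "linked E x y \<Longrightarrow> {y, z} \<in> E \<Longrightarrow> linked E x z"
  by (auto simp: component_of_def intro: rtrancl_into_rtrancl)

lemma linked_induct [consumes 1, case_names base step]: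
  assumes "linked E x y" "P x" "\<And>y z. linked E x y \<Longrightarrow> P y \<Longrightarrow> {y, z} \<in> E \<Longrightarrow> P z"
  shows "P y"
proof -
  have "(x, y) \<in> {(x, y). {x, y} \<in> E}\<^sup>*" using assms(1) by (simp add: component_of_def)
  then show ?thesis
    by (induction rule: rtrancl_induct) (use assms(2,3) in \<open>auto simp: component_of_def\<close>)
qed

lemma linked_trans: "linked E x y \<Longrightarrow> linked E y z \<Longrightarrow> linked E x z"
  by (auto simp: component_of_def)

lemma linked_sym: "linked E x y \<Longrightarrow> linked E y x"
proof (induction rule: linked_induct)
  case (step y z)
  have "linked E z y" using linked_edge[OF linked_refl, of z y E] step.hyps(2) by (simp add: insert_commute)
  then show ?case using step.IH linked_trans by metis
qed (rule linked_refl)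

lemma linked_mono:
  assumes "E \<subseteq> E'" "linked E x y"
  shows "linked E' x y"
  using assms(2) by (induction rule: linked_induct) (use assms(1) linked_refl linked_edge in \<open>fast+\<close>)

lemma component_of_eq_iff: "component_of E x = component_of E y \<longleftrightarrow> linked E x y"
proof
  show "linked E x y" if "component_of E x = component_of E y" using linked_refl[of y E] that by simp
  show "component_of E x = component_of E y" if "linked E x y"
    using linked_trans[OF that] linked_trans[OF linked_sym[OF that]] by blast
qed

definition below :: "'v ltree \<Rightarrow> 'v set \<Rightarrow> 'v set" where
  "below t e = {v \<in> verts t. \<not> linked (edges t - {e}) (root t) v}"

definition cluster :: "nat \<Rightarrow> 'v ltree \<Rightarrow> 'v set \<Rightarrow> nat set" where
  "cluster n t e = {i \<in> {1..n}. leaf t i \<in> below t e}"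

text \<open>
  What is used about trees: they are connected, every edge is a bridge, and the root is not a leaf. These
  properties survive contraction of internal edges and are easier to transport than the absence of cycles.
\<close>

locale bridge_tree =
  fixes n :: nat and t :: "'v ltree"
  assumes finite_verts: "finite (verts t)"
    and edgeE: "e \<in> edges t \<Longrightarrow> \<exists>a b. a \<noteq> b \<and> e = {a, b} \<and> a \<in> verts t \<and> b \<in> verts t"
    and linked_verts: "u \<in> verts t \<Longrightarrow> v \<in> verts t \<Longrightarrow> linked (edges t) u v"
    and bridge: "{a, b} \<in> edges t \<Longrightarrow> \<not> linked (edges t - {{a, b}}) a b"
    and root_in: "root t \<in> verts t" and root_not_leaf: "root t \<notin> leaves t"
    and leaf_bij: "bij_betw (leaf t) {1..n} (leaves t)"
begin

lemma edge_verts: "{a, b} \<in> edges t \<Longrightarrow> a \<in> verts t \<and> b \<in> verts t \<and> a \<noteq> b"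
  using edgeE[of "{a, b}"] by (auto simp: doubleton_eq_iff)

lemma finite_edges: "finite (edges t)"
proof (rule finite_subset)
  show "edges t \<subseteq> Pow (verts t)" using edgeE by blast
qed (simp add: finite_verts)

lemma linked_in_verts:
  assumes "E' \<subseteq> edges t" "a \<in> verts t" "linked E' a v"
  shows "v \<in> verts t"
  using assms(3) by (induction rule: linked_induct) (use assms(1,2) edge_verts in blast)+

lemma edge_sides:
  assumes "{a, b} \<in> edges t" "v \<in> verts t"
  shows "linked (edges t - {{a, b}}) a v \<or> linked (edges t - {{a, b}}) b v"
proof -
  have "linked (edges t) a v" using linked_verts assms edge_verts by blast
  then show ?thesis
  proof (induction rule: linked_induct)
    case (step y z)
    show ?case
    proof (cases "{y, z} = {a, b}")
      case True
      then have "z = a \<or> z = b" by (auto simp: doubleton_eq_iff)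
      then show ?thesis using linked_refl by metis
    next
      case False
      then have "{y, z} \<in> edges t - {{a, b}}" using step.hyps by simp
      then show ?thesis using step.IH linked_edge by metis
    qed
  qed (simp add: linked_refl)
qed

text \<open>
  Removing an edge leaves two components; \<open>b\<close> is the end of the edge away from the root.
\<close>

lemma below_eq:
  assumes "e \<in> edges t"
  obtains a b where "e = {a, b}" "a \<noteq> b" "a \<in> verts t" "b \<in> verts t" "linked (edges t - {e}) (root t) a"
    "below t e = {v \<in> verts t. linked (edges t - {e}) b v}" "b \<in> below t e" "a \<notin> below t e"
proof -
  \<comment> \<open>for either choice of the end \<open>a\<close> that is linked to the root\<close>
  have *: "below t e = {v \<in> verts t. linked (edges t - {e}) b v}"
    if e: "e = {a, b}" and ra: "linked (edges t - {e}) (root t) a" for a b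
  proof -
    have "\<not> linked (edges t - {e}) (root t) v \<longleftrightarrow> linked (edges t - {e}) b v" if v: "v \<in> verts t" for v
    proof
      assume "\<not> linked (edges t - {e}) (root t) v"
      then have "\<not> linked (edges t - {e}) a v" using ra linked_trans by metis
      then show "linked (edges t - {e}) b v" using edge_sides[of a b v] assms e v by blast
    next
      assume bv: "linked (edges t - {e}) b v"
      show "\<not> linked (edges t - {e}) (root t) v"
      proof
        assume "linked (edges t - {e}) (root t) v"
        then have "linked (edges t - {e}) a b"
          using linked_trans[OF linked_trans[OF linked_sym[OF ra]] linked_sym[OF bv]] by blast
        then show False using bridge[of a b] assms e by blast
      qed
    qed
    then show ?thesis unfolding below_def by blast
  qed
  obtain a b where e: "e = {a, b}" and ab: "a \<noteq> b" "a \<in> verts t" "b \<in> verts t" using edgeE[OF assms] by blast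
  have "linked (edges t - {e}) (root t) a \<or> linked (edges t - {e}) (root t) b"
    using edge_sides[of a b "root t"] assms root_in linked_sym unfolding e by metis
  then obtain a' b' where ab': "e = {a', b'}" "linked (edges t - {e}) (root t) a'" "a' \<in> verts t" "b' \<in> verts t" "a' \<noteq> b'"
    using e ab by (metis insert_commute)
  have "b' \<in> below t e" using *[OF ab'(1,2)] linked_refl[of b'] ab'(4) by simp
  moreover have "a' \<notin> below t e" using ab'(2) by (simp add: below_def)
  ultimately show ?thesis using that[OF ab'(1) ab'(5,3,4,2) *[OF ab'(1,2)]] by blast
qed

lemma linked_beyond:
  assumes "{a, b} \<in> edges t" "{b, c} \<in> edges t" "{b, c} \<noteq> {a, b}"
    and "linked (edges t - {{b, c}}) c v"
  shows "linked (edges t - {{a, b}}) b v"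
  using assms(4)
proof (induction rule: linked_induct)
  case base
  show ?case using linked_edge[OF linked_refl, of b c] assms(2,3) by simp
next
  case (step y z)
  have "{y, z} \<noteq> {a, b}"
  proof
    assume "{y, z} = {a, b}"
    then have "b = y \<or> b = z" by (auto simp: doubleton_eq_iff)
    moreover have "linked (edges t - {{b, c}}) c z" using step.hyps linked_edge by metis
    ultimately have "linked (edges t - {{b, c}}) c b" using step.hyps(1) by blast
    then show False using bridge[OF assms(2)] linked_sym by metis
  qed
  then show ?case using step linked_edge[of y _ b z] by simp
qed

text \<open>
  Walking away from \<open>a\<close> through \<open>b\<close> ends in a leaf: as long as \<open>b\<close> is not a leaf there is another
  edge to follow, and the part of the tree ahead shrinks.
\<close>

lemma leaf_beyond:
  assumes "{a, b} \<in> edges t"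
  shows "\<exists>l\<in>leaves t. linked (edges t - {{a, b}}) b l"
  using assms
proof (induction "card {v \<in> verts t. linked (edges t - {{a, b}}) b v}" arbitrary: a b rule: less_induct)
  case less
  let ?D = "{e \<in> edges t. b \<in> e}"
  have b: "b \<in> verts t" using edge_verts[OF less.prems] by simp
  show ?case
  proof (cases "b \<in> leaves t")
    case True
    then show ?thesis using linked_refl by metis
  next
    case False
    then have "card ?D \<noteq> 1" using b by (simp add: leaves_def degree_def)
    then have "?D \<noteq> {{a, b}}" by (metis card_1_singleton_iff One_nat_def)
    moreover have "{a, b} \<in> ?D" using less.prems by simp
    ultimately obtain e where e: "e \<in> edges t" "b \<in> e" "e \<noteq> {a, b}" by blast
    then obtain c where c: "e = {b, c}" "c \<noteq> b" using edgeE[OF e(1)] by blast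
    have bc: "{b, c} \<in> edges t" "{b, c} \<noteq> {a, b}" using e c by auto
    let ?S = "{v \<in> verts t. linked (edges t - {{a, b}}) b v}"
    let ?S' = "{v \<in> verts t. linked (edges t - {{b, c}}) c v}"
    have "?S' \<subseteq> ?S" using linked_beyond[OF less.prems bc] by blast
    moreover have "b \<in> ?S" using b linked_refl by fast
    moreover have "b \<notin> ?S'" using bridge[OF bc(1)] linked_sym[of b _ c] by blast
    ultimately have "?S' \<subset> ?S" by blast
    then have "card ?S' < card ?S" using finite_verts by (intro psubset_card_mono) auto
    then obtain l where "l \<in> leaves t" "linked (edges t - {{b, c}}) c l"
      using less.hyps[OF _ bc(1)] by blast
    then show ?thesis using linked_beyond[OF less.prems bc] by blast
  qed
qed

text \<open>
  If \<open>e'\<close> lies on the far side of \<open>e\<close>, then the root side of \<open>e\<close> stays connected without \<open>e'\<close>; otherwise the far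
  side does. In either case one side of \<open>e\<close> lies on one side of \<open>e'\<close>.
\<close>

lemma below_laminar:
  assumes "e \<in> edges t" "e' \<in> edges t"
  shows "below t e \<subseteq> below t e' \<or> below t e' \<subseteq> below t e \<or> below t e \<inter> below t e' = {}"
proof (cases "e = e'")
  case False
  obtain a b where e: "e = {a, b}" "b \<in> verts t" "below t e = {v \<in> verts t. linked (edges t - {e}) b v}"
    using below_eq[OF assms(1)] .
  obtain a' b' where e': "e' = {a', b'}" "a' \<in> verts t" "b' \<in> verts t"
    "below t e' = {v \<in> verts t. linked (edges t - {e'}) b' v}"
    using below_eq[OF assms(2)] .
  have ab': "{a', b'} \<in> edges t - {e}" "{b', a'} \<in> edges t - {e}"
    using e'(1) assms(2) False by (auto simp: insert_commute)
  have sides: "a' \<in> below t e \<longleftrightarrow> b' \<in> below t e"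
    using linked_edge[OF _ ab'(1), of b] linked_edge[OF _ ab'(2), of b] e'(2,3) unfolding e(3) by simp blast
  show ?thesis
  proof (cases "b' \<in> below t e")
    case True
    have "linked (edges t - {e'}) (root t) v" if "linked (edges t - {e}) (root t) v" for v
      using that
    proof (induction rule: linked_induct)
      case (step y z)
      have "y \<notin> below t e" using step.hyps(1) by (simp add: below_def)
      then have "{y, z} \<noteq> e'" using True sides e'(1) by (auto simp: doubleton_eq_iff)
      then show ?case using step linked_edge[of y _ "root t" z] by simp
    qed (rule linked_refl)
    then have "below t e' \<subseteq> below t e" unfolding below_def by blast
    then show ?thesis by simp
  next
    case False
    have *: "linked (edges t - {e'}) b v" if "linked (edges t - {e}) b v" for v
      using that
    proof (induction rule: linked_induct)
      case (step y z)
      have "y \<in> verts t" using linked_in_verts[OF _ e(2) step.hyps(1)] by blast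
      then have "y \<in> below t e" using step.hyps(1) e(3) by simp
      then have "{y, z} \<noteq> e'" using False sides e'(1) by (auto simp: doubleton_eq_iff)
      then show ?case using step linked_edge[of y _ b z] by simp
    qed (rule linked_refl)
    show ?thesis
    proof (cases "b \<in> below t e'")
      case True
      then have "linked (edges t - {e'}) b' b" using e'(4) by simp
      have "below t e \<subseteq> below t e'"
      proof
        fix v assume v: "v \<in> below t e"
        then have "linked (edges t - {e'}) b v" using * e(3) by simp
        then show "v \<in> below t e'"
          using linked_trans[OF \<open>linked (edges t - {e'}) b' b\<close>] v e'(4) by (simp add: below_def)
      qed
      then show ?thesis by simp
    next
      case False
      then have nb: "\<not> linked (edges t - {e'}) b' b" using e'(4) e(2) by simp
      have "v \<notin> below t e'" if "v \<in> below t e" for v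
      proof
        assume "v \<in> below t e'"
        then have "linked (edges t - {e'}) b' v" using e'(4) by simp
        moreover have "linked (edges t - {e'}) v b" using linked_sym[OF *] that e(3) by simp
        ultimately show False using nb linked_trans by metis
      qed
      then show ?thesis by blast
    qed
  qed
qed simp

lemma cluster_laminar: "laminar (cluster n t ` edges t)"
  unfolding laminar_def
proof (intro ballI)
  fix A B assume "A \<in> cluster n t ` edges t" "B \<in> cluster n t ` edges t"
  then obtain e e' where "A = cluster n t e" "B = cluster n t e'" "e \<in> edges t" "e' \<in> edges t" by blast
  then show "A \<subseteq> B \<or> B \<subseteq> A \<or> A \<inter> B = {}"
    using below_laminar[of e e'] unfolding cluster_def by blast
qed

lemma leaf_label:
  assumes "l \<in> leaves t"
  obtains i where "i \<in> {1..n}" "leaf t i = l"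
proof -
  have "l \<in> leaf t ` {1..n}" using assms bij_betw_imp_surj_on[OF leaf_bij] by simp
  then show ?thesis using that by blast
qed

lemma leaf_in: "i \<in> {1..n} \<Longrightarrow> leaf t i \<in> leaves t \<and> leaf t i \<in> verts t"
  using bij_betwE[OF leaf_bij] by (simp add: leaves_def)

text \<open>
  The lower end of an internal edge has two further edges, each leading to a leaf below; the
  upper end leads to a leaf that is not below.
\<close>

lemma cluster_in_clusters:
  assumes deg: "\<And>v. v \<in> verts t - leaves t - {root t} \<Longrightarrow> 3 \<le> degree t v"
    and e: "e \<in> internal_edges t"
  shows "cluster n t e \<in> clusters n"
proof -
  have eE: "e \<in> edges t" and e_int: "e \<inter> leaves t = {}" using e by (auto simp: internal_edges_def)
  obtain a b where ab: "e = {a, b}" "a \<noteq> b" "a \<in> verts t" "b \<in> verts t" "linked (edges t - {e}) (root t) a"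
    "below t e = {v \<in> verts t. linked (edges t - {e}) b v}" "b \<in> below t e"
    using below_eq[OF eE] .
  have abE: "{a, b} \<in> edges t" "{b, a} \<in> edges t" using eE ab(1) by (simp_all add: insert_commute)
  have "b \<noteq> root t" using ab(7) by (auto simp: below_def linked_refl)
  then have "3 \<le> degree t b" using deg[of b] ab(1,4) e_int by blast
  then have D3: "3 \<le> card {e \<in> edges t. b \<in> e}" by (simp add: degree_def)
  have "card ({e \<in> edges t. b \<in> e} - {e}) \<ge> 2"
    using D3 finite_edges eE ab(1) by (simp add: card_Diff_singleton)
  then obtain e1 e2 where "e1 \<noteq> e2" "e1 \<in> {e \<in> edges t. b \<in> e} - {e}" "e2 \<in> {e \<in> edges t. b \<in> e} - {e}"
    by (meson card_2_iff' obtain_subset_with_card_n subsetD)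
  then have e12: "e1 \<in> edges t" "b \<in> e1" "e1 \<noteq> e" "e2 \<in> edges t" "b \<in> e2" "e2 \<noteq> e" "e1 \<noteq> e2" by auto
  obtain c1 where c1: "e1 = {b, c1}" using edgeE[OF e12(1)] e12(2) by blast
  obtain c2 where c2: "e2 = {b, c2}" using edgeE[OF e12(4)] e12(5) by blast
  obtain l1 where l1: "l1 \<in> leaves t" "linked (edges t - {{b, c1}}) c1 l1"
    using leaf_beyond[of b c1] e12(1) c1 by blast
  obtain l2 where l2: "l2 \<in> leaves t" "linked (edges t - {{b, c2}}) c2 l2"
    using leaf_beyond[of b c2] e12(4) c2 by blast
  have "linked (edges t - {e}) b l1"
    using linked_beyond[OF abE(1), of c1 l1] e12(1,3) c1 l1(2) ab(1) by simp
  moreover have "linked (edges t - {e}) b l2"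
    using linked_beyond[OF abE(1), of c2 l2] e12(4,6) c2 l2(2) ab(1) by simp
  ultimately have l12: "l1 \<in> below t e" "l2 \<in> below t e" using l1(1) l2(1) ab(6) by (simp_all add: leaves_def)
  have "l1 \<noteq> l2"
  proof
    assume eq: "l1 = l2"
    have "linked (edges t - {{c2, b}}) b l1"
      using linked_beyond[of c2 b c1 l1] e12(1,4,7) c1 c2 l1(2) by (simp add: insert_commute)
    then have "linked (edges t - {{b, c2}}) b l2" using eq by (simp add: insert_commute)
    then have "linked (edges t - {{b, c2}}) b c2" using l2(2) linked_trans linked_sym by metis
    then show False using bridge[of b c2] e12(4) c2 by simp
  qed
  obtain i1 where i1: "i1 \<in> {1..n}" "leaf t i1 = l1" using leaf_label[OF l1(1)] .
  obtain i2 where i2: "i2 \<in> {1..n}" "leaf t i2 = l2" using leaf_label[OF l2(1)] .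
  have "{i1, i2} \<subseteq> cluster n t e" using i1 i2 l12 by (simp add: cluster_def)
  moreover have "finite (cluster n t e)" by (simp add: cluster_def)
  ultimately have "card {i1, i2} \<le> card (cluster n t e)" by (rule card_mono[rotated])
  moreover have "i1 \<noteq> i2" using i1(2) i2(2) \<open>l1 \<noteq> l2\<close> by auto
  ultimately have two: "2 \<le> card (cluster n t e)" by simp
  have "{b, a} = e" using ab(1) by blast
  then obtain l where l: "l \<in> leaves t" "linked (edges t - {e}) a l"
    using leaf_beyond[OF abE(2)] by blast
  obtain i where i: "i \<in> {1..n}" "leaf t i = l" using leaf_label[OF l(1)] .
  have "linked (edges t - {e}) (root t) l" using ab(5) l(2) linked_trans by metis
  then have "i \<notin> cluster n t e" using i by (simp add: cluster_def below_def)
  moreover have "cluster n t e \<subseteq> {1..n}" unfolding cluster_def by blast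
  ultimately have "cluster n t e \<subset> {1..n}" using i(1) by blast
  then show ?thesis using two by (simp add: clusters_def)
qed

lemma leaf_edge_unique:
  assumes "l \<in> leaves t" "{l, x} \<in> edges t" "{l, y} \<in> edges t"
  shows "x = y"
proof -
  have "card {e \<in> edges t. l \<in> e} = 1" using assms(1) by (simp add: leaves_def degree_def)
  then obtain e where e: "{e \<in> edges t. l \<in> e} = {e}" by (rule card_1_singletonE)
  have "{l, x} \<in> {e \<in> edges t. l \<in> e}" "{l, y} \<in> {e \<in> edges t. l \<in> e}" using assms(2,3) by simp_all
  then have "{l, x} = e" "{l, y} = e" unfolding e by simp_all
  then show ?thesis by (auto simp: doubleton_eq_iff)
qed

text \<open>
  Paths between vertices that are not leaves can avoid leaves, since a leaf is a dead end.
\<close>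

lemma linked_internal:
  assumes x: "x \<in> verts t" "x \<notin> leaves t" and xy: "linked (edges t) x y"
  shows "(y \<notin> leaves t \<longrightarrow> linked (internal_edges t) x y) \<and>
    (y \<in> leaves t \<longrightarrow> (\<forall>z. {y, z} \<in> edges t \<longrightarrow> z \<notin> leaves t \<and> linked (internal_edges t) x z))"
  using xy
proof (induction rule: linked_induct)
  case base
  then show ?case using x linked_refl by simp
next
  case (step y z)
  show ?case
  proof (cases "y \<in> leaves t")
    case True
    then show ?thesis using step by blast
  next
    case False
    then have y: "linked (internal_edges t) x y" using step.IH by simp
    have zy: "{z, y} \<in> edges t" using step.hyps(2) by (simp add: insert_commute)
    have "linked (internal_edges t) x z" if "z \<notin> leaves t"
    proof -
      have "{y, z} \<in> internal_edges t" using that False step.hyps(2) by (simp add: internal_edges_def)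
      then show ?thesis using linked_edge[OF y] by blast
    qed
    moreover have "w = y" if "z \<in> leaves t" "{z, w} \<in> edges t" for w
      using leaf_edge_unique[OF that(1) zy that(2)] by simp
    ultimately show ?thesis using False y by blast
  qed
qed

lemma pendant_edge:
  assumes "l \<in> leaves t"
  obtains w where "{l, w} \<in> edges t" "w \<in> verts t" "w \<notin> leaves t"
proof -
  have "card {e \<in> edges t. l \<in> e} = 1" using assms by (simp add: leaves_def degree_def)
  then obtain e where "{e \<in> edges t. l \<in> e} = {e}" by (rule card_1_singletonE)
  then have "e \<in> {e \<in> edges t. l \<in> e}" by simp
  then have e: "e \<in> edges t" "l \<in> e" by simp_all
  obtain a b where "a \<noteq> b" "e = {a, b}" "a \<in> verts t" "b \<in> verts t" using edgeE[OF e(1)] by blast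
  then obtain w where w: "e = {l, w}" "w \<in> verts t" using e(2) by blast
  have "l \<in> verts t" using assms by (simp add: leaves_def)
  then have "w \<notin> leaves t"
    using linked_internal[OF root_in root_not_leaf linked_verts[OF root_in]] assms e(1) w(1) by blast
  then show ?thesis using that e(1) w by blast
qed

end

lemma linked_path:
  assumes "linked E a b"
  obtains p where "is_path E p" "hd p = a" "last p = b"
proof -
  have "\<exists>p. is_path E p \<and> hd p = a \<and> last p = b"
    using assms
  proof (induction rule: linked_induct)
    case base
    show ?case by (intro exI[of _ "[a]"]) (simp add: is_path_def)
  next
    case (step y z)
    then obtain p where p: "is_path E p" "hd p = a" "last p = y" by blast
    show ?case
    proof (cases "z \<in> set p")
      case True
      then obtain us vs where "p = us @ z # vs" by (meson split_list)
      then have split: "p = (us @ [z]) @ vs" by simp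
      have "is_path E (us @ [z])"
        using p(1) unfolding split is_path_def successively_append_iff[of _ "us @ [z]" vs] by simp
      moreover have "hd (us @ [z]) = a" using p(2) unfolding split by (cases us) simp_all
      ultimately have "is_path E (us @ [z]) \<and> hd (us @ [z]) = a \<and> last (us @ [z]) = z" by simp
      then show ?thesis by blast
    next
      case False
      have "p \<noteq> []" using p(1) by (simp add: is_path_def)
      then have "is_path E (p @ [z]) \<and> hd (p @ [z]) = a \<and> last (p @ [z]) = z"
        using p False step.hyps(2) by (simp add: is_path_def successively_append_iff)
      then show ?thesis by blast
    qed
  qed
  then show ?thesis using that by blast
qed

lemma is_path_mono: "is_path E p \<Longrightarrow> E \<subseteq> E' \<Longrightarrow> is_path E' p"
  unfolding is_path_def by (auto elim: successively_mono)

text \<open>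
  A path around the edge would close up to a cycle.
\<close>

lemma tree_bridge:
  assumes "is_tree t" and e: "{a, b} \<in> edges t"
  shows "\<not> linked (edges t - {{a, b}}) a b"
proof
  assume "linked (edges t - {{a, b}}) a b"
  then obtain p where p: "is_path (edges t - {{a, b}}) p" "hd p = a" "last p = b" by (rule linked_path)
  have "card {a, b} = 2" using assms by (auto simp: is_tree_def)
  then have "a \<noteq> b" by auto
  have "length p \<ge> 3"
  proof (rule ccontr)
    assume short: "\<not> 3 \<le> length p"
    have "p \<noteq> []" using p(1) by (simp add: is_path_def)
    then obtain x q where q: "p = x # q" by (cases p) auto
    have "q \<noteq> []" using p(2,3) q \<open>a \<noteq> b\<close> by auto
    then obtain y r where r: "q = y # r" by (cases q) auto
    then have "r = []" using short q by (cases r) simp_all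
    then have "p = [a, b]" using p(2,3) q r by simp
    then show False using p(1) by (simp add: is_path_def)
  qed
  moreover have "is_path (edges t) p" using is_path_mono[OF p(1)] by blast
  ultimately have "is_cycle (edges t) p"
    using e p(2,3) by (simp add: is_cycle_def insert_commute)
  then show False using assms(1) by (auto simp: is_tree_def)
qed

lemma labelled_tree_bridge_tree:
  assumes "labelled_tree n t"
  shows "bridge_tree n t"
proof -
  have t: "is_tree t" "root t \<in> verts t" "degree t (root t) > 1" "bij_betw (leaf t) {1..n} (leaves t)"
    using assms by (simp_all add: labelled_tree_def rooted_tree_def)
  show ?thesis
  proof
    show "finite (verts t)" using t(1) by (simp add: is_tree_def)
    show "\<exists>a b. a \<noteq> b \<and> e = {a, b} \<and> a \<in> verts t \<and> b \<in> verts t" if "e \<in> edges t" for e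
    proof -
      have "card e = 2" "e \<subseteq> verts t" using t(1) that by (simp_all add: is_tree_def)
      then show ?thesis by (auto simp: card_2_iff)
    qed
    show "linked (edges t) u v" if "u \<in> verts t" "v \<in> verts t" for u v
      using t(1) that by (simp add: is_tree_def)
    show "\<not> linked (edges t - {{a, b}}) a b" if "{a, b} \<in> edges t" for a b
      using tree_bridge[OF t(1) that] .
    show "root t \<notin> leaves t" using t(3) by (simp add: leaves_def)
  qed (use t in simp_all)
qed

section \<open>Contraction\<close>

locale contracted_tree = bridge_tree n t for n and t :: "'v ltree" +
  fixes F :: "'v set set"
  assumes F: "F \<subseteq> internal_edges t"
begin

abbreviation "cmp \<equiv> component_of F"
abbreviation "img E' \<equiv> (\<lambda>e. cmp ` e) ` E'"

lemma F_edges: "F \<subseteq> edges t"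
  using F by (auto simp: internal_edges_def)

lemma comp_eq_iff: "cmp x = cmp y \<longleftrightarrow> linked F x y"
  by (rule component_of_eq_iff)

lemma contract_simps [simp]:
  "verts (contract t F) = cmp ` verts t" "edges (contract t F) = img (edges t - F)"
  "root (contract t F) = cmp (root t)" "leaf (contract t F) = (\<lambda>i. cmp (leaf t i))"
  by (simp_all add: contract_def)

text \<open>
  Everything about the contracted tree reduces to this: reachability does not change, provided
  that the contracted edges are still available.
\<close>

lemma linked_contract:
  assumes E': "F \<subseteq> E'" "E' \<subseteq> edges t"
  shows "linked (img (E' - F)) (cmp x) (cmp y) \<longleftrightarrow> linked E' x y"
proof
  assume "linked E' x y"
  then show "linked (img (E' - F)) (cmp x) (cmp y)"
  proof (induction rule: linked_induct)
    case (step y z)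
    show ?case
    proof (cases "{y, z} \<in> F")
      case True
      then have "cmp y = cmp z" using comp_eq_iff linked_edge[OF linked_refl] by metis
      then show ?thesis using step.IH by simp
    next
      case False
      then have "{cmp y, cmp z} \<in> img (E' - F)"
        using step.hyps(2) by (intro image_eqI[of _ _ "{y, z}"]) simp_all
      then show ?thesis using step.IH linked_edge by metis
    qed
  qed (rule linked_refl)
next
  assume "linked (img (E' - F)) (cmp x) (cmp y)"
  then have "\<forall>w. cmp y = cmp w \<longrightarrow> linked E' x w"
  proof (induction rule: linked_induct)
    case base
    show ?case using comp_eq_iff linked_mono[OF E'(1)] by metis
  next
    case (step Y Z)
    then obtain e where e: "e \<in> E'" "{Y, Z} = cmp ` e" by blast
    then obtain u v where uv: "e = {u, v}" using edgeE[of e] E'(2) by blast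
    then have "{Y, Z} = {cmp u, cmp v}" using e(2) by simp
    then consider "Y = cmp u" "Z = cmp v" | "Y = cmp v" "Z = cmp u" by (auto simp: doubleton_eq_iff)
    then obtain u' v' where uv': "Y = cmp u'" "Z = cmp v'" "{u', v'} \<in> E'"
      using e(1) uv by (metis insert_commute)
    have "linked E' x v'" using step.IH uv'(1,3) linked_edge by metis
    then show ?case using uv'(2) comp_eq_iff linked_mono[OF E'(1)] linked_trans by metis
  qed
  then show "linked E' x y" by simp
qed

lemma comp_edge_ne:
  assumes "{a, b} \<in> edges t - F"
  shows "cmp a \<noteq> cmp b"
proof
  assume "cmp a = cmp b"
  then have "linked F a b" by (simp add: comp_eq_iff)
  moreover have "F \<subseteq> edges t - {{a, b}}" using assms F_edges by blast
  ultimately have "linked (edges t - {{a, b}}) a b" using linked_mono by metis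
  then show False using bridge assms by blast
qed

lemma comp_edge_inj:
  assumes "{a, b} \<in> edges t - F" "{c, d} \<in> edges t - F" "cmp a = cmp c" "cmp b = cmp d"
  shows "{a, b} = {c, d}"
proof (rule ccontr)
  assume ne: "{a, b} \<noteq> {c, d}"
  let ?E = "edges t - {{a, b}}"
  have FE: "F \<subseteq> ?E" using assms(1) F_edges by blast
  have "linked ?E a c" using linked_mono[OF FE] assms(3) comp_eq_iff by metis
  then have "linked ?E a d" using linked_edge[of c ?E a d] assms(2) ne by simp
  moreover have "linked ?E d b" using linked_mono[OF FE] assms(4) comp_eq_iff by metis
  ultimately have "linked ?E a b" using linked_trans by metis
  then show False using bridge assms(1) by blast
qed

text \<open>
  Two edges between the same two components would form a cycle.
\<close>

lemma inj_on_img: "inj_on (\<lambda>e. cmp ` e) (edges t - F)"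
proof (rule inj_onI)
  fix e e' assume e: "e \<in> edges t - F" "e' \<in> edges t - F" and eq: "cmp ` e = cmp ` e'"
  obtain a b where ab: "e = {a, b}" using edgeE[of e] e(1) by blast
  obtain c d where cd: "e' = {c, d}" using edgeE[of e'] e(2) by blast
  have "{cmp a, cmp b} = {cmp c, cmp d}" using eq ab cd by simp
  then consider "cmp a = cmp c" "cmp b = cmp d" | "cmp a = cmp d" "cmp b = cmp c"
    by (auto simp: doubleton_eq_iff)
  then show "e = e'"
  proof cases
    case 1
    then show ?thesis using comp_edge_inj[of a b c d] e ab cd by simp
  next
    case 2
    then show ?thesis using comp_edge_inj[of a b d c] e ab cd by (simp add: insert_commute)
  qed
qed

lemma img_diff: "e \<in> edges t - F \<Longrightarrow> img (edges t - F) - {cmp ` e} = img ((edges t - {e}) - F)"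
proof -
  assume "e \<in> edges t - F"
  then have "img (edges t - F) - {cmp ` e} = img (edges t - F - {e})"
    using inj_on_image_set_diff[OF inj_on_img, of "edges t - F" "{e}"] by simp
  moreover have "edges t - F - {e} = edges t - {e} - F" by blast
  ultimately show ?thesis by simp
qed

lemma comp_leaf:
  assumes "l \<in> leaves t"
  shows "cmp l = {l}"
proof -
  have "v = l" if "linked F l v" for v
    using that
  proof (induction rule: linked_induct)
    case (step y z)
    then have "{l, z} \<in> internal_edges t" using F by blast
    then show ?case using assms by (simp add: internal_edges_def)
  qed simp
  then show ?thesis using linked_refl by fast
qed

lemma degree_comp_leaf:
  assumes l: "l \<in> leaves t"
  shows "degree (contract t F) (cmp l) = 1"
proof -
  obtain w where w: "{l, w} \<in> edges t" using pendant_edge[OF l] by blast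
  have notF: "{l, x} \<notin> F" for x using F l by (auto simp: internal_edges_def)
  have only: "E = {cmp l, cmp w}" if "E \<in> img (edges t - F)" "cmp l \<in> E" for E
  proof -
    obtain e where e: "e \<in> edges t - F" "E = cmp ` e" using \<open>E \<in> _\<close> by blast
    then obtain x where x: "x \<in> e" "cmp x = cmp l" using \<open>cmp l \<in> E\<close> by auto
    then have "l \<in> e" using comp_leaf[OF l] linked_refl[of x F] by simp
    then obtain y where y: "e = {l, y}" using edgeE[of e] e(1) by blast
    then have "y = w" using leaf_edge_unique[OF l, of y w] e(1) w by simp
    then show ?thesis using e(2) y by simp
  qed
  have mem: "{cmp l, cmp w} \<in> img (edges t - F)"
    using w notF by (intro image_eqI[of _ _ "{l, w}"]) simp_all
  have "{E \<in> img (edges t - F). cmp l \<in> E} = {{cmp l, cmp w}}"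
  proof (intro equalityI subsetI)
    show "E \<in> {{cmp l, cmp w}}" if "E \<in> {E \<in> img (edges t - F). cmp l \<in> E}" for E
      using only[of E] that by simp
    show "E \<in> {E \<in> img (edges t - F). cmp l \<in> E}" if "E \<in> {{cmp l, cmp w}}" for E
      using mem that by simp
  qed
  then show ?thesis by (simp add: degree_def)
qed

text \<open>
  Contraction creates no new leaves. If only one edge \<open>{a, b}\<close> left the component of \<open>v\<close>, the
  component would contain everything beyond this edge, in particular a leaf.
\<close>

lemma degree_comp_nonleaf:
  assumes v: "v \<in> verts t" "v \<notin> leaves t"
  shows "degree (contract t F) (cmp v) \<noteq> 1"
proof
  assume "degree (contract t F) (cmp v) = 1"
  then have "card {E \<in> img (edges t - F). cmp v \<in> E} = 1" by (simp add: degree_def)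
  then obtain E where E: "{E \<in> img (edges t - F). cmp v \<in> E} = {E}" by (rule card_1_singletonE)
  then have "E \<in> {E \<in> img (edges t - F). cmp v \<in> E}" by simp
  then obtain e where e: "e \<in> edges t - F" "E = cmp ` e" "cmp v \<in> E" by blast
  then obtain b where b: "b \<in> e" "cmp b = cmp v" by auto
  then obtain a where a: "e = {a, b}" using edgeE[of e] e(1) by blast
  have "cmp w = cmp v" if "linked (edges t - {{a, b}}) b w" for w
    using that
  proof (induction rule: linked_induct)
    case base show ?case by (rule b(2))
  next
    case (step y z)
    have "{y, z} \<in> F"
    proof (rule ccontr)
      assume nF: "{y, z} \<notin> F"
      have "cmp ` {y, z} \<in> {E \<in> img (edges t - F). cmp v \<in> E}"
      proof -
        have "{y, z} \<in> edges t - F" using nF step.hyps(2) by simp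
        then have "cmp ` {y, z} \<in> img (edges t - F)" by (rule imageI)
        moreover have "cmp v \<in> cmp ` {y, z}" using step.IH by simp
        ultimately show ?thesis by simp
      qed
      then have "cmp ` {y, z} = cmp ` e" unfolding E e(2) by simp
      then have "{y, z} = e" using inj_onD[OF inj_on_img, of "{y, z}" e] step.hyps(2) nF e(1) by simp
      then show False using step.hyps(2) a by simp
    qed
    then have "cmp y = cmp z" using comp_eq_iff linked_edge[OF linked_refl] by metis
    then show ?case using step.IH by simp
  qed
  moreover obtain l where l: "l \<in> leaves t" "linked (edges t - {{a, b}}) b l"
    using leaf_beyond[of a b] e(1) a by blast
  ultimately have "cmp l = cmp v" by blast
  then have "v \<in> {l}" using comp_leaf[OF l(1)] linked_refl[of v F] by simp
  then show False using v(2) l(1) by simp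
qed

lemma comp_in_leaves:
  assumes "v \<in> verts t"
  shows "cmp v \<in> leaves (contract t F) \<longleftrightarrow> v \<in> leaves t"
proof
  assume "cmp v \<in> leaves (contract t F)"
  then have "degree (contract t F) (cmp v) = 1" by (simp add: leaves_def)
  then show "v \<in> leaves t" using degree_comp_nonleaf[OF assms] by blast
next
  assume "v \<in> leaves t"
  then show "cmp v \<in> leaves (contract t F)" using degree_comp_leaf assms by (simp add: leaves_def)
qed

lemma leaves_contract: "leaves (contract t F) = cmp ` leaves t"
proof
  show "leaves (contract t F) \<subseteq> cmp ` leaves t"
  proof
    fix X assume X: "X \<in> leaves (contract t F)"
    then obtain v where "v \<in> verts t" "X = cmp v" by (auto simp: leaves_def)
    then show "X \<in> cmp ` leaves t" using X comp_in_leaves by blast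
  qed
  show "cmp ` leaves t \<subseteq> leaves (contract t F)"
    using comp_in_leaves by (auto simp: leaves_def)
qed

lemma bridge_tree_contract: "bridge_tree n (contract t F)"
proof
  show "finite (verts (contract t F))" using finite_verts by simp
  show "\<exists>A B. A \<noteq> B \<and> E = {A, B} \<and> A \<in> verts (contract t F) \<and> B \<in> verts (contract t F)"
    if E: "E \<in> edges (contract t F)" for E
  proof -
    obtain e where e: "e \<in> edges t - F" "E = cmp ` e" using E by auto
    obtain a b where ab: "e = {a, b}" "a \<in> verts t" "b \<in> verts t" using edgeE[of e] e(1) by blast
    show ?thesis
      using comp_edge_ne[of a b] e ab by (intro exI[of _ "cmp a"] exI[of _ "cmp b"]) simp
  qed
  show "linked (edges (contract t F)) U V" if U: "U \<in> verts (contract t F)" and V: "V \<in> verts (contract t F)" for U V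
  proof -
    obtain u v where "u \<in> verts t" "v \<in> verts t" "U = cmp u" "V = cmp v" using U V by auto
    then show ?thesis using linked_contract[OF F_edges order.refl] linked_verts by simp
  qed
  show "\<not> linked (edges (contract t F) - {{A, B}}) A B" if AB: "{A, B} \<in> edges (contract t F)" for A B
  proof -
    obtain e where e: "e \<in> edges t - F" "{A, B} = cmp ` e" using AB by auto
    obtain a b where ab: "e = {a, b}" using edgeE[of e] e(1) by blast
    have "{A, B} = {cmp a, cmp b}" using e(2) ab by simp
    then have "(A = cmp a \<and> B = cmp b) \<or> (A = cmp b \<and> B = cmp a)" by (auto simp: doubleton_eq_iff)
    then obtain c d where cd: "A = cmp c" "B = cmp d" "e = {c, d}" using ab by (metis insert_commute)
    have "edges (contract t F) - {{A, B}} = img ((edges t - {e}) - F)"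
      using img_diff[OF e(1)] e(2) by simp
    moreover have "F \<subseteq> edges t - {e}" using F_edges e(1) by blast
    ultimately show ?thesis
      using linked_contract[of "edges t - {e}" d c] bridge[of c d] cd e(1) by simp
  qed
  show "root (contract t F) \<in> verts (contract t F)" using root_in by simp
  show "root (contract t F) \<notin> leaves (contract t F)"
    using comp_in_leaves[OF root_in] root_not_leaf by simp
  have "inj_on cmp (leaves t)" using comp_leaf by (intro inj_onI) auto
  then have "bij_betw cmp (leaves t) (cmp ` leaves t)" by (rule inj_on_imp_bij_betw)
  from bij_betw_trans[OF leaf_bij this]
  show "bij_betw (leaf (contract t F)) {1..n} (leaves (contract t F))"
    by (simp add: leaves_contract o_def)
qed

lemma internal_edges_contract: "internal_edges (contract t F) = img (internal_edges t - F)"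
proof -
  have "cmp ` e \<inter> leaves (contract t F) = {} \<longleftrightarrow> e \<inter> leaves t = {}" if "e \<in> edges t" for e
  proof -
    obtain a b where "e = {a, b}" "a \<in> verts t" "b \<in> verts t" using edgeE[OF \<open>e \<in> _\<close>] by blast
    then show ?thesis using comp_in_leaves[of a] comp_in_leaves[of b] by simp
  qed
  then show ?thesis unfolding internal_edges_def contract_simps by blast
qed

lemma cluster_contract:
  assumes e: "e \<in> edges t - F"
  shows "cluster n (contract t F) (cmp ` e) = cluster n t e"
proof -
  have "F \<subseteq> edges t - {e}" using F_edges e by blast
  then have "linked (edges (contract t F) - {cmp ` e}) (cmp (root t)) (cmp v) \<longleftrightarrow>
      linked (edges t - {e}) (root t) v" for v
    using linked_contract[of "edges t - {e}"] img_diff[OF e] by simp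
  then show ?thesis
    using leaf_in unfolding cluster_def below_def by auto
qed

end

section \<open>Vertices of the complex of trees\<close>

text \<open>
  The standard tree whose only internal edge cuts off \<open>S\<close>: the leaves are their own labels, the root is \<open>0\<close>, and
  the internal vertex \<open>n + 1\<close> carries the leaves in \<open>S\<close>.
\<close>

definition star_tree :: "nat \<Rightarrow> nat set \<Rightarrow> nat ltree" where
  "star_tree n S = \<lparr>verts = {0..n + 1},
     edges = insert {0, n + 1} ((\<lambda>i. {if i \<in> S then n + 1 else 0, i}) ` {1..n}),
     root = 0, leaf = id\<rparr>"

definition tree_vertex :: "nat \<Rightarrow> nat set \<Rightarrow> nat ltree set" where
  "tree_vertex n S = combinatorial_type n (star_tree n S)"

lemma star_tree_simps [simp]:
  "verts (star_tree n S) = {0..n + 1}" "root (star_tree n S) = 0" "leaf (star_tree n S) = id"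
  by (simp_all add: star_tree_def)

lemma star_tree_edge:
  assumes "i \<in> {1..n}"
  shows "{n + 1, i} \<in> edges (star_tree n S) \<longleftrightarrow> i \<in> S" "{0, i} \<in> edges (star_tree n S) \<longleftrightarrow> i \<notin> S"
proof -
  have e: "{x, i} \<in> edges (star_tree n S) \<longleftrightarrow> x = (if i \<in> S then n + 1 else 0)" if x: "x \<in> {0, n + 1}" for x
  proof
    assume "{x, i} \<in> edges (star_tree n S)"
    then have "{x, i} = {0, n + 1} \<or> (\<exists>j\<in>{1..n}. {x, i} = {if j \<in> S then n + 1 else 0, j})"
      by (simp add: star_tree_def image_iff)
    moreover have "{x, i} \<noteq> {0, n + 1}" using assms by (auto simp: doubleton_eq_iff)
    ultimately obtain j where j: "j \<in> {1..n}" "{x, i} = {if j \<in> S then n + 1 else 0, j}" by blast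
    then have "i = j \<and> x = (if j \<in> S then n + 1 else 0)"
      using assms x by (auto simp: doubleton_eq_iff split: if_splits)
    then show "x = (if i \<in> S then n + 1 else 0)" by simp
  next
    assume "x = (if i \<in> S then n + 1 else 0)"
    then show "{x, i} \<in> edges (star_tree n S)"
      using assms by (simp add: star_tree_def)
  qed
  show "{n + 1, i} \<in> edges (star_tree n S) \<longleftrightarrow> i \<in> S" using e[of "n + 1"] by simp
  show "{0, i} \<in> edges (star_tree n S) \<longleftrightarrow> i \<notin> S" using e[of 0] by simp
qed

lemma isomorphic_trees_refl: "isomorphic_trees n t t"
  unfolding isomorphic_trees_def by (intro exI[of _ id]) simp

lemma isomorphic_trees_trans:
  assumes "isomorphic_trees n t t'" "isomorphic_trees n t' t''"
  shows "isomorphic_trees n t t''"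
proof -
  obtain f where f: "bij_betw f (verts t) (verts t')" "edges t' = (\<lambda>e. f ` e) ` edges t"
    "root t' = f (root t)" "\<forall>i\<in>{1..n}. leaf t' i = f (leaf t i)"
    using assms(1) by (auto simp: isomorphic_trees_def)
  obtain g where g: "bij_betw g (verts t') (verts t'')" "edges t'' = (\<lambda>e. g ` e) ` edges t'"
    "root t'' = g (root t')" "\<forall>i\<in>{1..n}. leaf t'' i = g (leaf t' i)"
    using assms(2) by (auto simp: isomorphic_trees_def)
  show ?thesis
    unfolding isomorphic_trees_def
  proof (intro exI[of _ "g \<circ> f"] conjI)
    show "bij_betw (g \<circ> f) (verts t) (verts t'')" using bij_betw_trans[OF f(1) g(1)] .
    show "edges t'' = (\<lambda>e. (g \<circ> f) ` e) ` edges t" unfolding g(2) f(2) by (simp add: image_image image_comp)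
  qed (use f g in simp_all)
qed

lemma isomorphic_trees_sym:
  assumes iso: "isomorphic_trees n t t'"
    and wf: "\<And>e. e \<in> edges t \<Longrightarrow> e \<subseteq> verts t" "root t \<in> verts t" "\<And>i. i \<in> {1..n} \<Longrightarrow> leaf t i \<in> verts t"
  shows "isomorphic_trees n t' t"
proof -
  obtain f where f: "bij_betw f (verts t) (verts t')" "edges t' = (\<lambda>e. f ` e) ` edges t"
    "root t' = f (root t)" "\<forall>i\<in>{1..n}. leaf t' i = f (leaf t i)"
    using iso by (auto simp: isomorphic_trees_def)
  let ?g = "inv_into (verts t) f"
  have g: "?g (f x) = x" if "x \<in> verts t" for x
    using bij_betw_imp_inj_on[OF f(1)] that by simp
  have "?g ` f ` e = e" if "e \<in> edges t" for e
    using inv_into_image_cancel[OF bij_betw_imp_inj_on[OF f(1)] wf(1)[OF that]] .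
  then have "(\<lambda>e. ?g ` e) ` edges t' = edges t" unfolding f(2) by (simp add: image_image)
  then show ?thesis
    unfolding isomorphic_trees_def
    using bij_betw_inv_into[OF f(1)] g wf(2,3) f(3,4) by (intro exI[of _ ?g]) simp
qed

lemma combinatorial_type_eq:
  assumes iso: "isomorphic_trees n t t'"
    and wf: "\<And>e. e \<in> edges t \<Longrightarrow> e \<subseteq> verts t" "root t \<in> verts t" "\<And>i. i \<in> {1..n} \<Longrightarrow> leaf t i \<in> verts t"
  shows "combinatorial_type n t = combinatorial_type n t'"
  unfolding combinatorial_type_def
  using isomorphic_trees_trans[OF iso] isomorphic_trees_trans[OF isomorphic_trees_sym[OF assms]] by blast

lemma star_tree_wf:
  assumes "e \<in> edges (star_tree n S)"
  shows "e \<subseteq> {0..n + 1}"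
  using assms by (auto simp: star_tree_def split: if_splits)

lemma tree_vertex_eq:
  assumes "isomorphic_trees n (star_tree n S) t"
  shows "tree_vertex n S = combinatorial_type n t"
  unfolding tree_vertex_def using star_tree_wf by (intro combinatorial_type_eq[OF assms]) auto

text \<open>
  An isomorphism preserves the root and all leaves, so it fixes the remaining vertex \<open>n + 1\<close> and with it
  the set of leaves attached to this vertex.
\<close>

lemma tree_vertex_inj:
  assumes "S \<subseteq> {1..n}" "S' \<subseteq> {1..n}" "tree_vertex n S = tree_vertex n S'"
  shows "S = S'"
proof -
  have "star_tree n S' \<in> tree_vertex n S'"
    using isomorphic_trees_refl by (simp add: tree_vertex_def combinatorial_type_def)
  then have "star_tree n S' \<in> tree_vertex n S" by (simp only: assms(3))
  then have "isomorphic_trees n (star_tree n S) (star_tree n S')"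
    by (simp add: tree_vertex_def combinatorial_type_def)
  then obtain f where f: "bij_betw f {0..n + 1} {0..n + 1}" "edges (star_tree n S') = (\<lambda>e. f ` e) ` edges (star_tree n S)"
    "f 0 = 0" "\<forall>i\<in>{1..n}. f i = i"
    by (auto simp: isomorphic_trees_def)
  have fl: "f i = i" if "i \<le> n" for i using f(3,4) that by (cases "i = 0") auto
  have "f (n + 1) \<in> {0..n + 1}" using bij_betwE[OF f(1)] by simp
  moreover have "\<not> f (n + 1) \<le> n"
  proof
    assume le: "f (n + 1) \<le> n"
    then have "f (f (n + 1)) = f (n + 1)" using fl by blast
    then have "f (n + 1) = n + 1"
      using inj_onD[OF bij_betw_imp_inj_on[OF f(1)], of "f (n + 1)" "n + 1"] le by simp
    then show False using le by simp
  qed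
  ultimately have fn: "f (n + 1) = n + 1" by auto
  have "i \<in> S \<longleftrightarrow> i \<in> S'" if i: "i \<in> {1..n}" for i
  proof
    assume "i \<in> S"
    then have "f ` {n + 1, i} \<in> edges (star_tree n S')"
      unfolding f(2) using star_tree_edge(1)[OF i, of S] by blast
    moreover have "f ` {n + 1, i} = {n + 1, i}" using fn fl i by simp
    ultimately show "i \<in> S'" using star_tree_edge(1)[OF i] by simp
  next
    assume "i \<in> S'"
    show "i \<in> S"
    proof (rule ccontr)
      assume "i \<notin> S"
      then have "f ` {0, i} \<in> edges (star_tree n S')"
        unfolding f(2) using star_tree_edge(2)[OF i, of S] by blast
      moreover have "f ` {0, i} = {0, i}" using fl i by simp
      ultimately show False using star_tree_edge(2)[OF i] \<open>i \<in> S'\<close> by simp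
    qed
  qed
  then show ?thesis using assms(1,2) by blast
qed

text \<open>
  With one internal edge only the root and the other end of this edge are not leaves, and the cluster
  tells to which of the two a leaf is attached.
\<close>

lemma (in bridge_tree) one_internal_edge:
  assumes single: "internal_edges t = {e}"
  shows "isomorphic_trees n (star_tree n (cluster n t e)) t"
proof -
  have eE: "e \<in> edges t" and e_int: "e \<inter> leaves t = {}"
    using single unfolding internal_edges_def by blast+
  obtain a b where ab: "e = {a, b}" "a \<noteq> b" "a \<in> verts t" "b \<in> verts t" "linked (edges t - {e}) (root t) a"
    "below t e = {v \<in> verts t. linked (edges t - {e}) b v}" "b \<in> below t e" "a \<notin> below t e"
    using below_eq[OF eE] .
  let ?r = "root t"
  have r_above: "?r \<notin> below t e" by (simp add: below_def linked_refl)
  have via_e: "y = x \<or> (x \<in> e \<and> y \<in> e)" if "linked {e} x y" for x y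
    using that by (induction rule: linked_induct) auto
  have nonleaf: "v = ?r \<or> ?r \<in> e \<and> v \<in> e" if "v \<in> verts t" "v \<notin> leaves t" for v
    using linked_internal[OF root_in root_not_leaf linked_verts[OF root_in that(1)]] that(2) via_e single by metis
  have "b \<notin> leaves t" "b \<noteq> ?r" using e_int ab(1,7) r_above by auto
  then have "?r \<in> e" using nonleaf[OF ab(4)] by blast
  then have r: "?r = a" using ab(1) \<open>b \<noteq> ?r\<close> by simp
  have nonleaves: "verts t = leaves t \<union> {?r, b}"
  proof
    show "verts t \<subseteq> leaves t \<union> {?r, b}" using nonleaf ab(1) r by blast
    show "leaves t \<union> {?r, b} \<subseteq> verts t" using root_in ab(4) by (auto simp: leaves_def)
  qed
  let ?S = "cluster n t e"
  have pend: "{l, if l \<in> below t e then b else ?r} \<in> edges t" if l: "l \<in> leaves t" for l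
  proof -
    obtain w where w: "{l, w} \<in> edges t" "w \<in> verts t" "w \<notin> leaves t" using pendant_edge[OF l] .
    have "{l, w} \<noteq> e" using l e_int by auto
    then have "{w, l} \<in> edges t - {e}" "{l, w} \<in> edges t - {e}" using w(1) by (simp_all add: insert_commute)
    then have same: "linked (edges t - {e}) x w \<longleftrightarrow> linked (edges t - {e}) x l" for x
      using linked_edge by metis
    have "l \<in> verts t" using l by (simp add: leaves_def)
    then have "l \<in> below t e \<longleftrightarrow> w \<in> below t e" using same[of ?r] w(2) by (simp add: below_def)
    moreover have "w = ?r \<or> w = b" using nonleaves w(2,3) by blast
    ultimately show ?thesis using w(1) r_above ab(7) by auto
  qed
  let ?f = "\<lambda>v. if v = 0 then ?r else if v = n + 1 then b else leaf t v"
  have edges: "edges t = insert {?r, b} ((\<lambda>i. {if i \<in> ?S then b else ?r, leaf t i}) ` {1..n})"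
  proof (intro equalityI subsetI)
    fix d assume d: "d \<in> edges t"
    show "d \<in> insert {?r, b} ((\<lambda>i. {if i \<in> ?S then b else ?r, leaf t i}) ` {1..n})"
    proof (cases "d \<in> internal_edges t")
      case True
      then show ?thesis using single ab(1) r by simp
    next
      case False
      then obtain l where l: "l \<in> d" "l \<in> leaves t" using d by (auto simp: internal_edges_def)
      obtain x where x: "d = {l, x}" using edgeE[OF d] l(1) by blast
      obtain i where i: "i \<in> {1..n}" "leaf t i = l" using leaf_label[OF l(2)] .
      have "x = (if l \<in> below t e then b else ?r)"
        using leaf_edge_unique[OF l(2) _ pend[OF l(2)], of x] d x by simp
      then have "d = {if i \<in> ?S then b else ?r, leaf t i}"
        using x i by (simp add: cluster_def insert_commute)
      then show ?thesis using i(1) by blast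
    qed
  next
    fix d assume "d \<in> insert {?r, b} ((\<lambda>i. {if i \<in> ?S then b else ?r, leaf t i}) ` {1..n})"
    then consider "d = {?r, b}" | i where "i \<in> {1..n}" "d = {if i \<in> ?S then b else ?r, leaf t i}" by blast
    then show "d \<in> edges t"
    proof cases
      case 1
      then show ?thesis using eE ab(1) r by simp
    next
      case 2
      then have "d = {leaf t i, if leaf t i \<in> below t e then b else ?r}"
        by (simp add: cluster_def insert_commute)
      then show ?thesis using pend leaf_in[OF 2(1)] by simp
    qed
  qed
  show ?thesis
    unfolding isomorphic_trees_def
  proof (intro exI[of _ ?f] conjI)
    have vs: "{0..n + 1} = insert 0 (insert (n + 1) {1..n})" by auto
    have bl: "bij_betw ?f {1..n} (leaves t)"
      using leaf_bij by (rule bij_betw_cong[THEN iffD1, rotated]) simp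
    have "bij_betw ?f (insert (n + 1) {1..n}) (insert b (leaves t))"
      using notIn_Un_bij_betw[OF _ _ bl, of "n + 1"] \<open>b \<notin> leaves t\<close> by simp
    then have "bij_betw ?f (insert 0 (insert (n + 1) {1..n})) (insert ?r (insert b (leaves t)))"
      using notIn_Un_bij_betw[of 0 "insert (n + 1) {1..n}" ?f "insert b (leaves t)"] root_not_leaf \<open>b \<noteq> ?r\<close> by simp
    moreover have "insert ?r (insert b (leaves t)) = verts t" using nonleaves by blast
    ultimately show "bij_betw ?f (verts (star_tree n ?S)) (verts t)" by (simp only: star_tree_simps vs)
    show "edges t = (\<lambda>e. ?f ` e) ` edges (star_tree n ?S)"
    proof -
      have "(\<lambda>i. ?f ` {if i \<in> ?S then n + 1 else 0, i}) ` {1..n} =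
          (\<lambda>i. {if i \<in> ?S then b else ?r, leaf t i}) ` {1..n}"
        by (rule image_cong) auto
      moreover have "?f ` {0, n + 1} = {?r, b}" by auto
      moreover have "(\<lambda>e. ?f ` e) ` edges (star_tree n ?S) =
          insert (?f ` {0, n + 1}) ((\<lambda>i. ?f ` {if i \<in> ?S then n + 1 else 0, i}) ` {1..n})"
        unfolding star_tree_def ltree.simps image_insert image_image ..
      ultimately show ?thesis unfolding edges by (simp only:)
    qed
  qed simp_all
qed

text \<open>
  Contracting all internal edges but one leaves a tree with one internal edge, whose cluster is that of
  the original edge. So the vertices of the simplex are the types given by the clusters.
\<close>

lemma (in contracted_tree) tree_simplex_contract:
  "tree_simplex n (contract t F) = tree_vertex n ` cluster n t ` (internal_edges t - F)"
proof -
  let ?G = "contract t F"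
  interpret G: bridge_tree n ?G by (rule bridge_tree_contract)
  have type: "combinatorial_type n (contract ?G (internal_edges ?G - {E})) = tree_vertex n (cluster n ?G E)"
    if E: "E \<in> internal_edges ?G" for E
  proof -
    interpret H: contracted_tree n ?G "internal_edges ?G - {E}" by unfold_locales blast
    have eE: "E \<in> edges ?G - (internal_edges ?G - {E})" using E by (simp add: internal_edges_def)
    have "internal_edges ?G - (internal_edges ?G - {E}) = {E}" using E by blast
    then have "internal_edges (contract ?G (internal_edges ?G - {E})) =
        {component_of (internal_edges ?G - {E}) ` E}"
      using H.internal_edges_contract by simp
    from bridge_tree.one_internal_edge[OF H.bridge_tree_contract this] show ?thesis
      using tree_vertex_eq unfolding H.cluster_contract[OF eE] by metis
  qed
  have "tree_simplex n ?G = (\<lambda>E. tree_vertex n (cluster n ?G E)) ` internal_edges ?G"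
    unfolding tree_simplex_def using type by (auto simp: image_iff)
  also have "\<dots> = (\<lambda>e. tree_vertex n (cluster n ?G (cmp ` e))) ` (internal_edges t - F)"
    unfolding internal_edges_contract by (simp only: image_image)
  also have "\<dots> = (\<lambda>e. tree_vertex n (cluster n t e)) ` (internal_edges t - F)"
  proof (rule image_cong[OF refl])
    fix e assume "e \<in> internal_edges t - F"
    then have "e \<in> edges t - F" by (simp add: internal_edges_def)
    then show "tree_vertex n (cluster n ?G (cmp ` e)) = tree_vertex n (cluster n t e)"
      by (simp only: cluster_contract)
  qed
  finally show ?thesis by (simp only: image_image)
qed

lemma relabel_isomorphic:
  assumes "\<sigma> permutes {1..n}" "isomorphic_trees n t t'"
  shows "isomorphic_trees n (relabel \<sigma> t) (relabel \<sigma> t')"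
proof -
  have "inv' \<sigma> i \<in> {1..n}" if "i \<in> {1..n}" for i using permutes_in_image[OF permutes_inv[OF assms(1)]] that by blast
  moreover obtain f where "bij_betw f (verts t) (verts t')" "edges t' = (\<lambda>e. f ` e) ` edges t"
    "root t' = f (root t)" "\<forall>i\<in>{1..n}. leaf t' i = f (leaf t i)"
    using assms(2) by (auto simp: isomorphic_trees_def)
  ultimately show ?thesis
    unfolding isomorphic_trees_def by (intro exI[of _ f]) (simp add: relabel_def)
qed

lemma relabel_comp:
  assumes "bij \<sigma>" "bij \<tau>"
  shows "relabel (\<sigma> \<circ> \<tau>) t = relabel \<sigma> (relabel \<tau> t)"
  using assms by (simp add: relabel_def o_inv_distrib o_assoc)

lemma relabel_id: "relabel id t = t"
  by (simp add: relabel_def)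

lemma permute_type_comp:
  assumes "bij \<sigma>" "bij \<tau>"
  shows "permute_type (\<sigma> \<circ> \<tau>) = permute_type \<sigma> \<circ> permute_type \<tau>"
proof -
  have "relabel (\<sigma> \<circ> \<tau>) = (\<lambda>t :: nat ltree. relabel \<sigma> (relabel \<tau> t))" using relabel_comp[OF assms] by (rule ext)
  then have "permute_type (\<sigma> \<circ> \<tau>) T = permute_type \<sigma> (permute_type \<tau> T)" for T
    unfolding permute_type_def by (simp only: image_image)
  then show ?thesis by (simp add: fun_eq_iff)
qed

lemma permute_type_id: "permute_type id = id"
proof -
  have "relabel id = (\<lambda>t :: nat ltree. t)" using relabel_id by (rule ext)
  then have "permute_type id T = T" for T unfolding permute_type_def by (simp only: image_ident)
  then show ?thesis by (simp add: fun_eq_iff)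
qed

lemma bij_permute_type:
  assumes "bij \<sigma>"
  shows "bij (permute_type \<sigma>)"
proof (rule o_bij)
  have i: "bij (inv' \<sigma>)" using assms by (rule bij_imp_bij_inv)
  show "permute_type (inv' \<sigma>) \<circ> permute_type \<sigma> = id"
    using assms by (simp add: permute_type_id bij_is_inj flip: permute_type_comp[OF i assms])
  show "permute_type \<sigma> \<circ> permute_type (inv' \<sigma>) = id"
    using assms by (simp add: permute_type_id bij_is_surj surj_iff[THEN iffD1] flip: permute_type_comp[OF assms i])
qed

lemma permute_combinatorial_type:
  assumes \<sigma>: "\<sigma> permutes {1..n}"
  shows "permute_type \<sigma> (combinatorial_type n t) = combinatorial_type n (relabel \<sigma> t)"
proof (intro equalityI subsetI)
  fix t' assume "t' \<in> permute_type \<sigma> (combinatorial_type n t)"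
  then show "t' \<in> combinatorial_type n (relabel \<sigma> t)"
    using relabel_isomorphic[OF \<sigma>] by (auto simp: permute_type_def combinatorial_type_def)
next
  note b = permutes_bij[OF \<sigma>] and i = permutes_inv[OF \<sigma>]
  have cancel: "relabel (inv' \<sigma>) (relabel \<sigma> u) = u" for u :: "'b ltree"
    using relabel_comp[OF permutes_bij[OF i] b] by (metis permutes_inv_o(2)[OF \<sigma>] relabel_id)
  have cancel': "relabel \<sigma> (relabel (inv' \<sigma>) u) = u" for u :: "nat ltree"
    using relabel_comp[OF b permutes_bij[OF i]] by (metis permutes_inv_o(1)[OF \<sigma>] relabel_id)
  fix t' assume "t' \<in> combinatorial_type n (relabel \<sigma> t)"
  then have "isomorphic_trees n t (relabel (inv' \<sigma>) t')"
    using relabel_isomorphic[OF i, of "relabel \<sigma> t" t'] by (simp add: combinatorial_type_def cancel)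
  then have "relabel \<sigma> (relabel (inv' \<sigma>) t') \<in> permute_type \<sigma> (combinatorial_type n t)"
    unfolding permute_type_def combinatorial_type_def by blast
  then show "t' \<in> permute_type \<sigma> (combinatorial_type n t)" by (simp only: cancel')
qed

text \<open>
  The permutation of the labels is itself an isomorphism between the standard trees.
\<close>

lemma permute_tree_vertex:
  assumes \<sigma>: "\<sigma> permutes {1..n}" and S: "S \<subseteq> {1..n}"
  shows "permute_type \<sigma> (tree_vertex n S) = tree_vertex n (\<sigma> ` S)"
proof -
  have fix0: "\<sigma> 0 = 0" "\<sigma> (n + 1) = n + 1" using \<sigma> by (auto simp: permutes_def)
  have mem: "\<sigma> i \<in> \<sigma> ` S \<longleftrightarrow> i \<in> S" for i using permutes_inj[OF \<sigma>] by (simp add: inj_image_mem_iff)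
  have "isomorphic_trees n (relabel \<sigma> (star_tree n S)) (star_tree n (\<sigma> ` S))"
    unfolding isomorphic_trees_def
  proof (intro exI[of _ \<sigma>] conjI)
    have "\<sigma> permutes {0..n + 1}" using permutes_subset[OF \<sigma>] by auto
    then show "bij_betw \<sigma> (verts (relabel \<sigma> (star_tree n S))) (verts (star_tree n (\<sigma> ` S)))"
      using permutes_imp_bij by (simp add: relabel_def)
    have "edges (star_tree n (\<sigma> ` S)) =
        insert {0, n + 1} ((\<lambda>i. {if i \<in> \<sigma> ` S then n + 1 else 0, i}) ` \<sigma> ` {1..n})"
      using permutes_image[OF \<sigma>] by (simp add: star_tree_def)
    also have "\<dots> = insert {0, n + 1} ((\<lambda>i. {if i \<in> S then n + 1 else 0, \<sigma> i}) ` {1..n})"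
      by (simp only: image_image mem)
    also have "\<dots> = (\<lambda>e. \<sigma> ` e) ` insert {0, n + 1} ((\<lambda>i. {if i \<in> S then n + 1 else 0, i}) ` {1..n})"
    proof -
      have "\<sigma> ` {if i \<in> S then n + 1 else 0, i} = {if i \<in> S then n + 1 else 0, \<sigma> i}" for i
        using fix0 by simp
      moreover have "\<sigma> ` {0, n + 1} = {0, n + 1}" using fix0 by simp
      ultimately show ?thesis by (simp only: image_insert[where f = "\<lambda>e. \<sigma> ` e"] image_image)
    qed
    finally show "edges (star_tree n (\<sigma> ` S)) = (\<lambda>e. \<sigma> ` e) ` edges (relabel \<sigma> (star_tree n S))"
      by (simp add: relabel_def star_tree_def)
    show "\<forall>i\<in>{1..n}. leaf (star_tree n (\<sigma> ` S)) i = \<sigma> (leaf (relabel \<sigma> (star_tree n S)) i)"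
      using permutes_inverses(1)[OF \<sigma>] by (simp add: relabel_def)
    show "root (star_tree n (\<sigma> ` S)) = \<sigma> (root (relabel \<sigma> (star_tree n S)))"
      using fix0 by (simp add: relabel_def)
  qed
  then have "combinatorial_type n (relabel \<sigma> (star_tree n S)) = tree_vertex n (\<sigma> ` S)"
    unfolding tree_vertex_def
  proof (rule combinatorial_type_eq)
    show "e \<subseteq> verts (relabel \<sigma> (star_tree n S))" if "e \<in> edges (relabel \<sigma> (star_tree n S))" for e
      using star_tree_wf[of e n S] that by (simp add: relabel_def)
    show "leaf (relabel \<sigma> (star_tree n S)) i \<in> verts (relabel \<sigma> (star_tree n S))" if "i \<in> {1..n}" for i
      using permutes_in_image[OF permutes_inv[OF \<sigma>], of i] that by (simp add: relabel_def)
  qed (simp add: relabel_def)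
  then show ?thesis
    using permute_combinatorial_type[OF \<sigma>] unfolding tree_vertex_def by metis
qed

section \<open>The binary tree of a maximal laminar family\<close>

lemma path_linked:
  assumes "successively (\<lambda>u v. {u, v} \<in> E) p" "p \<noteq> []"
  shows "linked E (hd p) (last p)"
  using assms
proof (induction p rule: rev_induct)
  case (snoc x p)
  show ?case
  proof (cases "p = []")
    case True
    then show ?thesis by (simp add: linked_refl)
  next
    case False
    then have "successively (\<lambda>u v. {u, v} \<in> E) p" "{last p, x} \<in> E"
      using snoc.prems(1) by (simp_all add: successively_append_iff)
    then show ?thesis using snoc.IH False linked_edge by (metis hd_append2 last_snoc)
  qed
qed simp

text \<open>
  A laminar family in which every set with at least two elements splits into two members. Its members, named by
  natural numbers through \<open>h\<close>, become the vertices of a binary tree; the parent of a set is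
  the smallest larger member.
\<close>

locale binary_laminar =
  fixes n :: nat and Fam :: "nat set set" and V :: "nat set" and h :: "nat \<Rightarrow> nat set"
  assumes n: "2 \<le> n" and finite_V: "finite V" and bij_h: "bij_betw h V Fam"
    and laminar: "laminar Fam" and top: "{1..n} \<in> Fam" and single: "i \<in> {1..n} \<Longrightarrow> {i} \<in> Fam"
    and member: "X \<in> Fam \<Longrightarrow> X \<noteq> {} \<and> X \<subseteq> {1..n}"
    and binary: "X \<in> Fam \<Longrightarrow> 2 \<le> card X \<Longrightarrow> \<exists>Y\<in>Fam. \<exists>Z\<in>Fam. Y \<inter> Z = {} \<and> X = Y \<union> Z"
begin

definition vert :: "nat set \<Rightarrow> nat" where
  "vert = inv_into V h"

definition child :: "nat \<Rightarrow> nat \<Rightarrow> bool" where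
  "child u v \<longleftrightarrow> u \<in> V \<and> v \<in> V \<and> h u \<subset> h v \<and> (\<forall>w\<in>V. h u \<subset> h w \<longrightarrow> h v \<subseteq> h w)"

definition tree :: "nat ltree" where
  "tree = \<lparr>verts = V, edges = {{u, v} | u v. child u v}, root = vert {1..n}, leaf = (\<lambda>i. vert {i})\<rparr>"

lemma tree_simps [simp]:
  "verts tree = V" "edges tree = {{u, v} | u v. child u v}" "root tree = vert {1..n}" "leaf tree = (\<lambda>i. vert {i})"
  by (simp_all add: tree_def)

lemma h_in: "v \<in> V \<Longrightarrow> h v \<in> Fam"
  using bij_betwE[OF bij_h] by blast

lemma vert: "X \<in> Fam \<Longrightarrow> vert X \<in> V \<and> h (vert X) = X"
  using bij_betw_inv_into_right[OF bij_h] bij_betwE[OF bij_betw_inv_into[OF bij_h]] by (simp add: vert_def)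

lemma h_inj: "u \<in> V \<Longrightarrow> v \<in> V \<Longrightarrow> h u = h v \<Longrightarrow> u = v"
  using inj_onD[OF bij_betw_imp_inj_on[OF bij_h]] by blast

lemma h_props: "v \<in> V \<Longrightarrow> h v \<noteq> {}" "v \<in> V \<Longrightarrow> h v \<subseteq> {1..n}" "v \<in> V \<Longrightarrow> finite (h v)"
  using member[OF h_in] by (auto intro: finite_subset)

lemma compare:
  assumes "u \<in> V" "v \<in> V"
  shows "h u \<subseteq> h v \<or> h v \<subseteq> h u \<or> h u \<inter> h v = {}"
  using laminar h_in[OF assms(1)] h_in[OF assms(2)] unfolding laminar_def by blast

lemma childD:
  assumes "child u v"
  shows "u \<in> V" "v \<in> V" "h u \<subset> h v" "\<And>w. w \<in> V \<Longrightarrow> h u \<subset> h w \<Longrightarrow> h v \<subseteq> h w" "card (h u) < card (h v)"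
  using assms psubset_card_mono[OF h_props(3)] by (auto simp: child_def)

lemma parent_unique: "child u v \<Longrightarrow> child u w \<Longrightarrow> v = w"
  using childD h_inj by (metis subset_antisym)

lemma root_vert: "vert {1..n} \<in> V" "h (vert {1..n}) = {1..n}"
  using vert[OF top] by simp_all

lemma parent_exists:
  assumes u: "u \<in> V" "h u \<noteq> {1..n}"
  obtains v where "child u v"
proof -
  have "vert {1..n} \<in> V \<and> h u \<subset> h (vert {1..n})" using root_vert h_props(2)[OF u(1)] u(2) by auto
  then obtain v where v: "v \<in> V \<and> h u \<subset> h v" "\<And>w. w \<in> V \<and> h u \<subset> h w \<Longrightarrow> card (h v) \<le> card (h w)"
    using ex_has_least_nat[of "\<lambda>v. v \<in> V \<and> h u \<subset> h v" _ "\<lambda>v. card (h v)"] by blast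
  have "h v \<subseteq> h w" if w: "w \<in> V" "h u \<subset> h w" for w
  proof -
    have "h v \<inter> h w \<noteq> {}" using v(1) w(2) h_props(1)[OF u(1)] by blast
    then consider "h v \<subseteq> h w" | "h w \<subseteq> h v" using compare[of v w] v(1) w(1) by blast
    then show ?thesis
    proof cases
      case 2
      then show ?thesis using card_seteq[OF h_props(3)[of v] 2] v w by simp
    qed
  qed
  then have "child u v" using u(1) v(1) by (simp add: child_def)
  then show ?thesis by (rule that)
qed

text \<open>
  The parts of a splitting \<open>h v = Y \<union> Z\<close> are the maximal proper subsets of \<open>h v\<close>:
  by laminarity any member properly inside \<open>h v\<close> lies inside \<open>Y\<close> or \<open>Z\<close>.
\<close>

lemma children:
  assumes v: "v \<in> V" "2 \<le> card (h v)"
  obtains x y where "x \<noteq> y" "{u. child u v} = {x, y}"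
proof -
  obtain Y Z where YZ: "Y \<in> Fam" "Z \<in> Fam" "Y \<inter> Z = {}" "h v = Y \<union> Z"
    using binary[OF h_in[OF v(1)] v(2)] by blast
  have cover: "child (vert A) v"
    if A: "A \<in> Fam" and B: "B \<in> Fam" and AB: "A \<inter> B = {}" "h v = A \<union> B" for A B
  proof -
    have a: "vert A \<in> V" "h (vert A) = A" and b: "vert B \<in> V" "h (vert B) = B" using vert A B by blast+
    have ne: "A \<noteq> {}" "B \<noteq> {}" using member A B by blast+
    have "h v \<subseteq> h w" if w: "w \<in> V" "A \<subset> h w" for w
    proof -
      consider "h v \<subseteq> h w" | "h w \<subseteq> h v" using compare[OF v(1) w(1)] w(2) ne AB by blast
      then show ?thesis
      proof cases
        case 2
        then have "h w \<inter> B \<noteq> {}" "\<not> h w \<subseteq> B" using w(2) AB ne(1) by blast+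
        then have "B \<subseteq> h w" using compare[OF w(1) b(1)] b(2) by simp
        then show ?thesis using w(2) AB(2) by blast
      qed
    qed
    moreover have "A \<subset> h v" using AB ne(2) by blast
    ultimately show ?thesis using a v(1) by (simp add: child_def)
  qed
  have "Z \<inter> Y = {}" "h v = Z \<union> Y" using YZ(3,4) by blast+
  then have yz: "child (vert Y) v" "child (vert Z) v" using cover[OF YZ] cover[OF YZ(2,1)] by blast+
  have hY: "vert Y \<in> V" "h (vert Y) = Y" and hZ: "vert Z \<in> V" "h (vert Z) = Z"
    using vert[OF YZ(1)] vert[OF YZ(2)] by simp_all
  have ne: "Y \<noteq> {}" "Z \<noteq> {}" using member[OF YZ(1)] member[OF YZ(2)] by simp_all
  have "u = vert Y \<or> u = vert Z" if u: "child u v" for u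
  proof -
    note c = childD[OF u]
    have "\<not> h v \<subseteq> Y" "\<not> h v \<subseteq> Z" using YZ(3,4) ne by blast+
    then have notin: "\<not> h u \<subset> Y" "\<not> h u \<subset> Z"
      using c(4)[OF hY(1)] c(4)[OF hZ(1)] unfolding hY(2) hZ(2) by blast+
    have "\<not> h v \<subseteq> h u" using c(3) by blast
    then have notout: "\<not> Y \<subset> h u" "\<not> Z \<subset> h u"
      using childD(4)[OF yz(1) c(1)] childD(4)[OF yz(2) c(1)] unfolding hY(2) hZ(2) by blast+
    have "h u \<inter> Y \<noteq> {} \<or> h u \<inter> Z \<noteq> {}" using c(3) h_props(1)[OF c(1)] YZ(4) by blast
    moreover have "h u \<subseteq> Y \<or> Y \<subseteq> h u \<or> h u \<inter> Y = {}" "h u \<subseteq> Z \<or> Z \<subseteq> h u \<or> h u \<inter> Z = {}"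
      using compare[OF c(1) hY(1)] compare[OF c(1) hZ(1)] unfolding hY(2) hZ(2) .
    ultimately have "h u = Y \<or> h u = Z" using notin notout by (metis psubsetI)
    then show ?thesis using h_inj[OF c(1) hY(1)] h_inj[OF c(1) hZ(1)] hY(2) hZ(2) by blast
  qed
  then have "{u. child u v} \<subseteq> {vert Y, vert Z}" by blast
  moreover have "{vert Y, vert Z} \<subseteq> {u. child u v}" using yz by simp
  ultimately have "{u. child u v} = {vert Y, vert Z}" by (rule subset_antisym)
  moreover have "vert Y \<noteq> vert Z" using hY(2) hZ(2) YZ(3) ne by (metis Int_absorb)
  ultimately show ?thesis using that by blast
qed

lemma no_children:
  assumes "v \<in> V" "card (h v) < 2"
  shows "{u. child u v} = {}"
proof -
  have False if u: "child u v" for u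
  proof -
    have "card (h u) \<noteq> 0" using h_props(1,3)[OF childD(1)[OF u]] by simp
    then show False using childD(5)[OF u] assms(2) by simp
  qed
  then show ?thesis by blast
qed

lemma edges_at:
  "{e \<in> edges tree. v \<in> e} = (\<lambda>u. {u, v}) ` {u. child u v} \<union> (\<lambda>w. {v, w}) ` {w. child v w}"
  by auto

lemma adjacent_iff: "{u, v} \<in> edges tree \<longleftrightarrow> child u v \<or> child v u"
  by (auto simp: doubleton_eq_iff)

lemma card_child_edges: "card ((\<lambda>u. {u, v}) ` {u. child u v}) = card {u. child u v}"
  by (rule card_image) (auto simp: inj_on_def doubleton_eq_iff)

lemma degree_tree:
  "degree tree v = card {u. child u v} + card {w. child v w}"
proof -
  have "finite {u. child u v}" "finite {w. child v w}"
    using finite_V childD(1,2) by (auto intro!: finite_subset[OF _ finite_V])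
  moreover have "card ((\<lambda>w. {v, w}) ` {w. child v w}) = card {w. child v w}"
    by (rule card_image) (auto simp: inj_on_def doubleton_eq_iff)
  moreover have "(\<lambda>u. {u, v}) ` {u. child u v} \<inter> (\<lambda>w. {v, w}) ` {w. child v w} = {}"
  proof -
    have "{u, v} \<noteq> {v, w}" if uv: "child u v" and vw: "child v w" for u w
      using childD(5)[OF uv] childD(5)[OF vw] by (auto simp: doubleton_eq_iff)
    then show ?thesis by blast
  qed
  ultimately show ?thesis
    unfolding degree_def edges_at by (simp add: card_Un_disjoint card_child_edges)
qed

lemma card_parents:
  assumes "v \<in> V"
  shows "card {w. child v w} = (if h v = {1..n} then 0 else 1)"
proof (cases "h v = {1..n}")
  case True
  have "\<not> child v w" for w using childD(2,3)[of v w] h_props(2)[of w] True by blast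
  then show ?thesis using True by simp
next
  case False
  then obtain w where w: "child v w" using parent_exists assms by blast
  then have "{w. child v w} = {w}" using parent_unique by blast
  then show ?thesis using False by simp
qed

lemma card_children:
  assumes "v \<in> V"
  shows "card {u. child u v} = (if card (h v) < 2 then 0 else 2)"
proof (cases "card (h v) < 2")
  case True
  then show ?thesis using no_children[OF assms] by simp
next
  case False
  then have "2 \<le> card (h v)" by simp
  then obtain x y where "x \<noteq> y" "{u. child u v} = {x, y}" by (rule children[OF assms])
  then show ?thesis using False by simp
qed

lemma leaves_tree: "leaves tree = {v \<in> V. card (h v) < 2}"
proof -
  have "degree tree v = 1 \<longleftrightarrow> card (h v) < 2" if v: "v \<in> V" for v
  proof (cases "card (h v) < 2")
    case True
    then have "h v \<noteq> {1..n}" using n by auto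
    then show ?thesis using True by (simp add: degree_tree card_parents[OF v] card_children[OF v])
  next
    case False
    then show ?thesis by (simp add: degree_tree card_parents[OF v] card_children[OF v])
  qed
  then show ?thesis by (auto simp: leaves_def)
qed

text \<open>
  Induction along the ascent from a vertex to the root, with an invariant that permits to
  avoid some edges.
\<close>

lemma climb:
  assumes step: "\<And>w z. child w z \<Longrightarrow> Q w \<Longrightarrow> {w, z} \<in> E' \<and> Q z" and "w \<in> V" "Q w"
  shows "linked E' w (vert {1..n})"
  using assms(2,3)
proof (induction "n - card (h w)" arbitrary: w rule: less_induct)
  case less
  show ?case
  proof (cases "h w = {1..n}")
    case True
    then have "w = vert {1..n}" using h_inj root_vert less.prems(1) by metis
    then show ?thesis by (simp add: linked_refl)
  next
    case False
    then obtain z where z: "child w z" using parent_exists less.prems(1) by blast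
    have "card (h z) \<le> n" using card_mono[OF _ h_props(2)[OF childD(2)[OF z]]] by simp
    then have "linked E' z (vert {1..n})"
      using less.hyps[of z] childD(2,5)[OF z] step[OF z] less.prems(2) by simp
    moreover have "linked E' w z" by (rule linked_edge[OF linked_refl]) (use step[OF z less.prems(2)] in simp)
    ultimately show ?thesis by (rule linked_trans[rotated])
  qed
qed

lemma linked_tree:
  assumes "u \<in> V" "v \<in> V"
  shows "linked (edges tree) u v"
proof -
  have "linked (edges tree) w (vert {1..n})" if "w \<in> V" for w
    by (rule climb[where Q = "\<lambda>_. True"]) (use that adjacent_iff in auto)
  then show ?thesis using assms linked_sym linked_trans by metis
qed

lemma linked_below:
  assumes uv: "child u v" and yz: "linked (edges tree - {{u, v}}) y z" and y: "y \<in> V" "h y \<subseteq> h u"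
  shows "z \<in> V \<and> h z \<subseteq> h u"
  using yz
proof (induction rule: linked_induct)
  case base
  then show ?case using y by simp
next
  case (step w z)
  then have w: "w \<in> V" "h w \<subseteq> h u" and wz: "{w, z} \<in> edges tree" "{w, z} \<noteq> {u, v}" by blast+
  consider "child w z" | "child z w" using wz(1) adjacent_iff by blast
  then show ?case
  proof cases
    case 1
    have "h w \<noteq> h u"
    proof
      assume "h w = h u"
      then have "w = u" using h_inj w(1) childD(1)[OF uv] by blast
      then show False using parent_unique 1 uv wz(2) by blast
    qed
    then show ?thesis using childD(2,4)[OF 1] childD(1)[OF uv] w(2) by blast
  next
    case 2
    then show ?thesis using childD(1,3)[OF 2] w(2) by blast
  qed
qed

text \<open>
  Both neighbours on a cycle of a vertex with the smallest set would be its parent.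
\<close>

lemma acyclic_tree: "\<not> is_cycle (edges tree) p"
proof
  assume cyc: "is_cycle (edges tree) p"
  let ?k = "length p"
  have k: "3 \<le> ?k" and dist: "distinct p" and ne: "p \<noteq> []" and closing: "{last p, hd p} \<in> edges tree"
    and adj: "\<And>j. Suc j < ?k \<Longrightarrow> {p ! j, p ! Suc j} \<in> edges tree"
    using cyc unfolding is_cycle_def is_path_def successively_conv_nth by blast+
  have close: "{p ! (?k - 1), p ! 0} \<in> edges tree"
    using closing ne by (simp add: last_conv_nth hd_conv_nth del: tree_simps)
  obtain i where i: "i < ?k" "\<And>j. j < ?k \<Longrightarrow> card (h (p ! i)) \<le> card (h (p ! j))"
    using ex_has_least_nat[of "\<lambda>i. i < ?k" 0 "\<lambda>i. card (h (p ! i))"] ne by auto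
  have parent: "child (p ! i) (p ! j)" if "j < ?k" "{p ! i, p ! j} \<in> edges tree" for j
    using that(2) childD(5)[of "p ! j" "p ! i"] i(2)[OF that(1)] unfolding adjacent_iff by auto
  have "\<exists>j j'. j < ?k \<and> j' < ?k \<and> j \<noteq> j' \<and> {p ! i, p ! j} \<in> edges tree \<and> {p ! i, p ! j'} \<in> edges tree"
  proof -
    consider "i = 0" | "i = ?k - 1" | "0 < i" "Suc i < ?k" using i(1) by linarith
    then show ?thesis
    proof cases
      case 1
      have "{p ! i, p ! 1} \<in> edges tree" using adj[of 0] k 1 by (simp del: tree_simps)
      moreover have "{p ! i, p ! (?k - 1)} \<in> edges tree" using close 1 by (simp add: insert_commute del: tree_simps)
      moreover have "1 < ?k" "?k - 1 < ?k" "1 \<noteq> ?k - 1" using k by linarith+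
      ultimately show ?thesis by blast
    next
      case 2
      have "{p ! i, p ! 0} \<in> edges tree" using close 2 by (simp del: tree_simps)
      moreover have "{p ! i, p ! (?k - 2)} \<in> edges tree"
      proof -
        have "Suc (?k - 2) = i" using 2 k by simp
        then show ?thesis using adj[of "?k - 2"] i(1) by (simp add: insert_commute del: tree_simps)
      qed
      moreover have "0 < ?k" "?k - 2 < ?k" "0 \<noteq> ?k - 2" using k by linarith+
      ultimately show ?thesis by blast
    next
      case 3
      have "{p ! i, p ! Suc i} \<in> edges tree" using adj[OF 3(2)] .
      moreover have "{p ! i, p ! (i - 1)} \<in> edges tree"
        using adj[of "i - 1"] 3 by (simp add: insert_commute del: tree_simps)
      moreover have "i - 1 < ?k" "Suc i \<noteq> i - 1" using 3 by linarith+
      ultimately show ?thesis using 3(2) by blast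
    qed
  qed
  then obtain j j' where "j < ?k" "j' < ?k" "j \<noteq> j'" "child (p ! i) (p ! j)" "child (p ! i) (p ! j')"
    using parent by blast
  then show False using parent_unique dist nth_eq_iff_index_eq by metis
qed

lemma is_tree_tree: "is_tree tree"
  unfolding is_tree_def
proof (intro conjI ballI)
  fix e assume "e \<in> edges tree"
  then obtain u v where uv: "e = {u, v}" "child u v" by auto
  have "u \<noteq> v" using childD(5)[OF uv(2)] by auto
  then show "e \<subseteq> verts tree" "card e = 2" using childD(1,2)[OF uv(2)] uv(1) by simp_all
qed (use finite_V linked_tree acyclic_tree in \<open>simp_all del: tree_simps(2)\<close>)

lemma labelled_tree_tree: "labelled_tree n tree"
  unfolding labelled_tree_def rooted_tree_def
proof (intro conjI ballI)
  show "is_tree tree" by (rule is_tree_tree)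
  show "root tree \<in> verts tree" using root_vert by simp
  show "1 < degree tree (root tree)"
    using n root_vert by (simp add: degree_tree card_children card_parents)
  fix v assume v: "v \<in> verts tree - leaves tree - {root tree}"
  then have "v \<in> V" "\<not> card (h v) < 2" "h v \<noteq> {1..n}"
    using h_inj[OF _ root_vert(1), of v] root_vert(2) by (auto simp: leaves_tree)
  then show "3 \<le> degree tree v" by (simp add: degree_tree card_children card_parents)
next
  show "bij_betw (leaf tree) {1..n} (leaves tree)"
  proof (rule bij_betw_imageI)
    show "inj_on (leaf tree) {1..n}"
      using vert[OF single] by (intro inj_onI) (metis singleton_inject tree_simps(4))
    have "vert {i} \<in> leaves tree" if "i \<in> {1..n}" for i
      using vert[OF single[OF that]] by (simp add: leaves_tree)
    moreover have "v \<in> (\<lambda>i. vert {i}) ` {1..n}" if v: "v \<in> leaves tree" for v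
    proof -
      have vV: "v \<in> V" and c: "card (h v) < 2" using v by (simp_all add: leaves_tree)
      then have "card (h v) = 1" using h_props(1,3)[OF vV] by (metis One_nat_def Suc_1 card_0_eq less_2_cases)
      then obtain i where i: "h v = {i}" by (rule card_1_singletonE)
      then have "i \<in> {1..n}" using h_props(2)[OF vV] by simp
      moreover have "v = vert {i}" using h_inj[OF vV] vert[OF single[OF \<open>i \<in> {1..n}\<close>]] i by simp
      ultimately show ?thesis by blast
    qed
    ultimately show "leaf tree ` {1..n} = leaves tree" by auto
  qed
qed

text \<open>
  A path that first descends to \<open>u\<close> never returns to \<open>v\<close> and stays within the vertices below \<open>u\<close>.
\<close>

lemma child_edge_not_upward:
  assumes uv: "child u v" and p: "is_path (edges tree) p" "hd p = v" "last p = root tree"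
  shows "{u, v} \<notin> path_edges p"
proof
  assume "{u, v} \<in> path_edges p"
  then obtain i where i: "Suc i < length p" "{u, v} = {p ! i, p ! Suc i}" by (auto simp: path_edges_def)
  have dist: "distinct p" and ne: "p \<noteq> []" and succ: "successively (\<lambda>x y. {x, y} \<in> edges tree) p"
    using p(1) by (simp_all add: is_path_def del: tree_simps)
  have v0: "p ! 0 = v" using p(2) ne by (simp add: hd_conv_nth)
  have "i = 0"
  proof -
    have "p ! i = p ! 0 \<or> p ! Suc i = p ! 0" using i(2) v0 by (auto simp: doubleton_eq_iff)
    then show ?thesis
      using dist ne i(1) nth_eq_iff_index_eq[of p i 0] nth_eq_iff_index_eq[of p "Suc i" 0] by auto
  qed
  then have "p ! 1 = u" using i v0 childD(3)[OF uv] by (auto simp: doubleton_eq_iff)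
  then obtain q where q: "p = v # u # q"
    using i(1) v0 by (cases p; cases "tl p") auto
  let ?E = "edges tree - {{u, v}}"
  have "successively (\<lambda>x y. {x, y} \<in> ?E) (u # q)"
  proof -
    have "successively (\<lambda>x y. {x, y} \<in> edges tree) (u # q)" using succ q by simp
    moreover have "v \<notin> set (u # q)" using dist q by simp
    ultimately show ?thesis
      by (elim successively_mono) (auto simp: doubleton_eq_iff simp del: tree_simps)
  qed
  then have "linked ?E u (last p)" using path_linked[of ?E "u # q"] q by simp
  from linked_below[OF uv this childD(1)[OF uv] order.refl]
  have "h (root tree) \<subseteq> h u" unfolding p(3) by (rule conjunct2)
  then show False using root_vert(2) childD(1,2,3)[OF uv] h_props(2)[of v] by auto
qed

lemma outdegree_tree:
  assumes "v \<in> V"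
  shows "outdegree tree v = card {u. child u v}"
proof -
  let ?up = "\<lambda>e. \<exists>p. is_path (edges tree) p \<and> hd p = v \<and> last p = root tree \<and> e \<in> path_edges p"
  have up: "?up {v, w}" if w: "child v w" for w
  proof -
    have "linked (edges tree) v (root tree)" using linked_tree[OF assms root_vert(1)] by (simp del: tree_simps(2))
    then obtain p where p: "is_path (edges tree) p" "hd p = v" "last p = root tree" by (rule linked_path)
    have "v \<noteq> root tree" using childD(2,3)[OF w] root_vert(2) h_props(2)[of w] by auto
    then obtain u q where q: "p = v # u # q"
      using p by (cases p; cases "tl p") (auto simp: is_path_def simp del: tree_simps)
    have vu: "{v, u} \<in> path_edges p" unfolding path_edges_def q by (intro CollectI exI[of _ 0]) simp
    have "{v, u} \<in> edges tree" using p(1) q by (simp add: is_path_def del: tree_simps)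
    then consider "child v u" | "child u v" using adjacent_iff by blast
    then show ?thesis
    proof cases
      case 1
      then have "u = w" using parent_unique w by blast
      then show ?thesis using p vu by blast
    next
      case 2
      then show ?thesis using child_edge_not_upward[OF 2 p] vu by (simp add: insert_commute)
    qed
  qed
  have down: "\<not> ?up {u, v}" if "child u v" for u
    using child_edge_not_upward[OF that] by blast
  have "{e \<in> edges tree. v \<in> e \<and> \<not> ?up e} = {e \<in> {e \<in> edges tree. v \<in> e}. \<not> ?up e}" by blast
  also have "\<dots> = (\<lambda>u. {u, v}) ` {u. child u v}"
    unfolding edges_at using up down by blast
  finally show ?thesis unfolding outdegree_def by (simp only: card_child_edges)
qed

lemma binary_tree_tree: "binary_tree n tree"
  unfolding binary_tree_def
  using labelled_tree_tree by (auto simp: outdegree_tree leaves_tree card_children)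

text \<open>
  Without the edge above \<open>u\<close>, the subsets of \<open>h u\<close> are cut off, and everything else can still climb to the root.
\<close>

lemma cluster_tree:
  assumes uv: "child u v"
  shows "cluster n tree {u, v} = h u"
proof -
  let ?E = "edges tree - {{u, v}}"
  have "linked ?E (root tree) (vert {i}) \<longleftrightarrow> i \<notin> h u" if i: "i \<in> {1..n}" for i
  proof
    assume l: "linked ?E (root tree) (vert {i})"
    show "i \<notin> h u"
    proof
      assume "i \<in> h u"
      then have "h (vert {i}) \<subseteq> h u" "vert {i} \<in> V" using vert[OF single[OF i]] by simp_all
      from linked_below[OF uv linked_sym[OF l] this(2,1)]
      have "h (root tree) \<subseteq> h u" by (rule conjunct2)
      then show False using root_vert(2) childD(1,2,3)[OF uv] h_props(2)[of v] by auto
    qed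
  next
    assume ni: "i \<notin> h u"
    have "linked ?E (vert {i}) (vert {1..n})"
    proof (rule climb[where Q = "\<lambda>w. \<not> h w \<subseteq> h u"])
      fix w z assume wz: "child w z" "\<not> h w \<subseteq> h u"
      have "{w, z} \<noteq> {u, v}" using wz childD(3)[OF uv] childD(3)[OF wz(1)] by (auto simp: doubleton_eq_iff)
      then show "{w, z} \<in> ?E \<and> \<not> h z \<subseteq> h u" using wz childD(3)[OF wz(1)] adjacent_iff by blast
    qed (use vert[OF single[OF i]] ni in simp_all)
    then show "linked ?E (root tree) (vert {i})" using linked_sym by simp
  qed
  moreover have "vert {i} \<in> V" if "i \<in> {1..n}" for i using vert[OF single[OF that]] by simp
  ultimately have "i \<in> cluster n tree {u, v} \<longleftrightarrow> i \<in> {1..n} \<and> i \<in> h u" for i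
    unfolding cluster_def below_def by (auto simp del: tree_simps(2))
  then show ?thesis using h_props(2)[OF childD(1)[OF uv]] by blast
qed

lemma clusters_tree: "cluster n tree ` internal_edges tree = {X \<in> Fam. 2 \<le> card X \<and> X \<noteq> {1..n}}"
proof (intro equalityI subsetI)
  fix X assume "X \<in> cluster n tree ` internal_edges tree"
  then obtain e where e: "e \<in> internal_edges tree" "X = cluster n tree e" by blast
  then obtain u v where uv: "e = {u, v}" "child u v" by (auto simp: internal_edges_def)
  have X: "X = h u" using cluster_tree[OF uv(2)] e(2) uv(1) by simp
  have "u \<notin> leaves tree" using e(1) uv(1) by (auto simp: internal_edges_def)
  then have "2 \<le> card (h u)" using childD(1)[OF uv(2)] by (auto simp: leaves_tree)
  moreover have "h u \<noteq> {1..n}" using childD(2,3)[OF uv(2)] h_props(2)[of v] by blast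
  ultimately show "X \<in> {X \<in> Fam. 2 \<le> card X \<and> X \<noteq> {1..n}}"
    using X h_in[OF childD(1)[OF uv(2)]] by simp
next
  fix X assume "X \<in> {X \<in> Fam. 2 \<le> card X \<and> X \<noteq> {1..n}}"
  then have X: "X \<in> Fam" "2 \<le> card X" "X \<noteq> {1..n}" by simp_all
  note u = vert[OF X(1)]
  obtain v where v: "child (vert X) v" using parent_exists[of "vert X"] u X(3) by auto
  have "{vert X, v} \<inter> leaves tree = {}"
    using childD(5)[OF v] u X(2) by (auto simp: leaves_tree)
  then have "{vert X, v} \<in> internal_edges tree" using v by (auto simp: internal_edges_def)
  then show "X \<in> cluster n tree ` internal_edges tree"
    using cluster_tree[OF v] u by (metis image_eqI)
qed

end

lemma binary_tree_of_merge_order: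
  assumes n: "2 \<le> n" and Bs: "Bs \<in> merge_orders n"
  obtains t :: "nat ltree" where "binary_tree n t" "cluster n t ` internal_edges t = set Bs"
proof -
  let ?Fam = "singletons n \<union> set Bs \<union> {{1..n}}"
  note L = merge_order_laminar[OF Bs]
  have "finite ?Fam" by (simp add: singletons_def)
  from ex_bij_betw_nat_finite[OF this] obtain h where h: "bij_betw h {0..<card ?Fam} ?Fam" ..
  have sizes: "X \<subseteq> {1..n} \<and> X \<noteq> {}" if "X \<in> ?Fam" for X
  proof -
    consider "X \<in> singletons n" | "X \<in> clusters n" | "X = {1..n}" using \<open>X \<in> ?Fam\<close> L(3) by blast
    then show ?thesis
    proof cases
      case 1
      then obtain i where "i \<in> {1..n}" "X = {i}" unfolding singletons_def by blast
      then show ?thesis by simp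
    next
      case 2
      then have "X \<subseteq> {1..n}" "2 \<le> card X" by (auto simp: clusters_def)
      moreover from this have "X \<noteq> {}" by (metis card.empty not_numeral_le_zero)
      ultimately show ?thesis by simp
    next
      case 3
      then show ?thesis using n by simp
    qed
  qed
  interpret binary_laminar n ?Fam "{0..<card ?Fam}" h
  proof
    show "X \<noteq> {} \<and> X \<subseteq> {1..n}" if "X \<in> ?Fam" for X
      using sizes[OF that] by auto
    show "\<exists>Y\<in>?Fam. \<exists>Z\<in>?Fam. Y \<inter> Z = {} \<and> X = Y \<union> Z" if X: "X \<in> ?Fam" "2 \<le> card X" for X
    proof -
      have "X \<notin> singletons n" using X(2) by (auto simp: singletons_def)
      then have "X \<in> set Bs \<union> {{1..n}}" using X(1) by blast
      from L(7)[OF this] show ?thesis by blast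
    qed
    show "{i} \<in> ?Fam" if "i \<in> {1..n}" for i using that unfolding singletons_def by blast
    show "{1..n} \<in> ?Fam" by blast
  qed (use n h L(1) in simp_all)
  have "{X \<in> ?Fam. 2 \<le> card X \<and> X \<noteq> {1..n}} = set Bs"
  proof (intro equalityI subsetI)
    fix X assume X: "X \<in> {X \<in> ?Fam. 2 \<le> card X \<and> X \<noteq> {1..n}}"
    then have "X \<notin> singletons n" by (auto simp: singletons_def)
    then show "X \<in> set Bs" using X by blast
  next
    fix X assume X: "X \<in> set Bs"
    then have "X \<in> clusters n" using L(3) by blast
    then show "X \<in> {X \<in> ?Fam. 2 \<le> card X \<and> X \<noteq> {1..n}}" using X unfolding clusters_def by blast
  qed
  then show ?thesis using that[OF binary_tree_tree] clusters_tree by simp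
qed

section \<open>The complex of trees as a complex of nested sets\<close>

lemma tree_simplex_clusters:
  assumes "binary_tree n t" "F \<subseteq> internal_edges t"
  shows "tree_simplex n (contract t F) = tree_vertex n ` cluster n t ` (internal_edges t - F)"
    and "cluster n t ` internal_edges t \<subseteq> clusters n" "laminar (cluster n t ` internal_edges t)"
proof -
  have lt: "labelled_tree n t" using assms(1) by (simp add: binary_tree_def)
  interpret bridge_tree n t by (rule labelled_tree_bridge_tree[OF lt])
  interpret contracted_tree n t F by unfold_locales (rule assms(2))
  show "tree_simplex n (contract t F) = tree_vertex n ` cluster n t ` (internal_edges t - F)"
    by (rule tree_simplex_contract)
  have "\<And>v. v \<in> verts t - leaves t - {root t} \<Longrightarrow> 3 \<le> degree t v"
    using lt by (simp add: labelled_tree_def rooted_tree_def)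
  then show "cluster n t ` internal_edges t \<subseteq> clusters n" using cluster_in_clusters by blast
  have "internal_edges t \<subseteq> edges t" by (auto simp: internal_edges_def)
  then show "laminar (cluster n t ` internal_edges t)"
    using cluster_laminar unfolding laminar_def by blast
qed

lemma tree_complex_clusters:
  assumes "X \<in> tree_complex n"
  obtains L where "L \<subseteq> clusters n" "laminar L" "X = tree_vertex n ` L"
proof -
  obtain t :: "nat ltree" and F where t: "binary_tree n t" "F \<subseteq> internal_edges t"
    and X: "X = tree_simplex n (contract t F)"
    using assms unfolding tree_complex_def by blast
  note c = tree_simplex_clusters[OF t]
  let ?L = "cluster n t ` (internal_edges t - F)"
  have sub: "?L \<subseteq> cluster n t ` internal_edges t" by blast
  then have "laminar ?L" using c(3) unfolding laminar_def by blast
  moreover have "?L \<subseteq> clusters n" using sub c(2) by (rule order.trans)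
  ultimately show ?thesis using that c(1) X by blast
qed

lemma inj_on_tree_vertex: "inj_on (tree_vertex n) (clusters n)"
  using tree_vertex_inj by (intro inj_onI) (auto simp: clusters_def)

text \<open>
  The bound on the cardinality of laminar families limits the dimension of \<open>T\<^sub>n\<close>, and its maximal simplices are
  identified by constructing a binary tree for each merge order.
\<close>

theorem equivariant_cluster_complex_tree_complex:
  assumes n: "3 \<le> n"
  shows "equivariant_cluster_complex n (tree_complex n) (tree_vertex n) permute_type"
proof
  have n2: "2 \<le> n" using n by simp
  show "3 \<le> n" by (rule n)
  show "inj_on (tree_vertex n) (clusters n)" by (rule inj_on_tree_vertex)
  show "tree_vertex n ` set Bs \<in> tree_complex n" if Bs: "Bs \<in> merge_orders n" for Bs
  proof -
    obtain t :: "nat ltree" where t: "binary_tree n t" "cluster n t ` internal_edges t = set Bs"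
      using binary_tree_of_merge_order[OF n2 Bs] .
    have "tree_simplex n (contract t {}) = tree_vertex n ` set Bs"
      using tree_simplex_clusters(1)[OF t(1), of "{}"] t(2) by simp
    then show ?thesis using t(1) unfolding tree_complex_def by blast
  qed
  have card: "card X + 2 \<le> n \<and> (card X + 2 = n \<longrightarrow> (\<exists>Bs\<in>merge_orders n. X = tree_vertex n ` set Bs))"
    if X: "X \<in> tree_complex n" for X
  proof -
    obtain L where L: "L \<subseteq> clusters n" "laminar L" "X = tree_vertex n ` L"
      using tree_complex_clusters[OF X] .
    have "card X = card L" unfolding L(3) by (rule card_image[OF inj_on_subset[OF inj_on_tree_vertex L(1)]])
    then show ?thesis using laminar_family_merge_order[OF n2 L(1,2)] L(3) by auto
  qed
  show "card X + 2 \<le> n" if "X \<in> tree_complex n" for X using card[OF that] by simp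
  show "\<exists>Bs\<in>merge_orders n. X = tree_vertex n ` set Bs" if "X \<in> tree_complex n" "card X + 2 = n" for X
    using card[OF that(1)] that(2) by simp
  show "bij (permute_type \<sigma>)" if "\<sigma> permutes {1..n}" for \<sigma>
    by (rule bij_permute_type[OF permutes_bij[OF that]])
  show "permute_type id = id" by (rule permute_type_id)
  show "permute_type (\<sigma> \<circ> \<tau>) = permute_type \<sigma> \<circ> permute_type \<tau>"
    if "\<sigma> permutes {1..n}" "\<tau> permutes {1..n}" for \<sigma> \<tau>
    by (rule permute_type_comp[OF permutes_bij[OF that(1)] permutes_bij[OF that(2)]])
  show "permute_type \<sigma> (tree_vertex n B) = tree_vertex n (\<sigma> ` B)"
    if "\<sigma> permutes {1..n}" "B \<in> clusters n" for \<sigma> B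
    by (rule permute_tree_vertex[OF that(1)]) (use that(2) in \<open>auto simp: clusters_def\<close>)
qed

theorem corollary3p3:
  fixes n :: nat
  assumes "n \<ge> 3"
  shows "isomorphic_group_modules (sym_group n)
    (reduced_simplicial_homology (tree_complex n) (n - 3))
    (\<lambda>\<sigma>. homology_map (tree_complex n) (n - 3) (permute_type \<sigma>))
    (reduced_simplicial_homology (partition_complex n) (n - 3))
    (\<lambda>\<sigma>. homology_map (partition_complex n) (n - 3) (permute_partition \<sigma>))"
  by (rule equivariant_cluster_complex.top_homology_isomorphic[OF
        equivariant_cluster_complex_tree_complex[OF assms]])

end
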